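(* Let $\mathcal N$ be an irreducible weight module for the Weyl vertex algebra $M$, and let $F$ be the Clifford vertex algebra. Then $\mathcal N\otimes F$ is a completely reducible $V_1(gl(1\vert1))$-module.
   Context: **Weyl vertex algebra.** The Weyl algebra $\widehat{\mathcal A}$ is the associative algebra with generators $a(n),a^*(n)$ ($n\in\mathbb Z$) and relations $[a(n),a^*(m)]=\delta_{n+m,0}$, $[a(n),a(m)]=[a^*(n),a^*(m)]=0$. Let $M$ be the simple $\widehat{\mathcal A}$-module generated by $\mathbf 1$ with $a(n)\mathbf 1=a^*(n+1)\mathbf 1=0$ for $n\ge0$, with its vertex algebra structure $Y(a(-1)\mathbf 1,z)=\sum_n a(n)z^{-n-1}$, $Y(a^*(0)\mathbf 1,z)=\sum_n a^*(n)z^{-n}$. Put $\omega=a(-1)a^*(-1)\mathbf 1$, $Y(\omega,z)=\sum_nL(n)z^{-n-2}$, $\beta=a(-1)a^*(0)\mathbf 1$, $Y(\beta,z)=\sum_n\beta(n)z^{-n-1}$. An $M$-module is called weight if $\beta(0)$ and $L(0)$ act semisimply on it. **Clifford vertex algebra.** $F$ is the vertex superalgebra generated by odd fields $\psi(z)=\sum_{n\in\mathbb Z}\psi(n+\frac12)z^{-n-1}$, $\psi^*(z)=\sum_{n\in\mathbb Z}\psi^*(n+\frac12)z^{-n-1}$ whose modes satisfy the (anti)commutation relations $[\psi(r),\psi^*(s)]=\delta_{r+s,0}$, $[\psi(r),\psi(s)]=[\psi^*(r),\psi^*(s)]=0$; as a vector space $F\cong\bigwedge(\{\psi(r),\psi^*(s)\mid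 r,s<0\})$. Let $\gamma=\psi(-\frac12)\psi^*(-\frac12)\mathbf 1$. **Affine $gl(1|1)$.** $\mathfrak g=gl(1\vert1)$ has even basis $E,N$ and odd basis $\Psi^\pm$ with $[\Psi^+,\Psi^-]=E$, $[E,\cdot]=0$, $[N,\Psi^\pm]=\pm\Psi^\pm$, other brackets trivial, and invariant supersymmetric form $(\Psi^+,\Psi^-)=-(\Psi^-,\Psi^+)=1$, $(N,E)=(E,N)=1$, other products $0$. The affine Lie superalgebra is $\hat{\mathfrak g}=\mathfrak g\otimes\mathbb C[t,t^{-1}]+\mathbb CK$, $[x(n),y(m)]=[x,y](n+m)+n(x,y)\delta_{n+m,0}K$, $K$ central, $x(n)=x\otimes t^n$. $V_1(\mathfrak g)=V_1(gl(1|1))$ is the simple affine vertex superalgebra of level $1$. The vectors $\Psi^+=a(-1)\psi$, $\Psi^-=a^*(0)\psi^*$, $E=\gamma+\beta$, $N=\frac12(\gamma-\beta)$ of $M\otimes F$ (where $\psi=\psi(-\frac12)\mathbf 1$, $\psi^*=\psi^*(-\frac12)\mathbf 1$) generate a level-$1$ action of $\hat{\mathfrak g}$, and the vertex subalgebra they generate is isomorphic to $V_1(\mathfrak g)$ (it equals the kernel of $E(0)$ on $M\otimes F$). Every $M\otimes F$-module is thereby a $V_1(\mathfrak g)$-module. Completely reducible means a direct sum of irreducible submodules. *)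

theory Defs
  imports Complex_Main "HOL-Library.Poly_Mapping" "HOL-Library.Z2"
begin

section \<open>Complex vector spaces\<close>

class complex_space = ab_group_add +
  fixes scaleC :: "complex \<Rightarrow> 'a \<Rightarrow> 'a" (infixr \<open>*\<^sub>C\<close> 75)
  assumes scaleC_add_right: "c *\<^sub>C (x + y) = c *\<^sub>C x + c *\<^sub>C y"
    and scaleC_add_left: "(c + d) *\<^sub>C x = c *\<^sub>C x + d *\<^sub>C x"
    and scaleC_scaleC: "c *\<^sub>C (d *\<^sub>C x) = (c * d) *\<^sub>C x"
    and scaleC_one: "1 *\<^sub>C x = x"

global_interpretation cvs: vector_space "scaleC :: complex \<Rightarrow> 'a::complex_space \<Rightarrow> 'a"
  by unfold_locales (simp_all add: scaleC_add_right scaleC_add_left scaleC_scaleC scaleC_one)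

abbreviation clinear :: "('a::complex_space \<Rightarrow> 'b::complex_space) \<Rightarrow> bool"
  where "clinear \<equiv> Vector_Spaces.linear scaleC scaleC"

definition cbilinear :: "('a::complex_space \<Rightarrow> 'b::complex_space \<Rightarrow> 'c::complex_space) \<Rightarrow> bool"
  where "cbilinear f \<longleftrightarrow> (\<forall>x. clinear (f x)) \<and> (\<forall>y. clinear (\<lambda>x. f x y))"

definition diagonalizable :: "('a::complex_space \<Rightarrow> 'a) \<Rightarrow> bool"
  where "diagonalizable f \<longleftrightarrow> cvs.span {w. \<exists>c. f w = c *\<^sub>C w} = UNIV"


section \<open>Tensor products\<close>

text \<open>The free vector space on \<open>'a \<times> 'b\<close> modulo the bilinearity relations.\<close>

definition free_scale :: "complex \<Rightarrow> ('x \<Rightarrow>\<^sub>0 complex) \<Rightarrow> ('x \<Rightarrow>\<^sub>0 complex)"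
  where "free_scale c p = Poly_Mapping.map ((*) c) p"

lemma lookup_free_scale [simp]: "Poly_Mapping.lookup (free_scale c p) x = c * Poly_Mapping.lookup p x"
  by (simp add: free_scale_def Poly_Mapping.map.rep_eq when_def)

global_interpretation free: vector_space "free_scale :: complex \<Rightarrow> ('x \<Rightarrow>\<^sub>0 complex) \<Rightarrow> _"
  by unfold_locales (auto intro!: poly_mapping_eqI simp: lookup_add algebra_simps)

definition tensor_relations ::
  "(('a::complex_space \<times> 'b::complex_space) \<Rightarrow>\<^sub>0 complex) set" where
  "tensor_relations =
     {Poly_Mapping.single (x + x', y) 1 - Poly_Mapping.single (x, y) 1 - Poly_Mapping.single (x', y) 1 |x x' y. True} \<union>
     {Poly_Mapping.single (x, y + y') 1 - Poly_Mapping.single (x, y) 1 - Poly_Mapping.single (x, y') 1 |x y y'. True} \<union>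
     {Poly_Mapping.single (c *\<^sub>C x, y) 1 - Poly_Mapping.single (x, y) c |c x y. True} \<union>
     {Poly_Mapping.single (x, c *\<^sub>C y) 1 - Poly_Mapping.single (x, y) c |c x y. True}"

definition tensor_eq ::
  "(('a::complex_space \<times> 'b::complex_space) \<Rightarrow>\<^sub>0 complex) \<Rightarrow> (('a \<times> 'b) \<Rightarrow>\<^sub>0 complex) \<Rightarrow> bool"
  where "tensor_eq p q \<longleftrightarrow> p - q \<in> free.span tensor_relations"

lemma equivp_tensor_eq: "equivp tensor_eq"
proof (rule equivpI)
  show "reflp tensor_eq"
    by (auto simp: reflp_def tensor_eq_def free.span_zero)
  show "symp tensor_eq"
    by (rule sympI) (unfold tensor_eq_def, drule free.span_neg, simp)
  show "transp tensor_eq"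
    by (rule transpI) (unfold tensor_eq_def, drule (1) free.span_add, simp)
qed

quotient_type (overloaded) ('a, 'b) tensor =
  "(('a::complex_space \<times> 'b::complex_space) \<Rightarrow>\<^sub>0 complex)" / tensor_eq
  by (rule equivp_tensor_eq)

instantiation tensor :: (complex_space, complex_space) complex_space
begin

lift_definition zero_tensor :: "('a, 'b) tensor" is 0 .

lift_definition plus_tensor :: "('a, 'b) tensor \<Rightarrow> ('a, 'b) tensor \<Rightarrow> ('a, 'b) tensor" is "(+)"
  unfolding tensor_eq_def by (drule (1) free.span_add) (simp add: algebra_simps)

lift_definition minus_tensor :: "('a, 'b) tensor \<Rightarrow> ('a, 'b) tensor \<Rightarrow> ('a, 'b) tensor" is "(-)"
  unfolding tensor_eq_def by (drule (1) free.span_diff) (simp add: algebra_simps)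

lift_definition uminus_tensor :: "('a, 'b) tensor \<Rightarrow> ('a, 'b) tensor" is uminus
  unfolding tensor_eq_def by (drule free.span_neg) simp

lift_definition scaleC_tensor :: "complex \<Rightarrow> ('a, 'b) tensor \<Rightarrow> ('a, 'b) tensor" is free_scale
  unfolding tensor_eq_def
  by (drule free.span_scale) (simp add: free.scale_right_diff_distrib)

instance
proof
  fix x y z :: "('a, 'b) tensor" and c d :: complex
  have refl: "tensor_eq p p" for p :: "('a \<times> 'b) \<Rightarrow>\<^sub>0 complex"
    by (rule equivp_reflp[OF equivp_tensor_eq])
  have eq: "p = q \<Longrightarrow> tensor_eq p q" for p q :: "('a \<times> 'b) \<Rightarrow>\<^sub>0 complex"
    using refl by simp
  show "x + y + z = x + (y + z)" by transfer (rule eq, simp add: add.assoc)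
  show "x + y = y + x" by transfer (rule eq, simp add: add.commute)
  show "0 + x = x" by transfer (rule eq, simp)
  show "- x + x = 0" by transfer (rule eq, simp)
  show "x - y = x + - y" by transfer (rule eq, simp)
  show "c *\<^sub>C (x + y) = c *\<^sub>C x + c *\<^sub>C y"
    by transfer (rule eq, simp add: free.scale_right_distrib)
  show "(c + d) *\<^sub>C x = c *\<^sub>C x + d *\<^sub>C x"
    by transfer (rule eq, simp add: free.scale_left_distrib)
  show "c *\<^sub>C (d *\<^sub>C x) = (c * d) *\<^sub>C x" by transfer (rule eq, simp)
  show "1 *\<^sub>C x = x" by transfer (rule eq, simp)
qed

end

lift_definition pure_tensor ::
  "'a::complex_space \<Rightarrow> 'b::complex_space \<Rightarrow> ('a, 'b) tensor" (infixl \<open>\<otimes>\<close> 72)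
  is "\<lambda>x y. Poly_Mapping.single (x, y) 1" .

text \<open>\<open>tensor_lift f\<close> is evaluated on a chosen representative; for bilinear \<open>f\<close> it is the linear map
  with \<open>tensor_lift f (x \<otimes> y) = f x y\<close>, as the lemmas below record.\<close>

definition formal_eval ::
  "('a \<Rightarrow> 'b \<Rightarrow> 'c::complex_space) \<Rightarrow> (('a \<times> 'b) \<Rightarrow>\<^sub>0 complex) \<Rightarrow> 'c"
  where "formal_eval f p = (\<Sum>(x, y)\<in>Poly_Mapping.keys p. Poly_Mapping.lookup p (x, y) *\<^sub>C f x y)"

definition tensor_lift ::
  "('a::complex_space \<Rightarrow> 'b::complex_space \<Rightarrow> 'c::complex_space) \<Rightarrow> ('a, 'b) tensor \<Rightarrow> 'c"
  where "tensor_lift f t = formal_eval f (rep_tensor t)"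

lemma formal_eval_superset:
  assumes "finite A" "Poly_Mapping.keys p \<subseteq> A"
  shows "formal_eval f p = (\<Sum>(x, y)\<in>A. Poly_Mapping.lookup p (x, y) *\<^sub>C f x y)"
  unfolding formal_eval_def
  by (rule sum.mono_neutral_left) (use assms in \<open>auto simp: in_keys_iff\<close>)

lemma formal_eval_add: "formal_eval f (p + q) = formal_eval f p + formal_eval f q"
proof -
  let ?A = "Poly_Mapping.keys p \<union> Poly_Mapping.keys q"
  have "formal_eval f (p + q) = (\<Sum>(x, y)\<in>?A. Poly_Mapping.lookup (p + q) (x, y) *\<^sub>C f x y)"
    by (rule formal_eval_superset) (auto simp: in_keys_iff lookup_add)
  also have "\<dots> = (\<Sum>(x, y)\<in>?A. Poly_Mapping.lookup p (x, y) *\<^sub>C f x y) + (\<Sum>(x, y)\<in>?A. Poly_Mapping.lookup q (x, y) *\<^sub>C f x y)"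
    by (simp add: lookup_add cvs.scale_left_distrib sum.distrib split_def)
  also have "\<dots> = formal_eval f p + formal_eval f q"
    using formal_eval_superset[of ?A p f] formal_eval_superset[of ?A q f] by simp
  finally show ?thesis .
qed

lemma formal_eval_scale: "formal_eval f (free_scale c p) = c *\<^sub>C formal_eval f p"
proof -
  have "formal_eval f (free_scale c p) = (\<Sum>(x, y)\<in>Poly_Mapping.keys p. Poly_Mapping.lookup (free_scale c p) (x, y) *\<^sub>C f x y)"
    by (rule formal_eval_superset) (auto simp: in_keys_iff)
  then show ?thesis
    by (simp add: formal_eval_def cvs.scale_sum_right split_def)
qed

lemma linear_formal_eval: "Vector_Spaces.linear free_scale scaleC (formal_eval f)"
  by unfold_locales (simp_all add: formal_eval_add formal_eval_scale)

lemma formal_eval_single: "formal_eval f (Poly_Mapping.single (x, y) c) = c *\<^sub>C f x y"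
  using formal_eval_superset[of "{(x, y)}" "Poly_Mapping.single (x, y) c" f] by (simp add: keys_single)

lemma formal_eval_diff: "formal_eval f (p - q) = formal_eval f p - formal_eval f q"
  by (rule module_hom.diff[OF Vector_Spaces.linear.axioms(3)[OF linear_formal_eval]])

lemma formal_eval_cong:
  assumes f: "cbilinear f" and "tensor_eq p q"
  shows "formal_eval f p = formal_eval f q"
proof -
  have l: "module_hom scaleC scaleC (f x)" and r: "module_hom scaleC scaleC (\<lambda>x. f x y)" for x y
    using f by (auto simp: cbilinear_def Vector_Spaces.linear_def)
  have gen: "formal_eval f r = 0" if "r \<in> tensor_relations" for r
    using that
    by (auto simp: tensor_relations_def formal_eval_diff formal_eval_single
        module_hom.add[OF l] module_hom.add[OF r] module_hom.scale[OF l] module_hom.scale[OF r])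
  have "formal_eval f r = 0" if "r \<in> free.span tensor_relations" for r
    using that
  proof (induction rule: free.span_induct_alt)
    case base
    show ?case by (simp add: formal_eval_def)
  next
    case (step c x y)
    then show ?case by (simp add: formal_eval_add formal_eval_scale gen)
  qed
  then show ?thesis
    using assms(2) formal_eval_diff[of f p q] by (simp add: tensor_eq_def)
qed

lemma tensor_lift_abs:
  assumes "cbilinear f"
  shows "tensor_lift f (abs_tensor p) = formal_eval f p"
  unfolding tensor_lift_def
  by (rule formal_eval_cong[OF assms])
    (rule rep_abs_rsp_left[OF Quotient3_tensor equivp_reflp[OF equivp_tensor_eq]])

lemma tensor_lift_pure [simp]:
  "cbilinear f \<Longrightarrow> tensor_lift f (x \<otimes> y) = f x y"
  by (simp add: pure_tensor.abs_eq tensor_lift_abs formal_eval_single)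

lemma clinear_tensor_lift:
  assumes "cbilinear f"
  shows "clinear (tensor_lift f)"
proof
  fix s t :: "('a, 'b) tensor" and c :: complex
  obtain p q where "s = abs_tensor p" "t = abs_tensor q"
    by (metis Quotient3_abs_rep Quotient3_tensor)
  then show "tensor_lift f (s + t) = tensor_lift f s + tensor_lift f t"
    and "tensor_lift f (c *\<^sub>C s) = c *\<^sub>C tensor_lift f s"
    by (simp_all add: plus_tensor.abs_eq scaleC_tensor.abs_eq tensor_lift_abs[OF assms]
        formal_eval_add formal_eval_scale)
qed


section \<open>Vertex superalgebras and their modules\<close>

text \<open>\<open>mode V u n v\<close> is \<open>u\<^sub>(\<^sub>n\<^sub>) v\<close>, where \<open>Y(u, z) = \<Sum>\<^sub>n u\<^sub>(\<^sub>n\<^sub>) z^(- n - 1)\<close>; \<open>part V p\<close> is the subspace of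
  parity \<open>p \<in> \<int>/2\<close>.\<close>

record 'v vertex_structure =
  vacuum :: 'v
  mode :: "'v \<Rightarrow> int \<Rightarrow> 'v \<Rightarrow> 'v"
  part :: "bit \<Rightarrow> 'v set"

definition koszul :: "bit \<Rightarrow> bit \<Rightarrow> complex"
  where "koszul p q = (if p = 1 \<and> q = 1 then - 1 else 1)"

text \<open>The Jacobi identity in component form. The sums range over all \<open>j \<ge> 0\<close>; by truncation only
  finitely many terms are nonzero, so \<^const>\<open>Sum_any\<close> gives the intended value.\<close>

definition borcherds_identity ::
  "'v::complex_space vertex_structure \<Rightarrow> ('v \<Rightarrow> int \<Rightarrow> 'w::complex_space \<Rightarrow> 'w) \<Rightarrow> bool" where
  "borcherds_identity V act \<longleftrightarrow>
     (\<forall>p q. \<forall>u\<in>part V p. \<forall>v\<in>part V q. \<forall>w. \<forall>l m n :: int.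
        Sum_any (\<lambda>j::nat. (of_int m gchoose j) *\<^sub>C act (mode V u (l + int j) v) (m + n - int j) w) =
        Sum_any (\<lambda>j::nat. ((- 1) ^ j * (of_int l gchoose j)) *\<^sub>C
                      act u (m + l - int j) (act v (n + int j) w)) -
        Sum_any (\<lambda>j::nat. (koszul p q * (- 1) powi l * (- 1) ^ j * (of_int l gchoose j)) *\<^sub>C
                      act v (l + n - int j) (act u (m + int j) w)))"

text \<open>A module is not required to carry a parity: the parity of the algebra enters only through
  the sign in the Jacobi identity. Likewise submodules and ideals below are not required to be
  graded. For \<open>V\<^sub>1(gl(1|1))\<close> this makes no difference: there \<open>\<gamma> = E/2 + N\<close> is available, and in
  \<open>V\<^sub>1(gl(1|1))\<close> and \<open>\<N> \<otimes> F\<close> the parity is that of the eigenvalue of the semisimple operator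
  \<open>\<gamma>(0)\<close>, so every submodule or ideal is graded automatically.\<close>

definition vertex_module ::
  "'v::complex_space vertex_structure \<Rightarrow> ('v \<Rightarrow> int \<Rightarrow> 'w::complex_space \<Rightarrow> 'w) \<Rightarrow> bool" where
  "vertex_module V act \<longleftrightarrow>
     (\<forall>n. cbilinear (\<lambda>v. act v n)) \<and>
     (\<forall>v w. \<exists>K. \<forall>n\<ge>K. act v n w = 0) \<and>
     (\<forall>n w. act (vacuum V) n w = (if n = - 1 then w else 0)) \<and>
     borcherds_identity V act"

definition vertex_superalgebra :: "'v::complex_space vertex_structure \<Rightarrow> bool" where
  "vertex_superalgebra V \<longleftrightarrow>
     (\<forall>p. cvs.subspace (part V p)) \<and>
     part V 0 \<inter> part V 1 = {0} \<and> (\<forall>v. \<exists>x\<in>part V 0. \<exists>y\<in>part V 1. v = x + y) \<and>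
     vacuum V \<in> part V 0 \<and>
     (\<forall>p q n. \<forall>u\<in>part V p. \<forall>v\<in>part V q. mode V u n v \<in> part V (p + q)) \<and>
     (\<forall>v. mode V v (- 1) (vacuum V) = v) \<and> (\<forall>v. \<forall>n\<ge>0. mode V v n (vacuum V) = 0) \<and>
     vertex_module V (mode V)"

definition vertex_algebra :: "'v::complex_space vertex_structure \<Rightarrow> bool"
  where "vertex_algebra V \<longleftrightarrow> vertex_superalgebra V \<and> part V 1 = {0}"

definition vertex_subalgebra :: "'v::complex_space vertex_structure \<Rightarrow> 'v set \<Rightarrow> bool" where
  "vertex_subalgebra V A \<longleftrightarrow>
     cvs.subspace A \<and> vacuum V \<in> A \<and> (\<forall>u\<in>A. \<forall>v\<in>A. \<forall>n. mode V u n v \<in> A)"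

definition vertex_generated :: "'v::complex_space vertex_structure \<Rightarrow> 'v set \<Rightarrow> bool"
  where "vertex_generated V S \<longleftrightarrow> (\<forall>A. vertex_subalgebra V A \<and> S \<subseteq> A \<longrightarrow> A = UNIV)"

definition vertex_ideal :: "'v::complex_space vertex_structure \<Rightarrow> 'v set \<Rightarrow> bool" where
  "vertex_ideal V I \<longleftrightarrow>
     cvs.subspace I \<and> (\<forall>u. \<forall>v\<in>I. \<forall>n. mode V u n v \<in> I \<and> mode V v n u \<in> I)"

definition simple_vertex_superalgebra :: "'v::complex_space vertex_structure \<Rightarrow> bool" where
  "simple_vertex_superalgebra V \<longleftrightarrow>
     vertex_superalgebra V \<and> vacuum V \<noteq> 0 \<and> (\<forall>I. vertex_ideal V I \<longrightarrow> I = {0} \<or> I = UNIV)"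

definition vertex_hom ::
  "'v::complex_space vertex_structure \<Rightarrow> 'u::complex_space vertex_structure \<Rightarrow> ('v \<Rightarrow> 'u) \<Rightarrow> bool" where
  "vertex_hom V U h \<longleftrightarrow>
     clinear h \<and> h (vacuum V) = vacuum U \<and> (\<forall>p. h ` part V p \<subseteq> part U p) \<and>
     (\<forall>u n v. h (mode V u n v) = mode U (h u) n (h v))"

definition submodule :: "('v \<Rightarrow> int \<Rightarrow> 'w::complex_space \<Rightarrow> 'w) \<Rightarrow> 'w set \<Rightarrow> bool"
  where "submodule act S \<longleftrightarrow> cvs.subspace S \<and> (\<forall>v n. \<forall>w\<in>S. act v n w \<in> S)"

definition irreducible_submodule :: "('v \<Rightarrow> int \<Rightarrow> 'w::complex_space \<Rightarrow> 'w) \<Rightarrow> 'w set \<Rightarrow> bool" where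
  "irreducible_submodule act S \<longleftrightarrow>
     submodule act S \<and> S \<noteq> {0} \<and> (\<forall>T\<subseteq>S. submodule act T \<longrightarrow> T = {0} \<or> T = S)"

definition irreducible_module ::
  "'v::complex_space vertex_structure \<Rightarrow> ('v \<Rightarrow> int \<Rightarrow> 'w::complex_space \<Rightarrow> 'w) \<Rightarrow> bool"
  where "irreducible_module V act \<longleftrightarrow> vertex_module V act \<and> irreducible_submodule act UNIV"

definition completely_reducible ::
  "'v::complex_space vertex_structure \<Rightarrow> ('v \<Rightarrow> int \<Rightarrow> 'w::complex_space \<Rightarrow> 'w) \<Rightarrow> bool" where
  "completely_reducible V act \<longleftrightarrow>
     vertex_module V act \<and>
     (\<exists>\<S>. (\<forall>S\<in>\<S>. irreducible_submodule act S) \<and>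
          (\<forall>S\<in>\<S>. S \<inter> cvs.span (\<Union>(\<S> - {S})) = {0}) \<and>
          cvs.span (\<Union>\<S>) = UNIV)"


section \<open>Tensor products of vertex superalgebras and modules\<close>

text \<open>\<open>Y(x \<otimes> y, z) = Y(x, z) \<otimes> Y(y, z)\<close>. No Koszul sign occurs, because this is only used when the
  left factors are an even vertex algebra and an (ungraded) module over it.\<close>

definition tensor_action ::
  "('m::complex_space \<Rightarrow> int \<Rightarrow> 'n::complex_space \<Rightarrow> 'n) \<Rightarrow>
   ('f::complex_space \<Rightarrow> int \<Rightarrow> 'g::complex_space \<Rightarrow> 'g) \<Rightarrow>
   ('m, 'f) tensor \<Rightarrow> int \<Rightarrow> ('n, 'g) tensor \<Rightarrow> ('n, 'g) tensor" where
  "tensor_action actM actF t k =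
     tensor_lift (\<lambda>w g. tensor_lift (\<lambda>x y.
       Sum_any (\<lambda>i. actM x i w \<otimes> actF y (k - 1 - i) g)) t)"

definition tensor_vertex ::
  "'m::complex_space vertex_structure \<Rightarrow> 'f::complex_space vertex_structure \<Rightarrow>
   ('m, 'f) tensor vertex_structure" where
  "tensor_vertex M F =
     \<lparr>vacuum = vacuum M \<otimes> vacuum F,
      mode = tensor_action (mode M) (mode F),
      part = (\<lambda>p. cvs.span {x \<otimes> y |x y q r. x \<in> part M q \<and> y \<in> part F r \<and> q + r = p})\<rparr>"


section \<open>The Weyl vertex algebra\<close>

text \<open>Here \<open>a\<close> stands for \<open>a(-1) 1\<close> and \<open>astar\<close> for \<open>a\<^sup>*(0) 1\<close>. Since
  \<open>Y(astar, z) = \<Sum>\<^sub>n a\<^sup>*(n) z^(- n)\<close>, the operator \<open>a\<^sup>*(n)\<close> is the vertex mode of index \<open>n - 1\<close>.\<close>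

definition weyl_a :: "'m vertex_structure \<Rightarrow> 'm \<Rightarrow> int \<Rightarrow> 'm \<Rightarrow> 'm"
  where "weyl_a M a n = mode M a n"

definition weyl_astar :: "'m vertex_structure \<Rightarrow> 'm \<Rightarrow> int \<Rightarrow> 'm \<Rightarrow> 'm"
  where "weyl_astar M astar n = mode M astar (n - 1)"

definition weyl_submodule ::
  "'m::complex_space vertex_structure \<Rightarrow> 'm \<Rightarrow> 'm \<Rightarrow> 'm set \<Rightarrow> bool" where
  "weyl_submodule M a astar S \<longleftrightarrow>
     cvs.subspace S \<and> (\<forall>n. \<forall>x\<in>S. weyl_a M a n x \<in> S \<and> weyl_astar M astar n x \<in> S)"

definition weyl_vertex_algebra ::
  "'m::complex_space vertex_structure \<Rightarrow> 'm \<Rightarrow> 'm \<Rightarrow> bool" where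
  "weyl_vertex_algebra M a astar \<longleftrightarrow>
     vertex_algebra M \<and>
     (\<forall>n m x. weyl_a M a n (weyl_astar M astar m x) - weyl_astar M astar m (weyl_a M a n x) =
              (if n + m = 0 then x else 0)) \<and>
     (\<forall>n m x. weyl_a M a n (weyl_a M a m x) = weyl_a M a m (weyl_a M a n x)) \<and>
     (\<forall>n m x. weyl_astar M astar n (weyl_astar M astar m x) = weyl_astar M astar m (weyl_astar M astar n x)) \<and>
     (\<forall>n\<ge>0. weyl_a M a n (vacuum M) = 0 \<and> weyl_astar M astar (n + 1) (vacuum M) = 0) \<and>
     a = weyl_a M a (- 1) (vacuum M) \<and> astar = weyl_astar M astar 0 (vacuum M) \<and>
     vacuum M \<noteq> 0 \<and>
     (\<forall>S. weyl_submodule M a astar S \<and> vacuum M \<in> S \<longrightarrow> S = UNIV) \<and>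
     (\<forall>S. weyl_submodule M a astar S \<longrightarrow> S = {0} \<or> S = UNIV)"

definition weyl_omega :: "'m vertex_structure \<Rightarrow> 'm \<Rightarrow> 'm \<Rightarrow> 'm"
  where "weyl_omega M a astar = weyl_a M a (- 1) (weyl_astar M astar (- 1) (vacuum M))"

definition weyl_beta :: "'m vertex_structure \<Rightarrow> 'm \<Rightarrow> 'm \<Rightarrow> 'm"
  where "weyl_beta M a astar = weyl_a M a (- 1) (weyl_astar M astar 0 (vacuum M))"

text \<open>As \<open>Y(\<omega>, z) = \<Sum>\<^sub>n L(n) z^(- n - 2)\<close>, the operator \<open>L(0)\<close> is the mode of \<open>\<omega>\<close> of index \<open>1\<close>.\<close>

definition weight_module ::
  "'m::complex_space vertex_structure \<Rightarrow> 'm \<Rightarrow> 'm \<Rightarrow>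
   ('m \<Rightarrow> int \<Rightarrow> 'n::complex_space \<Rightarrow> 'n) \<Rightarrow> bool" where
  "weight_module M a astar act \<longleftrightarrow>
     vertex_module M act \<and>
     diagonalizable (act (weyl_beta M a astar) 0) \<and> diagonalizable (act (weyl_omega M a astar) 1)"


section \<open>The Clifford vertex superalgebra\<close>

text \<open>The operators \<open>\<psi>(n + 1/2)\<close> and \<open>\<psi>\<^sup>*(n + 1/2)\<close> are the vertex modes of index \<open>n\<close>. The monomial
  of \<open>(A, B)\<close> is the product of the \<open>\<psi>(- i - 1/2)\<close>, \<open>i \<in> A\<close>, and the \<open>\<psi>\<^sup>*(- j - 1/2)\<close>, \<open>j \<in> B\<close>,
  applied to the vacuum; that these form a basis is the identification of \<open>F\<close> with an exterior
  algebra.\<close>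

definition clifford_monomial ::
  "'f vertex_structure \<Rightarrow> 'f \<Rightarrow> 'f \<Rightarrow> nat set \<times> nat set \<Rightarrow> 'f" where
  "clifford_monomial F \<psi> \<psi>s = (\<lambda>(A, B).
     foldr (\<lambda>i. mode F \<psi> (- int i - 1)) (sorted_list_of_set A)
       (foldr (\<lambda>j. mode F \<psi>s (- int j - 1)) (sorted_list_of_set B) (vacuum F)))"

definition clifford_vertex_superalgebra ::
  "'f::complex_space vertex_structure \<Rightarrow> 'f \<Rightarrow> 'f \<Rightarrow> bool" where
  "clifford_vertex_superalgebra F \<psi> \<psi>s \<longleftrightarrow>
     vertex_superalgebra F \<and> \<psi> \<in> part F 1 \<and> \<psi>s \<in> part F 1 \<and> vertex_generated F {\<psi>, \<psi>s} \<and>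
     (\<forall>m n x. mode F \<psi> m (mode F \<psi>s n x) + mode F \<psi>s n (mode F \<psi> m x) =
              (if m + n + 1 = 0 then x else 0)) \<and>
     (\<forall>m n x. mode F \<psi> m (mode F \<psi> n x) + mode F \<psi> n (mode F \<psi> m x) = 0) \<and>
     (\<forall>m n x. mode F \<psi>s m (mode F \<psi>s n x) + mode F \<psi>s n (mode F \<psi>s m x) = 0) \<and>
     inj_on (clifford_monomial F \<psi> \<psi>s) {(A, B). finite A \<and> finite B} \<and>
     cvs.independent (clifford_monomial F \<psi> \<psi>s ` {(A, B). finite A \<and> finite B}) \<and>
     cvs.span (clifford_monomial F \<psi> \<psi>s ` {(A, B). finite A \<and> finite B}) = UNIV"

definition clifford_gamma :: "'f vertex_structure \<Rightarrow> 'f \<Rightarrow> 'f \<Rightarrow> 'f"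
  where "clifford_gamma F \<psi> \<psi>s = mode F \<psi> (- 1) (mode F \<psi>s (- 1) (vacuum F))"


section \<open>The affine vertex superalgebra of $gl(1|1)$\<close>

text \<open>The type is the homogeneous basis of $gl(1|1)$; \<open>gl11_bracket x y z\<close> is the coefficient of \<open>z\<close> in
  \<open>[x, y]\<close>.\<close>

datatype gl11 = gl_E | gl_N | Psi_plus | Psi_minus

lemma UNIV_gl11: "UNIV = {gl_E, gl_N, Psi_plus, Psi_minus}"
  using gl11.exhaust by blast

instance gl11 :: finite
  by standard (simp add: UNIV_gl11)

fun gl11_parity :: "gl11 \<Rightarrow> bit" where
  "gl11_parity gl_E = 0"
| "gl11_parity gl_N = 0"
| "gl11_parity Psi_plus = 1"
| "gl11_parity Psi_minus = 1"

fun gl11_bracket :: "gl11 \<Rightarrow> gl11 \<Rightarrow> gl11 \<Rightarrow> complex" where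
  "gl11_bracket Psi_plus Psi_minus = (\<lambda>_. 0)(gl_E := 1)"
| "gl11_bracket Psi_minus Psi_plus = (\<lambda>_. 0)(gl_E := 1)"
| "gl11_bracket gl_N Psi_plus = (\<lambda>_. 0)(Psi_plus := 1)"
| "gl11_bracket Psi_plus gl_N = (\<lambda>_. 0)(Psi_plus := - 1)"
| "gl11_bracket gl_N Psi_minus = (\<lambda>_. 0)(Psi_minus := - 1)"
| "gl11_bracket Psi_minus gl_N = (\<lambda>_. 0)(Psi_minus := 1)"
| "gl11_bracket _ _ = (\<lambda>_. 0)"

fun gl11_form :: "gl11 \<Rightarrow> gl11 \<Rightarrow> complex" where
  "gl11_form Psi_plus Psi_minus = 1"
| "gl11_form Psi_minus Psi_plus = - 1"
| "gl11_form gl_N gl_E = 1"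
| "gl11_form gl_E gl_N = 1"
| "gl11_form _ _ = 0"

text \<open>\<open>simple_affine_gl11 k V g\<close>: \<open>V\<close> is the simple affine vertex superalgebra of level \<open>k\<close>, and
  \<open>g x\<close> is the vector \<open>x(-1) 1\<close>.\<close>

definition simple_affine_gl11 ::
  "complex \<Rightarrow> 'v::complex_space vertex_structure \<Rightarrow> (gl11 \<Rightarrow> 'v) \<Rightarrow> bool" where
  "simple_affine_gl11 k V g \<longleftrightarrow>
     simple_vertex_superalgebra V \<and>
     (\<forall>x. g x \<in> part V (gl11_parity x)) \<and>
     vertex_generated V (range g) \<and>
     (\<forall>x y m n w.
        mode V (g x) m (mode V (g y) n w) -
          koszul (gl11_parity x) (gl11_parity y) *\<^sub>C mode V (g y) n (mode V (g x) m w) =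
        (\<Sum>z\<in>UNIV. gl11_bracket x y z *\<^sub>C mode V (g z) (m + n) w) +
          (if m + n = 0 then (of_int m * gl11_form x y * k) *\<^sub>C w else 0))"

text \<open>The homomorphism \<open>V\<^sub>1(gl(1|1)) \<rightarrow> M \<otimes> F\<close> given by \<open>\<Psi>\<^sup>+ = a(-1) \<psi>\<close>, \<open>\<Psi>\<^sup>- = a\<^sup>*(0) \<psi>\<^sup>*\<close>,
  \<open>E = \<gamma> + \<beta>\<close>, \<open>N = (\<gamma> - \<beta>)/2\<close>. It is unique because these vectors generate \<open>V\<close>.\<close>

definition gl11_realization ::
  "'v::complex_space vertex_structure \<Rightarrow> (gl11 \<Rightarrow> 'v) \<Rightarrow>
   'm::complex_space vertex_structure \<Rightarrow> 'm \<Rightarrow> 'm \<Rightarrow>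
   'f::complex_space vertex_structure \<Rightarrow> 'f \<Rightarrow> 'f \<Rightarrow> ('v \<Rightarrow> ('m, 'f) tensor) \<Rightarrow> bool" where
  "gl11_realization V g M a astar F \<psi> \<psi>s h \<longleftrightarrow>
     vertex_hom V (tensor_vertex M F) h \<and>
     h (g Psi_plus) = a \<otimes> \<psi> \<and>
     h (g Psi_minus) = astar \<otimes> \<psi>s \<and>
     h (g gl_E) = vacuum M \<otimes> clifford_gamma F \<psi> \<psi>s + weyl_beta M a astar \<otimes> vacuum F \<and>
     h (g gl_N) = (1 / 2) *\<^sub>C (vacuum M \<otimes> clifford_gamma F \<psi> \<psi>s - weyl_beta M a astar \<otimes> vacuum F)"

end

theory Submission
  imports Defs "HOL-Computational_Algebra.Formal_Power_Series"
begin

text \<open>The operator \<open>E(0) = \<beta>(0) + \<gamma>(0)\<close> is diagonalizable on \<open>\<N> \<otimes> F\<close> and commutes with \<open>V\<^sub>1(gl(1|1))\<close>, so it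
  suffices that its eigenspaces are irreducible. Let \<open>S\<close> be a nonzero submodule of an eigenspace. The
  image of \<open>V\<^sub>1(gl(1|1))\<close> contains \<open>\<partial>\<^sup>i a \<otimes> \<psi>\<close> and \<open>\<partial>\<^sup>i a\<^sup>* \<otimes> \<psi>\<^sup>*\<close> for all \<open>i\<close>; as only finitely many terms of a mode
  act nontrivially on a given vector, interpolation shows that \<open>S\<close> is stable under each product
  \<open>a(m) \<psi>(r)\<close> and \<open>a\<^sup>*(m) \<psi>\<^sup>*(r)\<close>, and then under all products of one operator from
  \<open>{a\<^sup>*(m), \<psi>(r)}\<close>, which raise the \<open>E(0)\<close>-eigenvalue by 1, and one from \<open>{a(m), \<psi>\<^sup>*(r)}\<close>, which lower
  it by 1. Hence the span of the words in raising operators and the words in lowering operators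
  applied to \<open>S\<close> is stable under all these operators and meets the eigenspace only in \<open>S\<close>. It is
  everything, because \<open>\<N> \<otimes> F\<close> is irreducible under the Weyl and Clifford modes.\<close>

section \<open>Linear maps and finitely supported sums\<close>

text \<open>Complete reducibility as defined includes the claim that \<open>\<N> \<otimes> F\<close>
  is a module, so the Jacobi identity has to be carried from the two factors to the tensor action.
  The identity itself cannot be multiplied, because products of delta series make no sense. What
  does multiply is locality, where a power of z1 - z2 makes the two orders of a product agree, and
  associativity, where a power of z0 + z2 makes product and iterate agree; for truncated series the
  two together amount to the identity. The derivatives on the Weyl side come from E/2 + N =
  \<gamma>. This current acts on the Clifford factor alone, and its mode of index -1 differentiates
  \<open>\<psi>\<close>, and \<open>\<psi>s\<close> up to sign. Subtracting the result from the
  total derivative leaves the derivative of the Weyl factor. Irreducibility under the Weyl and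
  Clifford modes needs no density argument: annihilators move any nonzero vector to a nonzero vector
  of \<N> \<otimes> 1, where the irreducibility of \<N> takes over.\<close>

lemma clinear_iff: "clinear f \<longleftrightarrow> (\<forall>x y. f (x + y) = f x + f y) \<and> (\<forall>c x. f (c *\<^sub>C x) = c *\<^sub>C f x)"
  by (auto simp: Vector_Spaces.linear_def module_hom_def module_hom_axioms_def
      cvs.vector_space_axioms cvs.module_axioms)

lemma clinearI:
  "(\<And>x y. f (x + y) = f x + f y) \<Longrightarrow> (\<And>c x. f (c *\<^sub>C x) = c *\<^sub>C f x) \<Longrightarrow> clinear f"
  by (simp add: clinear_iff)

lemma clinear_add: "clinear f \<Longrightarrow> f (x + y) = f x + f y"
  and clinear_scale: "clinear f \<Longrightarrow> f (c *\<^sub>C x) = c *\<^sub>C f x"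
  by (simp_all add: clinear_iff)

lemma clinear_0: "clinear f \<Longrightarrow> f 0 = 0"
  using clinear_add[of f 0 0] by simp

lemma clinear_minus: "clinear f \<Longrightarrow> f (- x) = - f x"
  using clinear_add[of f x "- x"] clinear_0[of f] by (simp add: eq_neg_iff_add_eq_0 add.commute)

lemma clinear_diff: "clinear f \<Longrightarrow> f (x - y) = f x - f y"
  using clinear_add[of f x "- y"] clinear_minus[of f y] by simp

lemma clinear_sum: "clinear f \<Longrightarrow> f (sum g A) = (\<Sum>x\<in>A. f (g x))"
  by (induction A rule: infinite_finite_induct) (auto simp: clinear_0 clinear_add)

lemma clinear_id: "clinear (\<lambda>x. x)"
  by (simp add: clinear_iff)

lemma clinear_compose: "clinear f \<Longrightarrow> clinear g \<Longrightarrow> clinear (\<lambda>x. f (g x))"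
  by (simp add: clinear_iff)

lemma clinear_plus: "clinear f \<Longrightarrow> clinear g \<Longrightarrow> clinear (\<lambda>x. f x + g x)"
  by (simp add: clinear_iff cvs.scale_right_distrib)

lemma clinear_scaled: "clinear f \<Longrightarrow> clinear (\<lambda>x. c *\<^sub>C f x)"
  by (simp add: clinear_iff cvs.scale_right_distrib mult.commute)

lemma Sum_any_superset: "finite A \<Longrightarrow> (\<And>x. x \<notin> A \<Longrightarrow> g x = 0) \<Longrightarrow> Sum_any g = sum g A"
  by (rule Sum_any.expand_superset) auto

text \<open>\<open>Sum_any\<close> has value 0 on an infinite support, and \<open>f\<close> may kill
  all but finitely many terms, so finiteness is demanded before \<open>f\<close> is applied.\<close>

lemma clinear_Sum_any:
  assumes f: "clinear f" and "finite {x. g x \<noteq> 0}"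
  shows "f (Sum_any g) = Sum_any (\<lambda>x. f (g x))"
proof -
  have "Sum_any (\<lambda>x. f (g x)) = (\<Sum>x | g x \<noteq> 0. f (g x))"
    by (rule Sum_any_superset) (auto simp: assms clinear_0)
  then show ?thesis
    by (simp add: Sum_any.expand_set clinear_sum[OF f])
qed

lemma Sum_any_scaleC:
  assumes "finite {x. g x \<noteq> 0}"
  shows "c *\<^sub>C Sum_any g = Sum_any (\<lambda>x. c *\<^sub>C g x)"
  by (rule clinear_Sum_any[OF _ assms]) (rule clinear_scaled[OF clinear_id])

text \<open>The joint support lies in the product of its two projections, a finite
  rectangle.\<close>

lemma Sum_any_fubini:
  assumes "finite {(a, b). g a b \<noteq> 0}"
  shows "Sum_any (\<lambda>a. Sum_any (g a)) = Sum_any (\<lambda>(a, b). g a b)"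
proof (rule Sum_any.cartesian_product)
  let ?S = "{(a, b). g a b \<noteq> 0}"
  show "finite (fst ` ?S \<times> snd ` ?S)"
    using assms by blast
  show "{a. \<exists>b. g a b \<noteq> 0} \<times> {b. \<exists>a. g a b \<noteq> 0} \<subseteq> fst ` ?S \<times> snd ` ?S"
    by (auto simp: image_iff)
qed

lemma Sum_any_reindex_bij:
  assumes "bij h"
  shows "Sum_any g = Sum_any (\<lambda>x. g (h x))"
proof -
  have "h ` {x. g (h x) \<noteq> 0} = {y. g y \<noteq> 0}"
    using assms by (auto simp: image_iff) (metis bij_pointE)
  moreover have "inj_on h {x. g (h x) \<noteq> 0}"
    using assms by (meson bij_is_inj inj_on_subset subset_UNIV)
  ultimately show ?thesis
    unfolding Sum_any.expand_set by (metis (mono_tags, lifting) sum.reindex_cong)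
qed

lemma Sum_any_single: "(\<And>x. x \<noteq> a \<Longrightarrow> g x = 0) \<Longrightarrow> Sum_any g = g a"
  using Sum_any_superset[of "{a}" g] by simp

lemma Sum_any_add:
  "finite {x. f x \<noteq> 0} \<Longrightarrow> finite {x. g x \<noteq> 0} \<Longrightarrow> Sum_any (\<lambda>x. f x + g x) = Sum_any f + Sum_any g"
  by (rule Sum_any.distrib)

lemma Sum_any_in_subspace:
  assumes "cvs.subspace S" "\<And>x. g x \<in> S"
  shows "Sum_any g \<in> S"
  unfolding Sum_any.expand_set using assms by (auto intro: cvs.subspace_sum)

lemma finite_nat_eventually_0:
  assumes "\<And>j. j \<ge> J \<Longrightarrow> g j = 0" shows "finite {j::nat. g j \<noteq> 0}"
  by (rule finite_subset[of _ "{..<J}"]) (use assms in \<open>auto simp: not_less[symmetric]\<close>)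

section \<open>Tensor products of vector spaces\<close>

lemma tensor_eq_relation: "p - q \<in> tensor_relations \<Longrightarrow> tensor_eq p q"
  by (simp add: tensor_eq_def free.span_base)

lemma pure_tensor_add_left: "(x + x') \<otimes> y = x \<otimes> y + x' \<otimes> y"
proof (transfer, rule tensor_eq_relation)
  show "Poly_Mapping.single (x + x', y) 1 - (Poly_Mapping.single (x, y) 1 + Poly_Mapping.single (x', y) 1)
      \<in> tensor_relations" for x x' :: 'a and y :: 'b
    unfolding tensor_relations_def diff_diff_eq[symmetric] by blast
qed

lemma pure_tensor_add_right: "x \<otimes> (y + y') = x \<otimes> y + x \<otimes> y'"
proof (transfer, rule tensor_eq_relation)
  show "Poly_Mapping.single (x, y + y') 1 - (Poly_Mapping.single (x, y) 1 + Poly_Mapping.single (x, y') 1)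
      \<in> tensor_relations" for x :: 'a and y y' :: 'b
    unfolding tensor_relations_def diff_diff_eq[symmetric] by blast
qed

lemma free_scale_single: "free_scale c (Poly_Mapping.single z d) = Poly_Mapping.single z (c * d)"
  by (rule poly_mapping_eqI) (simp add: lookup_single when_def)

lemma pure_tensor_scale_left: "(c *\<^sub>C x) \<otimes> y = c *\<^sub>C (x \<otimes> y)"
proof (transfer, rule tensor_eq_relation)
  show "Poly_Mapping.single (c *\<^sub>C x, y) 1 - free_scale c (Poly_Mapping.single (x, y) 1)
      \<in> tensor_relations" for c and x :: 'a and y :: 'b
    unfolding tensor_relations_def free_scale_single mult_1_right by blast
qed

lemma pure_tensor_scale_right: "x \<otimes> (c *\<^sub>C y) = c *\<^sub>C (x \<otimes> y)"
proof (transfer, rule tensor_eq_relation)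
  show "Poly_Mapping.single (x, c *\<^sub>C y) 1 - free_scale c (Poly_Mapping.single (x, y) 1)
      \<in> tensor_relations" for c and x :: 'a and y :: 'b
    unfolding tensor_relations_def free_scale_single mult_1_right by blast
qed

lemma clinear_pure_left: "clinear (\<lambda>x. x \<otimes> y)"
  and clinear_pure_right: "clinear (\<lambda>y. x \<otimes> y)"
  by (simp_all add: clinear_iff pure_tensor_add_left pure_tensor_add_right
      pure_tensor_scale_left pure_tensor_scale_right)

lemma pure_tensor_0 [simp]: "0 \<otimes> y = 0" "x \<otimes> 0 = 0"
  using clinear_0[OF clinear_pure_left] clinear_0[OF clinear_pure_right] by auto

text \<open>Scalars are absorbed into the left factor, so every tensor is a sum of pure ones and no
  case for multiples arises.\<close>

lemma tensor_induct [case_names pure add]: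
  assumes pure: "\<And>x y. P (x \<otimes> y)" and add: "\<And>s t. P s \<Longrightarrow> P t \<Longrightarrow> P (s + t)"
  shows "P t"
proof -
  have "P (abs_tensor p)" for p :: "('a \<times> 'b) \<Rightarrow>\<^sub>0 complex"
  proof (induction p rule: update_induct)
    case const
    show ?case using pure[of 0 0] by (simp flip: zero_tensor.abs_eq)
  next
    case (update f z c)
    have "Poly_Mapping.update z c f = f + Poly_Mapping.single z c"
      using update by (intro poly_mapping_eqI)
        (auto simp: lookup_update lookup_add lookup_single when_def in_keys_iff)
    moreover have "abs_tensor (Poly_Mapping.single z c) = (c *\<^sub>C fst z) \<otimes> snd z"
      by (subst pure_tensor_scale_left, cases z)
        (simp add: pure_tensor.abs_eq scaleC_tensor.abs_eq free_scale_single)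
    ultimately show ?case
      using update pure by (auto simp flip: plus_tensor.abs_eq intro: add)
  qed
  moreover obtain p where "t = abs_tensor p"
    by (metis Quotient3_abs_rep Quotient3_tensor)
  ultimately show ?thesis by simp
qed

lemma clinear_eq_tensorI:
  assumes "clinear f" "clinear g" "\<And>x y. f (x \<otimes> y) = g (x \<otimes> y)"
  shows "f t = g t"
  by (induction t rule: tensor_induct) (auto simp: assms clinear_add)

definition tensor_map where "tensor_map f g = tensor_lift (\<lambda>x y. f x \<otimes> g y)"

lemma
  assumes "clinear f" "clinear g"
  shows tensor_map_pure: "tensor_map f g (x \<otimes> y) = f x \<otimes> g y"
    and clinear_tensor_map: "clinear (tensor_map f g)"
proof -
  have "cbilinear (\<lambda>x y. f x \<otimes> g y)"
    using assms by (simp add: cbilinear_def clinear_compose[OF clinear_pure_left]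
        clinear_compose[OF clinear_pure_right])
  then show "tensor_map f g (x \<otimes> y) = f x \<otimes> g y" "clinear (tensor_map f g)"
    by (simp_all add: tensor_map_def clinear_tensor_lift)
qed

section \<open>Two-variable grids and the Jacobi identity\<close>

text \<open>A grid \<open>a\<close> stands for the formal series \<open>\<Sum> a m n z\<^sub>1^(- m - 1) z\<^sub>2^(- n - 1)\<close>. The grids in
  \<open>jacobi_grids a b d\<close> are the expansions of \<open>Y(u, z\<^sub>1) Y(v, z\<^sub>2) w\<close>, \<open>\<plusminus> Y(v, z\<^sub>2) Y(u, z\<^sub>1) w\<close> and
  \<open>Y(Y(u, z\<^sub>0) v, z\<^sub>2) w\<close>. The operator \<open>lin_shift c\<close> is multiplication by the sum of the first variable
  and \<open>c\<close> times the second.\<close>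

type_synonym 'a grid = "int \<Rightarrow> int \<Rightarrow> 'a"

text \<open>Membership in W((z2))((z1)); exchanging the arguments gives W((z1))((z2)). Products Y(u,
  z1) Y(v, z2) w lie in the exchanged space, the opposite products and the iterates (with z0 as
  first variable) in the space itself.\<close>

definition truncated :: "'a::zero grid \<Rightarrow> bool" where
  "truncated a \<longleftrightarrow> (\<exists>K. \<forall>p\<ge>K. \<forall>q. a p q = 0) \<and> (\<forall>p. \<exists>K. \<forall>q\<ge>K. a p q = 0)"

definition lin_shift :: "complex \<Rightarrow> 'a::complex_space grid \<Rightarrow> 'a grid" where
  "lin_shift c a m n = a (m + 1) n + c *\<^sub>C a m (n + 1)"

text \<open>\<open>expand12\<close> multiplies by (z1 - z2)^l expanded in nonnegative powers of z2,
  \<open>expand21\<close> by the same power expanded in nonnegative powers of z1, and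
  \<open>expand0\<close> by z0^l (z2 + z0)^m expanded in nonnegative powers of z0. These are the
  three terms of the Jacobi identity.\<close>

definition expand12 :: "'a::complex_space grid \<Rightarrow> int \<Rightarrow> 'a grid" where
  "expand12 a l m n = Sum_any (\<lambda>j::nat. ((- 1) ^ j * (of_int l gchoose j)) *\<^sub>C a (m + l - int j) (n + int j))"

definition expand21 :: "'a::complex_space grid \<Rightarrow> int \<Rightarrow> 'a grid" where
  "expand21 b l m n = Sum_any (\<lambda>j::nat. ((- 1) powi l * (- 1) ^ j * (of_int l gchoose j)) *\<^sub>C b (m + int j) (l + n - int j))"

definition expand0 :: "'a::complex_space grid \<Rightarrow> int \<Rightarrow> 'a grid" where
  "expand0 d l m n = Sum_any (\<lambda>j::nat. (of_int m gchoose j) *\<^sub>C d (l + int j) (m + n - int j))"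

definition jacobi_grids :: "'a::complex_space grid \<Rightarrow> 'a grid \<Rightarrow> 'a grid \<Rightarrow> bool" where
  "jacobi_grids a b d \<longleftrightarrow> (\<forall>l m n. expand0 d l m n = expand12 a l m n - expand21 b l m n)"

section \<open>Recursions for the three expansions, all from Pascal's rule\<close>

lemma Sum_any_pascal:
  fixes x :: "nat \<Rightarrow> 'a::complex_space"
  assumes J: "\<And>j. j \<ge> J \<Longrightarrow> x j = 0"
  shows "Sum_any (\<lambda>j. (of_int (k + 1) gchoose j) *\<^sub>C x j) =
    Sum_any (\<lambda>j. (of_int k gchoose j) *\<^sub>C x j) + Sum_any (\<lambda>j. (of_int k gchoose j) *\<^sub>C x (Suc j))"
proof -
  have eq: "Sum_any (\<lambda>j. C j *\<^sub>C y j) = (\<Sum>j<Suc J. C j *\<^sub>C y j)" if "\<And>j. j \<ge> J \<Longrightarrow> y j = 0" for C and y :: "nat \<Rightarrow> 'a"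
    by (rule Sum_any_superset) (use that in auto)
  have gbi: "((of_int (k + 1) :: complex) gchoose Suc j) = (of_int k gchoose j) + (of_int k gchoose Suc j)" for j
    using gbinomial_Suc_Suc[of "of_int k :: complex" j] by simp
  have "(\<Sum>j<Suc J. (of_int (k + 1) gchoose j) *\<^sub>C x j) =
      x 0 + (\<Sum>j<J. (of_int (k + 1) gchoose Suc j) *\<^sub>C x (Suc j))"
    by (simp add: sum.lessThan_Suc_shift del: sum.lessThan_Suc)
  also have "\<dots> = (x 0 + (\<Sum>j<J. (of_int k gchoose Suc j) *\<^sub>C x (Suc j))) + (\<Sum>j<J. (of_int k gchoose j) *\<^sub>C x (Suc j))"
    unfolding gbi by (simp add: cvs.scale_left_distrib sum.distrib add_ac)
  also have "x 0 + (\<Sum>j<J. (of_int k gchoose Suc j) *\<^sub>C x (Suc j)) = (\<Sum>j<Suc J. (of_int k gchoose j) *\<^sub>C x j)"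
    by (simp add: sum.lessThan_Suc_shift del: sum.lessThan_Suc)
  also have "(\<Sum>j<J. (of_int k gchoose j) *\<^sub>C x (Suc j)) = (\<Sum>j<Suc J. (of_int k gchoose j) *\<^sub>C x (Suc j))"
    by (simp add: J)
  finally show ?thesis
    by (subst (1 2 3) eq) (simp_all add: J)
qed

lemma truncated_uniform: "truncated a \<Longrightarrow> \<exists>K. \<forall>p\<ge>K. \<forall>q. a p q = 0"
  and truncated_pointwise: "truncated a \<Longrightarrow> \<exists>K. \<forall>q\<ge>K. a p q = 0"
  by (auto simp: truncated_def)

lemma truncated_uniform_shift:
  assumes "truncated a" obtains J where "\<And>j::nat. j \<ge> J \<Longrightarrow> \<forall>q. a (p + int j) q = 0"
proof -
  obtain K where "\<forall>p\<ge>K. \<forall>q. a p q = 0"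
    using truncated_uniform[OF assms] by blast
  then show thesis
    by (intro that[of "nat (K - p)"]) auto
qed

text \<open>Splits off one factor z1 - z2 of the multiplier. The analogues below do the same for the
  other expansion of z1 - z2 and for z2 + z0.\<close>

lemma expand12_rec:
  assumes a: "truncated (\<lambda>q p. a p q)"
  shows "expand12 a (l + 1) m n = expand12 a l (m + 1) n - expand12 a l m (n + 1)"
proof -
  obtain J where J: "\<And>j::nat. j \<ge> J \<Longrightarrow> \<forall>p. a p (n + int j) = 0"
    using truncated_uniform_shift[OF a] by blast
  let ?x = "\<lambda>j. (- 1) ^ j *\<^sub>C a (m + (l + 1) - int j) (n + int j)"
  have 0: "expand12 a (l + 1) m n = Sum_any (\<lambda>j. (of_int (l + 1) gchoose j) *\<^sub>C ?x j)"
    unfolding expand12_def cvs.scale_scale by (simp only: mult.commute)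
  have 1: "expand12 a l (m + 1) n = Sum_any (\<lambda>j. (of_int l gchoose j) *\<^sub>C ?x j)"
    unfolding expand12_def cvs.scale_scale
    by (intro arg_cong[where f = Sum_any] ext arg_cong2[where f = scaleC] arg_cong2[where f = a]) auto
  have "- expand12 a l m (n + 1) = Sum_any (\<lambda>j. - (((- 1) ^ j * (of_int l gchoose j)) *\<^sub>C a (m + l - int j) (n + 1 + int j)))"
    unfolding expand12_def
  proof (rule clinear_Sum_any[OF _ finite_nat_eventually_0[of J]])
    fix j assume "J \<le> j"
    then show "((- 1) ^ j * (of_int l gchoose j)) *\<^sub>C a (m + l - int j) (n + 1 + int j) = 0"
      using J[of "Suc j"] by (simp add: add.assoc)
  qed (simp add: clinearI)
  also have "\<dots> = Sum_any (\<lambda>j. (of_int l gchoose j) *\<^sub>C ?x (Suc j))"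
    unfolding cvs.scale_scale cvs.scale_minus_left[symmetric]
    by (intro arg_cong[where f = Sum_any] ext arg_cong2[where f = scaleC] arg_cong2[where f = a]) auto
  finally have 2: "- expand12 a l m (n + 1) = Sum_any (\<lambda>j. (of_int l gchoose j) *\<^sub>C ?x (Suc j))" .
  have "Sum_any (\<lambda>j. (of_int (l + 1) gchoose j) *\<^sub>C ?x j) =
    Sum_any (\<lambda>j. (of_int l gchoose j) *\<^sub>C ?x j) + Sum_any (\<lambda>j. (of_int l gchoose j) *\<^sub>C ?x (Suc j))"
    by (rule Sum_any_pascal[of J]) (simp add: J)
  then show ?thesis
    unfolding 0[symmetric] 1[symmetric] 2[symmetric] by simp
qed

lemma expand21_rec:
  assumes b: "truncated b"
  shows "expand21 b (l + 1) m n = expand21 b l (m + 1) n - expand21 b l m (n + 1)"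
proof -
  obtain J where J: "\<And>j::nat. j \<ge> J \<Longrightarrow> \<forall>q. b (m + int j) q = 0"
    using truncated_uniform_shift[OF b] by blast
  let ?x = "\<lambda>j. ((- 1) powi (l + 1) * (- 1) ^ j) *\<^sub>C b (m + int j) (l + 1 + n - int j)"
  have 0: "expand21 b (l + 1) m n = Sum_any (\<lambda>j. (of_int (l + 1) gchoose j) *\<^sub>C ?x j)"
    unfolding expand21_def cvs.scale_scale by (simp only: mult_ac)
  have "- expand21 b l m (n + 1) = Sum_any (\<lambda>j::nat. - (((- 1) powi l * (- 1) ^ j * (of_int l gchoose j)) *\<^sub>C b (m + int j) (l + (n + 1) - int j)))"
    unfolding expand21_def
    by (rule clinear_Sum_any[OF _ finite_nat_eventually_0[of J]]) (simp_all add: J clinearI)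
  also have "\<dots> = Sum_any (\<lambda>j. (of_int l gchoose j) *\<^sub>C ?x j)"
    unfolding cvs.scale_scale cvs.scale_minus_left[symmetric]
    by (intro arg_cong[where f = Sum_any] ext arg_cong2[where f = scaleC] arg_cong2[where f = b])
      (auto simp: power_int_add)
  finally have 1: "- expand21 b l m (n + 1) = Sum_any (\<lambda>j. (of_int l gchoose j) *\<^sub>C ?x j)" .
  have 2: "expand21 b l (m + 1) n = Sum_any (\<lambda>j. (of_int l gchoose j) *\<^sub>C ?x (Suc j))"
    unfolding expand21_def cvs.scale_scale
    by (intro arg_cong[where f = Sum_any] ext arg_cong2[where f = scaleC] arg_cong2[where f = b])
      (auto simp: power_int_add)
  have "Sum_any (\<lambda>j. (of_int (l + 1) gchoose j) *\<^sub>C ?x j) =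
    Sum_any (\<lambda>j. (of_int l gchoose j) *\<^sub>C ?x j) + Sum_any (\<lambda>j. (of_int l gchoose j) *\<^sub>C ?x (Suc j))"
    by (rule Sum_any_pascal[of J]) (simp add: J)
  then show ?thesis
    unfolding 0[symmetric] 1[symmetric] 2[symmetric] by simp
qed

lemma expand0_rec:
  assumes d: "truncated d"
  shows "expand0 d l (m + 1) n = expand0 d (l + 1) m n + expand0 d l m (n + 1)"
proof -
  obtain J where J: "\<And>j::nat. j \<ge> J \<Longrightarrow> \<forall>q. d (l + int j) q = 0"
    using truncated_uniform_shift[OF d] by blast
  let ?x = "\<lambda>j. d (l + int j) (m + 1 + n - int j)"
  have 1: "expand0 d l m (n + 1) = Sum_any (\<lambda>j. (of_int m gchoose j) *\<^sub>C ?x j)"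
    and 2: "expand0 d (l + 1) m n = Sum_any (\<lambda>j. (of_int m gchoose j) *\<^sub>C ?x (Suc j))"
    unfolding expand0_def
    by (intro arg_cong[where f = Sum_any] ext arg_cong2[where f = scaleC] arg_cong2[where f = d]; simp)+
  have "Sum_any (\<lambda>j. (of_int (m + 1) gchoose j) *\<^sub>C ?x j) =
    Sum_any (\<lambda>j. (of_int m gchoose j) *\<^sub>C ?x j) + Sum_any (\<lambda>j. (of_int m gchoose j) *\<^sub>C ?x (Suc j))"
    by (rule Sum_any_pascal[of J]) (simp add: J)
  then show ?thesis
    unfolding 1[symmetric] 2[symmetric] by (simp add: expand0_def)
qed

lemma expand_zero [simp]: "expand12 a 0 = a" "expand21 b 0 = b" "expand0 d l 0 n = d l n"
proof -
  have z: "(0 gchoose j) = 0" if "j \<noteq> 0" for j :: nat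
    using that by (cases j) (auto simp: gbinomial_0)
  show "expand12 a 0 = a"
    unfolding expand12_def by (intro ext, subst Sum_any_single[of 0]) (simp_all add: z)
  show "expand21 b 0 = b"
    unfolding expand21_def by (intro ext, subst Sum_any_single[of 0]) (simp_all add: z)
  show "expand0 d l 0 n = d l n"
    unfolding expand0_def by (subst Sum_any_single[of 0]) (simp_all add: z)
qed

lemma lin_shift_funpow_Suc: "(lin_shift c ^^ Suc k) a m n = (lin_shift c ^^ k) a (m + 1) n + c *\<^sub>C (lin_shift c ^^ k) a m (n + 1)"
  by (simp add: lin_shift_def)

lemma expand12_funpow:
  assumes "truncated (\<lambda>q p. a p q)"
  shows "expand12 a (int k) = (lin_shift (- 1) ^^ k) a"
proof (induction k)
  case (Suc k)
  have "expand12 a (int k + 1) m n = (lin_shift (- 1) ^^ Suc k) a m n" for m n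
    unfolding expand12_rec[OF assms] Suc lin_shift_funpow_Suc by simp
  then show ?case by (auto simp: add.commute)
qed simp

lemma expand21_funpow:
  assumes "truncated b"
  shows "expand21 b (int k) = (lin_shift (- 1) ^^ k) b"
proof (induction k)
  case (Suc k)
  have "expand21 b (int k + 1) m n = (lin_shift (- 1) ^^ Suc k) b m n" for m n
    unfolding expand21_rec[OF assms] Suc lin_shift_funpow_Suc by simp
  then show ?case by (auto simp: add.commute)
qed simp

text \<open>Read along \<open>m\<close>, the recursion says that raising \<open>m\<close> multiplies
  by z0 + z2 in the pair \<open>(l, n)\<close>, so the layer \<open>m = 0\<close> determines all
  layers with nonnegative \<open>m\<close>.\<close>

lemma funpow_lin_shift_eqI:
  fixes f :: "int \<Rightarrow> 'a::complex_space grid"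
  assumes "\<And>l m n. f l (m + 1) n = f (l + 1) m n + f l m (n + 1)"
  shows "f l (int k) n = (lin_shift 1 ^^ k) (\<lambda>l n. f l 0 n) l n"
proof (induction k arbitrary: l n)
  case (Suc k)
  have "f l (int k + 1) n = (lin_shift 1 ^^ Suc k) (\<lambda>l n. f l 0 n) l n"
    unfolding assms Suc lin_shift_funpow_Suc by simp
  then show ?case by (simp add: add.commute)
qed simp

lemma expand0_funpow:
  assumes "truncated d"
  shows "expand0 d l (int k) n = (lin_shift 1 ^^ k) d l n"
  using funpow_lin_shift_eqI[of "expand0 d" l k n] expand0_rec[OF assms] by simp

text \<open>The recursion for \<open>expand12\<close> solved for the term with \<open>m + 1\<close>;
  it encodes z1 = z0 + z2 with z0 = z1 - z2.\<close>

lemma expand12_funpow2: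
  assumes "truncated (\<lambda>q p. a p q)"
  shows "expand12 a l (int k) n = (lin_shift 1 ^^ k) (\<lambda>l n. expand12 a l 0 n) l n"
  by (rule funpow_lin_shift_eqI) (simp add: expand12_rec[OF assms])

lemma expand21_eq_0:
  assumes "\<And>p q. p \<ge> m \<Longrightarrow> b p q = 0" shows "expand21 b l m n = 0"
  unfolding expand21_def by (simp add: assms)

lemma expand0_eq_0:
  assumes "\<And>p q. p \<ge> l \<Longrightarrow> d p q = 0" shows "expand0 d l m n = 0"
  unfolding expand0_def by (simp add: assms)

section \<open>The Jacobi identity as locality plus associativity\<close>

lemma lin_shift_funpow_mono:
  assumes "(lin_shift c ^^ L) a = (lin_shift c ^^ L) b" "L \<le> k"
  shows "(lin_shift c ^^ k) a = (lin_shift c ^^ k) b"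
proof -
  have "(lin_shift c ^^ k) x = (lin_shift c ^^ (k - L)) ((lin_shift c ^^ L) x)" for x :: "'a grid"
    using assms(2) by (simp flip: funpow_add[THEN fun_cong, unfolded o_apply])
  then show ?thesis by (simp add: assms(1))
qed

text \<open>All three expansions satisfy \<open>X (l + 1) m n = X l (m + 1) n - X l m (n + 1)\<close>, so locality gives the
  identity for large \<open>l\<close>, and associativity for one \<open>m0\<close> propagates it down to all \<open>l\<close>.\<close>

lemma jacobi_gridsI:
  assumes a: "truncated (\<lambda>q p. a p q)" and b: "truncated b" and d: "truncated d"
    and loc: "(lin_shift (- 1) ^^ L) a = (lin_shift (- 1) ^^ L) b"
    and assoc: "\<And>l n. expand0 d l m0 n = expand12 a l m0 n"
    and m0: "\<And>p q. p \<ge> m0 \<Longrightarrow> b p q = 0"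
  shows "jacobi_grids a b d"
proof -
  define D where "D l m n = expand0 d l m n - (expand12 a l m n - expand21 b l m n)" for l m n
  have rec: "D (l + 1) m n = D l (m + 1) n - D l m (n + 1)" for l m n
    unfolding D_def expand12_rec[OF a] expand21_rec[OF b] expand0_rec[OF d] by (simp add: algebra_simps)
  have D0: "D l m0 n = 0" for l n
    unfolding D_def assoc by (simp add: expand21_eq_0 m0)
  obtain K where K: "\<And>k q. k \<ge> K \<Longrightarrow> d k q = 0"
    using truncated_uniform[OF d] by auto
  \<comment> \<open>From \<open>L'\<close> on, locality holds and the iterates vanish as well, which
    disposes of all three terms of \<open>D\<close>.\<close>
  define L' where "L' = max L (nat K)"
  have up: "D (int k) m n = 0" if "k \<ge> L'" for k m n
  proof -
    have "expand12 a (int k) = expand21 b (int k)"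
      unfolding expand12_funpow[OF a] expand21_funpow[OF b]
      using that by (intro lin_shift_funpow_mono[OF loc]) (simp add: L'_def)
    moreover have "expand0 d (int k) m n = 0"
      using that by (intro expand0_eq_0 K) (auto simp: L'_def)
    ultimately show ?thesis
      by (simp add: D_def)
  qed
  have down: "D (int L' - int i) m n = 0" for i m n
  proof (induction i arbitrary: m n)
    case 0
    show ?case by (simp add: up)
  next
    case (Suc i)
    let ?l = "int L' - int (Suc i)"
    have "?l + 1 = int L' - int i" by simp
    \<comment> \<open>Once the layer above vanishes, \<open>D\<close> is constant along the lines
      with fixed \<open>m + n\<close>, and each of these lines meets \<open>m = m0\<close>, where
      associativity gives 0.\<close>
    then have eq: "D ?l (m + 1) n = D ?l m (n + 1)" for m n
      using rec[of ?l m n] Suc by simp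
    have p: "D ?l (m0 + int k) n = 0" for k n
    proof (induction k arbitrary: n)
      case (Suc k)
      show ?case
        using eq[of "m0 + int k" n] Suc[of "n + 1"] by (simp add: add_ac)
    qed (simp add: D0)
    have q: "D ?l (m0 - int k) n = 0" for k n
    proof (induction k arbitrary: n)
      case (Suc k)
      show ?case
        using eq[of "m0 - int (Suc k)" "n - 1"] Suc[of "n - 1"] by simp
    qed (simp add: D0)
    show ?case
      using p[of "nat (m - m0)" n] q[of "nat (m0 - m)" n] by (cases "m \<ge> m0") auto
  qed
  have "D l m n = 0" for l m n
    using up[of "nat l" m n] down[of "nat (int L' - l)" m n]
    by (cases "l \<ge> int L'") auto
  then show ?thesis
    by (simp add: jacobi_grids_def D_def)
qed

text \<open>For large \<open>l\<close> the iterates drop out and leave locality; for large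
  \<open>m\<close> the opposite products drop out and leave associativity. The bounds are natural
  numbers so that they can serve as exponents of \<open>lin_shift\<close>.\<close>

lemma jacobi_gridsD:
  assumes a: "truncated (\<lambda>q p. a p q)" and b: "truncated b" and d: "truncated d"
    and "jacobi_grids a b d"
  obtains L m0 :: nat where "(lin_shift (- 1) ^^ L) a = (lin_shift (- 1) ^^ L) b"
    "\<And>l n. expand0 d l (int m0) n = expand12 a l (int m0) n"
    "\<And>p q. p \<ge> int m0 \<Longrightarrow> b p q = 0"
proof -
  obtain K where K: "\<And>k q. k \<ge> K \<Longrightarrow> d k q = 0"
    using truncated_uniform[OF d] by auto
  obtain P where P: "\<And>k q. k \<ge> P \<Longrightarrow> b k q = 0"
    using truncated_uniform[OF b] by auto
  have "expand12 a (int (nat K)) m n = expand21 b (int (nat K)) m n" for m n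
  proof -
    have "expand0 d (int (nat K)) m n = 0"
      by (rule expand0_eq_0, rule K) linarith
    then show ?thesis
      using assms(4) by (simp add: jacobi_grids_def)
  qed
  then have "(lin_shift (- 1) ^^ nat K) a = (lin_shift (- 1) ^^ nat K) b"
    unfolding expand12_funpow[OF a, symmetric] expand21_funpow[OF b, symmetric] by blast
  moreover have b0: "b p q = 0" if "p \<ge> int (nat P)" for p q
    by (rule P) (use that in linarith)
  moreover have "expand0 d l (int (nat P)) n = expand12 a l (int (nat P)) n" for l n
    using assms(4) expand21_eq_0[of "int (nat P)" b l n, OF b0] by (simp add: jacobi_grids_def)
  ultimately show thesis
    using that by blast
qed

section \<open>Convolution of grids\<close>

text \<open>Multiplication of series: the exponents -p - 1 and -p' - 1 add up to -m - 1 exactly when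
  p' = m - 1 - p.\<close>

definition convolve :: "'a::complex_space grid \<Rightarrow> 'b::complex_space grid \<Rightarrow> ('a, 'b) tensor grid" where
  "convolve a b m n = Sum_any (\<lambda>(p, q). a p q \<otimes> b (m - 1 - p) (n - 1 - q))"

abbreviation convolvable :: "'a::complex_space grid \<Rightarrow> 'b::complex_space grid \<Rightarrow> bool" where
  "convolvable a b \<equiv> \<forall>m n. finite {(p, q). a p q \<noteq> 0 \<and> b (m - 1 - p) (n - 1 - q) \<noteq> 0}"

text \<open>The two uniform bounds leave finitely many \<open>p\<close>; for each of them the two
  pointwise bounds leave finitely many \<open>q\<close>.\<close>

lemma convolvable_truncated:
  assumes a: "truncated a" and b: "truncated b"
  shows "convolvable a b"
proof (intro allI)
  fix m n
  obtain Ka where Ka: "\<And>p q. p \<ge> Ka \<Longrightarrow> a p q = 0" using truncated_uniform[OF a] by auto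
  obtain Kb where Kb: "\<And>p q. p \<ge> Kb \<Longrightarrow> b p q = 0" using truncated_uniform[OF b] by auto
  obtain La where La: "\<And>p q. q \<ge> La p \<Longrightarrow> a p q = 0" using truncated_pointwise[OF a] by metis
  obtain Lb where Lb: "\<And>p q. q \<ge> Lb p \<Longrightarrow> b p q = 0" using truncated_pointwise[OF b] by metis
  have "{(p, q). a p q \<noteq> 0 \<and> b (m - 1 - p) (n - 1 - q) \<noteq> 0} \<subseteq>
      (SIGMA p : {m - 1 - Kb..Ka}. {n - 1 - Lb (m - 1 - p)..La p})"
  proof clarsimp
    fix p q assume *: "a p q \<noteq> 0" "b (m - 1 - p) (n - 1 - q) \<noteq> 0"
    show "m - 1 - Kb \<le> p \<and> p \<le> Ka \<and> n - 1 - Lb (m - 1 - p) \<le> q \<and> q \<le> La p"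
      using Ka[of p q] Kb[of "m - 1 - p" "n - 1 - q"] La[where p = p and q = q]
        Lb[where p = "m - 1 - p" and q = "n - 1 - q"] * by linarith
  qed
  then show "finite {(p, q). a p q \<noteq> 0 \<and> b (m - 1 - p) (n - 1 - q) \<noteq> 0}"
    by (rule finite_subset) auto
qed

lemma convolvable_flip:
  assumes "convolvable (\<lambda>q p. a p q) (\<lambda>q p. b p q)" shows "convolvable a b"
proof (intro allI)
  fix m n
  have "{(p, q). a p q \<noteq> 0 \<and> b (m - 1 - p) (n - 1 - q) \<noteq> 0} =
      prod.swap ` {(q, p). a p q \<noteq> 0 \<and> b (m - 1 - p) (n - 1 - q) \<noteq> 0}"
    by (auto simp: image_iff)
  then show "finite {(p, q). a p q \<noteq> 0 \<and> b (m - 1 - p) (n - 1 - q) \<noteq> 0}"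
    using assms by simp
qed

lemma convolve_flip: "convolve (\<lambda>q p. a p q) (\<lambda>q p. b p q) n m = convolve a b m n"
  unfolding convolve_def
  by (subst Sum_any_reindex_bij[of prod.swap]) (auto simp: split_def bij_swap intro!: arg_cong[where f = Sum_any])

lemma truncated_convolve:
  assumes a: "truncated a" and b: "truncated b"
  shows "truncated (convolve a b)"
proof -
  obtain Ka where Ka: "\<And>p q. p \<ge> Ka \<Longrightarrow> a p q = 0" using truncated_uniform[OF a] by auto
  obtain Kb where Kb: "\<And>p q. p \<ge> Kb \<Longrightarrow> b p q = 0" using truncated_uniform[OF b] by auto
  obtain La where La: "\<And>p q. q \<ge> La p \<Longrightarrow> a p q = 0" using truncated_pointwise[OF a] by metis
  obtain Lb where Lb: "\<And>p q. q \<ge> Lb p \<Longrightarrow> b p q = 0" using truncated_pointwise[OF b] by metis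
  have "convolve a b m n = 0" if "m \<ge> Ka + Kb + 1" for m n
  proof -
    have "a p q \<otimes> b (m - 1 - p) (n - 1 - q) = 0" for p q
    proof (cases "p \<ge> Ka")
      case False
      then have "m - 1 - p \<ge> Kb" using that by linarith
      then show ?thesis by (simp only: Kb pure_tensor_0)
    qed (simp only: Ka pure_tensor_0)
    then show ?thesis by (simp add: convolve_def)
  qed
  moreover have "\<exists>K. \<forall>n\<ge>K. convolve a b m n = 0" for m
  proof (intro exI allI impI)
    let ?I = "{m - 1 - Kb..Ka}"
    \<comment> \<open>For fixed \<open>m\<close> only the finitely many \<open>p\<close> in
      \<open>?I\<close> contribute, so their pointwise bounds have a maximum; the 0 keeps the set
      nonempty.\<close>
    define A where "A = Max (insert 0 (La ` ?I))"
    define B where "B = Max (insert 0 ((\<lambda>p. Lb (m - 1 - p)) ` ?I))"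
    have A: "La p \<le> A" if "p \<in> ?I" for p
      unfolding A_def by (rule Max_ge) (use that in blast)+
    have B: "Lb (m - 1 - p) \<le> B" if "p \<in> ?I" for p
      unfolding B_def by (rule Max_ge) (use that in blast)+
    fix n assume n: "n \<ge> A + B + 1"
    have "a p q \<otimes> b (m - 1 - p) (n - 1 - q) = 0" for p q
    proof (cases "p \<in> ?I")
      case True
      show ?thesis
      proof (cases "q \<ge> La p")
        case False
        then have "n - 1 - q \<ge> Lb (m - 1 - p)" using A[OF True] B[OF True] n by linarith
        then show ?thesis by (simp only: Lb pure_tensor_0)
      qed (simp only: La pure_tensor_0)
    next
      case False
      then have "p \<ge> Ka \<or> m - 1 - p \<ge> Kb" by auto
      then show ?thesis by (metis Ka Kb pure_tensor_0)
    qed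
    then show "convolve a b m n = 0" by (simp add: convolve_def)
  qed
  ultimately show ?thesis
    unfolding truncated_def by blast
qed

lemma truncated_flip_convolve:
  assumes "truncated (\<lambda>q p. a p q)" "truncated (\<lambda>q p. b p q)"
  shows "truncated (\<lambda>q p. convolve a b p q)"
proof -
  have "(\<lambda>q p. convolve a b p q) = convolve (\<lambda>q p. a p q) (\<lambda>q p. b p q)"
    by (intro ext) (rule convolve_flip[symmetric])
  then show ?thesis
    using truncated_convolve[OF assms] by simp
qed

section \<open>Multiplication of convolutions by powers of z1 + c z2\<close>

lemma truncated_lin_shift:
  assumes a: "truncated a" shows "truncated (lin_shift c a)"
proof -
  obtain K where K: "\<And>p q. p \<ge> K \<Longrightarrow> a p q = 0" using truncated_uniform[OF a] by auto
  obtain L where L: "\<And>p q. q \<ge> L p \<Longrightarrow> a p q = 0" using truncated_pointwise[OF a] by metis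
  have "\<forall>p\<ge>K. \<forall>q. lin_shift c a p q = 0"
    by (simp add: lin_shift_def K)
  moreover have "\<forall>q\<ge>max (L p) (L (p + 1)). lin_shift c a p q = 0" for p
    using L by (simp add: lin_shift_def)
  ultimately show ?thesis
    unfolding truncated_def by blast
qed

lemma truncated_flip_lin_shift:
  assumes a: "truncated (\<lambda>q p. a p q)" shows "truncated (\<lambda>q p. lin_shift c a p q)"
proof -
  obtain K where K: "\<And>p q. q \<ge> K \<Longrightarrow> a p q = 0" using truncated_uniform[OF a] by auto
  obtain L where L: "\<And>p q. p \<ge> L q \<Longrightarrow> a p q = 0" using truncated_pointwise[OF a] by metis
  have "\<forall>q\<ge>K. \<forall>p. lin_shift c a p q = 0"
    by (simp add: lin_shift_def K)
  moreover have "\<forall>p\<ge>max (L q) (L (q + 1)). lin_shift c a p q = 0" for q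
    using L by (simp add: lin_shift_def)
  ultimately show ?thesis
    unfolding truncated_def by blast
qed

lemma truncated_funpow: "truncated a \<Longrightarrow> truncated ((lin_shift c ^^ k) a)"
  by (induction k) (simp_all add: truncated_lin_shift)

lemma truncated_flip_funpow:
  "truncated (\<lambda>q p. a p q) \<Longrightarrow> truncated (\<lambda>q p. (lin_shift c ^^ k) a p q)"
  by (induction k) (auto dest: truncated_flip_lin_shift)

lemma finite_tensor_support:
  assumes "convolvable a b"
  shows "finite {z. (case z of (p, q) \<Rightarrow> a p q \<otimes> b (m - 1 - p) (n - 1 - q)) \<noteq> 0}"
  by (rule finite_subset[OF _ assms[rule_format, of m n]]) auto

text \<open>A factor z1 + c z2 may be attached to either series. On the left one it moves the
  summation indices \<open>p\<close> and \<open>q\<close>, hence the two bijections; on the right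
  one the terms match directly.\<close>

lemma
  assumes ab: "convolvable a b"
  shows convolve_lin_shift_left: "convolve (lin_shift c a) b = lin_shift c (convolve a b)"
    and convolve_lin_shift_right: "convolve a (lin_shift c b) = lin_shift c (convolve a b)"
proof -
  define t where "t m n = (\<lambda>(p, q). a p q \<otimes> b (m - 1 - p) (n - 1 - q))" for m n
  have t: "convolve a b m n = Sum_any (t m n)" for m n
    by (simp add: convolve_def t_def)
  have fin: "finite {z. t m n z \<noteq> 0}" for m n
    unfolding t_def by (rule finite_tensor_support[OF ab])
  have fin': "finite {z. t m n (h z) \<noteq> 0}" if "bij h" for m n h
    using finite_vimageI[OF fin[of m n] bij_is_inj[OF that]] by (simp add: vimage_def)
  have b1: "bij (\<lambda>(p, q). (p + 1, q :: int) :: int \<times> int)" and b2: "bij (\<lambda>(p, q). (p, q + 1) :: int \<times> int)"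
    by (intro o_bij[of "\<lambda>(p, q). (p - 1, q)"] o_bij[of "\<lambda>(p, q). (p, q - 1)"]; auto)+
  show "convolve (lin_shift c a) b = lin_shift c (convolve a b)"
  proof (intro ext)
    fix m n
    have "convolve (lin_shift c a) b m n =
        Sum_any (\<lambda>z. t (m + 1) n ((\<lambda>(p, q). (p + 1, q)) z) + c *\<^sub>C t m (n + 1) ((\<lambda>(p, q). (p, q + 1)) z))"
      unfolding convolve_def
      by (intro arg_cong[where f = Sum_any] ext)
        (auto simp: t_def lin_shift_def pure_tensor_add_left pure_tensor_scale_left algebra_simps)
    also have "\<dots> = Sum_any (\<lambda>z. t (m + 1) n ((\<lambda>(p, q). (p + 1, q)) z)) + c *\<^sub>C Sum_any (\<lambda>z. t m (n + 1) ((\<lambda>(p, q). (p, q + 1)) z))"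
      unfolding Sum_any_scaleC[OF fin'[OF b2]]
      by (intro Sum_any_add fin' b1 finite_subset[OF _ fin'[OF b2, of m "n + 1"]]) auto
    finally show "convolve (lin_shift c a) b m n = lin_shift c (convolve a b) m n"
      unfolding lin_shift_def t Sum_any_reindex_bij[OF b1, symmetric] Sum_any_reindex_bij[OF b2, symmetric] .
  qed
  show "convolve a (lin_shift c b) = lin_shift c (convolve a b)"
  proof (intro ext)
    fix m n
    have "convolve a (lin_shift c b) m n = Sum_any (\<lambda>z. t (m + 1) n z + c *\<^sub>C t m (n + 1) z)"
      unfolding convolve_def
      by (intro arg_cong[where f = Sum_any] ext)
        (auto simp: t_def lin_shift_def pure_tensor_add_right pure_tensor_scale_right algebra_simps)
    also have "\<dots> = Sum_any (t (m + 1) n) + c *\<^sub>C Sum_any (t m (n + 1))"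
      unfolding Sum_any_scaleC[OF fin]
      by (intro Sum_any_add fin finite_subset[OF _ fin[of m "n + 1"]]) auto
    finally show "convolve a (lin_shift c b) m n = lin_shift c (convolve a b) m n"
      unfolding lin_shift_def t .
  qed
qed

lemma convolve_funpow:
  assumes "\<And>i j. convolvable ((lin_shift c ^^ i) a) ((lin_shift c ^^ j) b)"
  shows "convolve ((lin_shift c ^^ i) a) ((lin_shift c ^^ j) b) = (lin_shift c ^^ (i + j)) (convolve a b)"
proof -
  have "convolve ((lin_shift c ^^ i) a) b = (lin_shift c ^^ i) (convolve a b)"
    using assms[of _ 0] by (induction i) (simp_all add: convolve_lin_shift_left)
  then show ?thesis
    using assms by (induction j) (simp_all add: convolve_lin_shift_right)
qed

text \<open>The substitution \<open>z\<^sub>1 = z\<^sub>0 + z\<^sub>2\<close>, expanded in nonnegative powers of \<open>z\<^sub>2\<close>.\<close>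

definition taylor :: "'a::complex_space grid \<Rightarrow> 'a grid" where
  "taylor a l n = Sum_any (\<lambda>j::nat. ((- 1) ^ j * (of_int l gchoose j)) *\<^sub>C a (l - int j) (n + int j))"

lemma taylor_eq: "expand12 a l 0 n = taylor a l n"
  by (simp add: expand12_def taylor_def)

lemma Sum_any_triangle:
  assumes "\<And>i k::nat. i + k \<ge> J \<Longrightarrow> g i k = 0"
  shows "Sum_any (\<lambda>(i, k). g i k) = Sum_any (\<lambda>j. \<Sum>i\<le>j. g i (j - i))"
proof -
  have "Sum_any (\<lambda>(i, k). g i k) = (\<Sum>(i, k)\<in>{(i, k). i + k < J}. g i k)"
    by (rule Sum_any_superset[OF finite_subset[of _ "{..J} \<times> {..J}"]]) (auto intro!: assms)
  also have "\<dots> = (\<Sum>j<J. \<Sum>i\<le>j. g i (j - i))"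
    by (rule sum.triangle_reindex)
  also have "\<dots> = Sum_any (\<lambda>j. \<Sum>i\<le>j. g i (j - i))"
    by (rule sym, rule Sum_any_superset) (auto intro!: sum.neutral assms)
  finally show ?thesis .
qed

text \<open>Upper negation makes both upper arguments independent of \<open>i\<close>, after which
  the sum is a Vandermonde convolution. The shifts by \<open>i\<close> originate in
  \<open>taylor_convolve\<close>, where \<open>p\<close> is the index of a coefficient before the
  substitution.\<close>

lemma gbinomial_shifted_Vandermonde:
  fixes p l :: complex
  shows "(\<Sum>i\<le>j. (p + of_nat i gchoose i) * (l - 1 - p - of_nat i gchoose (j - i))) = (l gchoose j)"
proof -
  have "(p + of_nat i gchoose i) * (l - 1 - p - of_nat i gchoose (j - i)) =
      (- 1) ^ j * ((- p - 1 gchoose i) * (of_nat j - l + p gchoose (j - i)))" if "i \<le> j" for i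
  proof -
    have "of_nat i - (p + of_nat i) - 1 = - p - 1" by simp
    then have 1: "(p + of_nat i gchoose i) = (- 1) ^ i * (- p - 1 gchoose i)"
      using gbinomial_negated_upper[of "p + of_nat i" i] by simp
    have h: "of_nat (j - i) - (l - 1 - p - of_nat i) - 1 = of_nat j - l + p"
      using that by (simp add: of_nat_diff)
    have 2: "(l - 1 - p - of_nat i gchoose (j - i)) = (- 1) ^ (j - i) * (of_nat j - l + p gchoose (j - i))"
      using gbinomial_negated_upper[of "l - 1 - p - of_nat i" "j - i"] by (simp only: h)
    have 3: "(- 1 :: complex) ^ j = (- 1) ^ i * (- 1) ^ (j - i)"
      using that by (simp flip: power_add)
    show ?thesis
      unfolding 1 2 3 by (simp only: mult_ac)
  qed
  then have "(\<Sum>i\<le>j. (p + of_nat i gchoose i) * (l - 1 - p - of_nat i gchoose (j - i))) =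
      (- 1) ^ j * (\<Sum>i=0..j. (- p - 1 gchoose i) * (of_nat j - l + p gchoose (j - i)))"
    by (simp add: sum_distrib_left atLeast0AtMost)
  also have "\<dots> = (- 1) ^ j * (of_nat j - l - 1 gchoose j)"
    unfolding gbinomial_Vandermonde by (intro arg_cong2[where f = times] arg_cong2[where f = gbinomial]) simp_all
  also have "\<dots> = (l gchoose j)"
    by (rule gbinomial_negated_upper[symmetric])
  finally show ?thesis .
qed

text \<open>With \<open>q\<close> fixed, only the finitely many rows between \<open>q\<close> and
  \<open>K\<close> contribute, so their pointwise bounds can be combined.\<close>

lemma truncated_taylor:
  assumes a: "truncated (\<lambda>q p. a p q)"
  shows "truncated (\<lambda>q p. taylor a p q)"
proof -
  obtain K where K: "\<And>p q. q \<ge> K \<Longrightarrow> a p q = 0" using truncated_uniform[OF a] by auto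
  obtain L where L: "\<And>p q. p \<ge> L q \<Longrightarrow> a p q = 0" using truncated_pointwise[OF a] by metis
  have "\<forall>q\<ge>K. \<forall>p. taylor a p q = 0"
    by (simp add: taylor_def K)
  moreover have "\<exists>B. \<forall>p\<ge>B. taylor a p q = 0" for q
  proof (intro exI allI impI)
    define B where "B = Max (insert 0 (L ` {q..K}))"
    have B: "L r \<le> B" if "r \<in> {q..K}" for r
      unfolding B_def by (rule Max_ge) (use that in blast)+
    fix p assume p: "p \<ge> B + K - q"
    have "a (p - int j) (q + int j) = 0" for j
    proof (cases "q + int j \<ge> K")
      case False
      then have "p - int j \<ge> L (q + int j)" using B[of "q + int j"] p by simp
      then show ?thesis by (simp only: L)
    qed (simp only: K)
    then show "taylor a p q = 0"
      by (simp add: taylor_def)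
  qed
  ultimately show ?thesis
    unfolding truncated_def by blast
qed

text \<open>The uniform bounds in the second index confine \<open>q\<close>, \<open>i\<close> and
  \<open>k\<close>; only then do the pointwise bounds confine \<open>p\<close>.\<close>

lemma finite_quadruple_support:
  assumes a: "truncated (\<lambda>q p. a p q)" and b: "truncated (\<lambda>q p. b p q)"
  shows "finite {((p, q), (i, k)). a p q \<noteq> 0 \<and> b (l - 1 - p - int i - int k) (n - 1 - q + int i + int k) \<noteq> 0}"
proof -
  obtain Ka where Ka: "\<And>p q. q \<ge> Ka \<Longrightarrow> a p q = 0" using truncated_uniform[OF a] by auto
  obtain La where La: "\<And>p q. p \<ge> La q \<Longrightarrow> a p q = 0" using truncated_pointwise[OF a] by metis
  obtain Kb where Kb: "\<And>p q. q \<ge> Kb \<Longrightarrow> b p q = 0" using truncated_uniform[OF b] by auto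
  obtain Lb where Lb: "\<And>p q. p \<ge> Lb q \<Longrightarrow> b p q = 0" using truncated_pointwise[OF b] by metis
  \<comment> \<open>The inequalities \<open>q < Ka\<close> and \<open>n - 1 - q + i + k < Kb\<close>
    force \<open>i + k < Ka + Kb - n + 1\<close>.\<close>
  define J where "J = nat (Ka + Kb - n + 1)"
  define I where "I q i k = {l - 1 - int i - int k - Lb (n - 1 - q + int i + int k)..La q}" for q i k
  let ?Z = "SIGMA q : {n - 1 - Kb..Ka}. SIGMA i : {..J}. SIGMA k : {..J}. I q i k"
  let ?h = "\<lambda>(q, i, k, p). ((p, q), (i, k))"
  have "finite ?Z" by (auto simp: I_def)
  moreover have "{((p, q), (i, k)). a p q \<noteq> 0 \<and> b (l - 1 - p - int i - int k) (n - 1 - q + int i + int k) \<noteq> 0} \<subseteq> ?h ` ?Z"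
  proof clarify
    fix p q i k
    assume 1: "a p q \<noteq> 0" and 2: "b (l - 1 - p - int i - int k) (n - 1 - q + int i + int k) \<noteq> 0"
    have q: "q < Ka" and p: "p < La q"
      using Ka[of q p] La[of q p] 1 by (auto simp: not_le[symmetric])
    have q': "n - 1 - q + int i + int k < Kb" 
      using Kb[of "n - 1 - q + int i + int k" "l - 1 - p - int i - int k"] 2 by (auto simp only: not_le[symmetric])
    have p': "l - 1 - p - int i - int k < Lb (n - 1 - q + int i + int k)"
      using Lb[of "n - 1 - q + int i + int k" "l - 1 - p - int i - int k"] 2 by (auto simp only: not_le[symmetric])
    have "(q, i, k, p) \<in> ?Z"
    proof (intro SigmaI)
      show "q \<in> {n - 1 - Kb..Ka}" "i \<in> {..J}" "k \<in> {..J}"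
        using q q' by (auto simp: J_def)
      show "p \<in> I q i k"
        unfolding I_def using p p' by auto
    qed
    then show "((p, q), i, k) \<in> ?h ` ?Z"
      by (rule rev_image_eqI) simp
  qed
  ultimately show ?thesis
    by (rule finite_subset[OF _ finite_imageI, rotated])
qed

text \<open>Substituting z1 = z0 + z2 commutes with multiplying series. Both sides are sums over
  \<open>p\<close>, \<open>q\<close> and two Taylor indices \<open>i\<close>, \<open>k\<close>;
  collecting the terms with \<open>i + k = j\<close> leaves the shifted Vandermonde sum.\<close>

lemma taylor_convolve:
  assumes a: "truncated (\<lambda>q p. a p q)" and b: "truncated (\<lambda>q p. b p q)"
  shows "taylor (convolve a b) l n = convolve (taylor a) (taylor b) l n"
proof -
  obtain Ka where Ka: "\<And>p q. q \<ge> Ka \<Longrightarrow> a p q = 0" using truncated_uniform[OF a] by auto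
  obtain Kb where Kb: "\<And>p q. q \<ge> Kb \<Longrightarrow> b p q = 0" using truncated_uniform[OF b] by auto
  let ?S = "{((p, q), (i, k)). a p q \<noteq> 0 \<and> b (l - 1 - p - int i - int k) (n - 1 - q + int i + int k) \<noteq> 0}"
  have S: "finite ?S"
    by (rule finite_quadruple_support[OF a b])
  define sg where "sg m j = (- 1) ^ j * (of_int m gchoose j :: complex)" for m :: int and j :: nat
  define G where "G p q i k = (sg (p + int i) i * sg (l - 1 - p - int i) k) *\<^sub>C
      (a p q \<otimes> b (l - 1 - p - int i - int k) (n - 1 - q + int i + int k))" for p q i k
  define H where "H p q i k = (sg p i * sg (l - 1 - p) k) *\<^sub>C
      (a (p - int i) (q + int i) \<otimes> b (l - 1 - p - int k) (n - 1 - q + int k))" for p q i k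
  \<comment> \<open>Moves the indices of \<open>a\<close> back to their values before the
    substitution. This turns \<open>H\<close> into \<open>G\<close>, where \<open>i\<close> and
    \<open>k\<close> enter the tensor only through \<open>i + k\<close>.\<close>
  define \<phi> where "\<phi> = (\<lambda>((p, q), (i :: nat, k :: nat)). ((p + int i, q - int i), (i, k)))"
  have bij: "bij \<phi>"
    by (rule o_bij[of "\<lambda>((p, q), (i, k)). ((p - int i, q + int i), (i, k))"]) (auto simp: \<phi>_def)
  have H\<phi>: "(\<lambda>((p, q), (i, k)). H p q i k) (\<phi> z) = (\<lambda>((p, q), (i, k)). G p q i k) z" for z
    by (auto simp: \<phi>_def G_def H_def split_def algebra_simps)
  have finG: "finite {((p, q), (i, k)). G p q i k \<noteq> 0}"
    by (rule finite_subset[OF _ S]) (auto simp: G_def)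
  have finH: "finite {((p, q), (i, k)). H p q i k \<noteq> 0}"
  proof (rule finite_subset[OF _ finite_imageI[OF finG, of \<phi>]])
    show "{((p, q), (i, k)). H p q i k \<noteq> 0} \<subseteq> \<phi> ` {((p, q), (i, k)). G p q i k \<noteq> 0}"
    proof clarify
      fix p q i k assume "H p q i k \<noteq> 0"
      then have "((p - int i, q + int i), (i, k)) \<in> {((p, q), (i, k)). G p q i k \<noteq> 0}"
        using H\<phi>[of "((p - int i, q + int i), (i, k))"] by (simp add: \<phi>_def)
      then show "((p, q), (i, k)) \<in> \<phi> ` {((p, q), (i, k)). G p q i k \<noteq> 0}"
        by (rule rev_image_eqI) (simp add: \<phi>_def)
    qed
  qed
  have slice: "finite {z. f x z \<noteq> 0}" if "finite {(x, z). f x z \<noteq> 0}" for f :: "'x \<Rightarrow> 'z \<Rightarrow> 'y::zero" and x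
    using finite_vimageI[OF that, of "Pair x"] by (simp add: vimage_def inj_on_def)
  have tt: "taylor a p q \<otimes> taylor b (l - 1 - p) (n - 1 - q) = Sum_any (\<lambda>(i, k). H p q i k)" for p q
  proof -
    have fa: "finite {i. (sg p i) *\<^sub>C a (p - int i) (q + int i) \<noteq> 0}"
      by (rule finite_nat_eventually_0[of "nat (Ka - q)"]) (auto simp: Ka)
    have fb: "finite {k. (sg (l - 1 - p) k) *\<^sub>C b (l - 1 - p - int k) (n - 1 - q + int k) \<noteq> 0}"
      by (rule finite_nat_eventually_0[of "nat (Kb - (n - 1 - q))"]) (auto simp: Kb)
    have "taylor a p q \<otimes> taylor b (l - 1 - p) (n - 1 - q) =
       Sum_any (\<lambda>i. (sg p i *\<^sub>C a (p - int i) (q + int i)) \<otimes> taylor b (l - 1 - p) (n - 1 - q))"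
      unfolding taylor_def[of a] sg_def[symmetric] by (rule clinear_Sum_any[OF clinear_pure_left fa])
    also have "\<dots> = Sum_any (\<lambda>i. Sum_any (\<lambda>k. H p q i k))"
    proof (rule arg_cong[where f = Sum_any], rule ext)
      fix i
      have "(sg p i *\<^sub>C a (p - int i) (q + int i)) \<otimes> taylor b (l - 1 - p) (n - 1 - q) =
        Sum_any (\<lambda>k. (sg p i *\<^sub>C a (p - int i) (q + int i)) \<otimes> (sg (l - 1 - p) k *\<^sub>C b (l - 1 - p - int k) (n - 1 - q + int k)))"
        unfolding taylor_def[of b] sg_def[symmetric] by (rule clinear_Sum_any[OF clinear_pure_right fb])
      also have "\<dots> = Sum_any (\<lambda>k. H p q i k)"
        by (simp add: H_def pure_tensor_scale_left pure_tensor_scale_right mult.commute)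
      finally show "(sg p i *\<^sub>C a (p - int i) (q + int i)) \<otimes> taylor b (l - 1 - p) (n - 1 - q) = Sum_any (\<lambda>k. H p q i k)" .
    qed
    also have "\<dots> = Sum_any (\<lambda>(i, k). H p q i k)"
      by (rule Sum_any_fubini) (use slice[of "\<lambda>(p, q) (i, k). H p q i k" "(p, q)"] finH in \<open>simp add: split_def\<close>)
    finally show ?thesis .
  qed
  have fub: "Sum_any (\<lambda>z. Sum_any (\<lambda>w. f z w)) = Sum_any (\<lambda>(z, w). f z w)"
    if "finite {(z, w). f z w \<noteq> 0}" for f :: "int \<times> int \<Rightarrow> nat \<times> nat \<Rightarrow> ('a, 'b) tensor"
    by (rule Sum_any_fubini[OF that])
  have "convolve (taylor a) (taylor b) l n = Sum_any (\<lambda>z. Sum_any (\<lambda>w. (\<lambda>(p, q) (i, k). H p q i k) z w))"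
    unfolding convolve_def tt by (simp add: split_def)
  also have "\<dots> = Sum_any (\<lambda>(z, w). (\<lambda>(p, q) (i, k). H p q i k) z w)"
    by (rule fub) (use finH in \<open>simp add: split_def\<close>)
  also have "\<dots> = Sum_any (\<lambda>z. (\<lambda>((p, q), (i, k)). H p q i k) (\<phi> z))"
    by (subst Sum_any_reindex_bij[OF bij]) (simp add: split_def)
  also have "\<dots> = Sum_any (\<lambda>(z, w). (\<lambda>(p, q) (i, k). G p q i k) z w)"
    unfolding H\<phi> by (simp add: split_def)
  also have "\<dots> = Sum_any (\<lambda>z. Sum_any (\<lambda>w. (\<lambda>(p, q) (i, k). G p q i k) z w))"
    by (rule fub[symmetric]) (use finG in \<open>simp add: split_def\<close>)
  also have "\<dots> = Sum_any (\<lambda>(p, q). Sum_any (\<lambda>j. sg l j *\<^sub>C (a p q \<otimes> b (l - int j - 1 - p) (n + int j - 1 - q))))"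
  proof (rule arg_cong[where f = Sum_any], rule ext, clarify)
    fix p q
    have "Sum_any (\<lambda>(i, k). G p q i k) = Sum_any (\<lambda>j. \<Sum>i\<le>j. G p q i (j - i))"
    proof (rule Sum_any_triangle[of "nat (Kb + q - n + 1)"])
      fix i k assume "nat (Kb + q - n + 1) \<le> i + k"
      then have "n - 1 - q + int i + int k \<ge> Kb" by linarith
      then show "G p q i k = 0" by (simp only: G_def Kb pure_tensor_0 cvs.scale_zero_right)
    qed
    also have "\<dots> = Sum_any (\<lambda>j. sg l j *\<^sub>C (a p q \<otimes> b (l - int j - 1 - p) (n + int j - 1 - q)))"
    proof (rule arg_cong[where f = Sum_any], rule ext)
      fix j
      have "G p q i (j - i) = (sg (p + int i) i * sg (l - 1 - p - int i) (j - i)) *\<^sub>C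
          (a p q \<otimes> b (l - int j - 1 - p) (n + int j - 1 - q))" if "i \<le> j" for i
      proof -
        have "l - 1 - p - int i - int (j - i) = l - int j - 1 - p" "n - 1 - q + int i + int (j - i) = n + int j - 1 - q"
          using that by auto
        then show ?thesis by (simp only: G_def)
      qed
      then have "(\<Sum>i\<le>j. G p q i (j - i)) = (\<Sum>i\<le>j. sg (p + int i) i * sg (l - 1 - p - int i) (j - i)) *\<^sub>C
          (a p q \<otimes> b (l - int j - 1 - p) (n + int j - 1 - q))"
        by (simp add: cvs.scale_sum_left)
      also have "(\<Sum>i\<le>j. sg (p + int i) i * sg (l - 1 - p - int i) (j - i)) = 
         (\<Sum>i\<le>j. (- 1) ^ j * ((of_int p + of_nat i gchoose i) * (of_int l - 1 - of_int p - of_nat i gchoose (j - i))))"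
      proof (rule sum.cong[OF refl])
        fix i assume "i \<in> {..j}"
        then have "(- 1 :: complex) ^ j = (- 1) ^ i * (- 1) ^ (j - i)"
          by (simp flip: power_add)
        then show "sg (p + int i) i * sg (l - 1 - p - int i) (j - i) =
           (- 1) ^ j * ((of_int p + of_nat i gchoose i) * (of_int l - 1 - of_int p - of_nat i gchoose (j - i)))"
          by (simp add: sg_def)
      qed
      also have "\<dots> = sg l j"
        unfolding sum_distrib_left[symmetric] gbinomial_shifted_Vandermonde by (simp add: sg_def)
      finally show "(\<Sum>i\<le>j. G p q i (j - i)) = sg l j *\<^sub>C (a p q \<otimes> b (l - int j - 1 - p) (n + int j - 1 - q))" .
    qed
    finally show "Sum_any (\<lambda>w. case w of (i, k) \<Rightarrow> G p q i k) = Sum_any (\<lambda>j. sg l j *\<^sub>C (a p q \<otimes> b (l - int j - 1 - p) (n + int j - 1 - q)))" .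
  qed
  finally have R: "convolve (taylor a) (taylor b) l n =
    Sum_any (\<lambda>(p, q). Sum_any (\<lambda>j. sg l j *\<^sub>C (a p q \<otimes> b (l - int j - 1 - p) (n + int j - 1 - q))))" .
  define T where "T z j = (\<lambda>(p, q). sg l j *\<^sub>C (a p q \<otimes> b (l - int j - 1 - p) (n + int j - 1 - q))) z" for z and j :: nat
  have finT: "finite {(z, j). T z j \<noteq> 0}"
  proof (rule finite_subset[OF _ finite_imageI[OF S, of "\<lambda>(z, (i, k)). (z, k)"]], clarify)
    fix p q j assume "T (p, q) j \<noteq> 0"
    then have "((p, q), (0, j)) \<in> ?S"
      by (auto simp: T_def algebra_simps)
    then show "((p, q), j) \<in> (\<lambda>(z, (i, k)). (z, k)) ` ?S"
      by (rule rev_image_eqI) simp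
  qed
  have "convolve (taylor a) (taylor b) l n = Sum_any (\<lambda>z. Sum_any (\<lambda>j. T z j))"
    unfolding R T_def by (simp add: split_def)
  also have "\<dots> = Sum_any (\<lambda>j. Sum_any (\<lambda>z. T z j))"
  proof (rule Sum_any.swap)
    have "{z. \<exists>j. T z j \<noteq> 0} = fst ` {(z, j). T z j \<noteq> 0}" "{j. \<exists>z. T z j \<noteq> 0} = snd ` {(z, j). T z j \<noteq> 0}"
      by force+
    then show "finite ({z. \<exists>j. T z j \<noteq> 0} \<times> {j. \<exists>z. T z j \<noteq> 0})"
      using finT by simp
  qed simp
  also have "\<dots> = taylor (convolve a b) l n"
    unfolding taylor_def
  proof (rule arg_cong[where f = Sum_any], rule ext)
    fix j :: nat
    have "finite {z. (case z of (p, q) \<Rightarrow> a p q \<otimes> b (l - int j - 1 - p) (n + int j - 1 - q)) \<noteq> 0}"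
      by (rule finite_tensor_support, rule convolvable_flip, rule convolvable_truncated) (fact a b)+
    then show "Sum_any (\<lambda>z. T z j) = ((- 1) ^ j * (of_int l gchoose j)) *\<^sub>C convolve a b (l - int j) (n + int j)"
      unfolding convolve_def sg_def[symmetric] T_def by (subst Sum_any_scaleC) (auto simp: split_def)
  qed
  finally show ?thesis by simp
qed

text \<open>Each factor yields a locality exponent and an associativity exponent. Powers of the same
  linear form multiply under convolution, so the sums of the exponents serve for the product, and
  the identity is rebuilt from there.\<close>

lemma jacobi_grids_convolve:
  assumes a: "truncated (\<lambda>q p. a p q)" and b: "truncated b" and d: "truncated d" and J: "jacobi_grids a b d"
    and a': "truncated (\<lambda>q p. a' p q)" and b': "truncated b'" and d': "truncated d'" and J': "jacobi_grids a' b' d'"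
  shows "jacobi_grids (convolve a a') (convolve b b') (convolve d d')"
proof -
  obtain L m where L: "(lin_shift (- 1) ^^ L) a = (lin_shift (- 1) ^^ L) b"
    and assoc: "\<And>l n. expand0 d l (int m) n = expand12 a l (int m) n"
    and m: "\<And>p q. p \<ge> int m \<Longrightarrow> b p q = 0"
    using jacobi_gridsD[OF a b d J] by blast
  obtain L' m' where L': "(lin_shift (- 1) ^^ L') a' = (lin_shift (- 1) ^^ L') b'"
    and assoc': "\<And>l n. expand0 d' l (int m') n = expand12 a' l (int m') n"
    and m': "\<And>p q. p \<ge> int m' \<Longrightarrow> b' p q = 0"
    using jacobi_gridsD[OF a' b' d' J'] by blast
  have conv: "convolvable ((lin_shift c ^^ i) x) ((lin_shift c ^^ j) y)"
    if "truncated x" "truncated y" for c i j and x :: "'a grid" and y :: "'b grid"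
    by (rule convolvable_truncated) (intro truncated_funpow that)+
  have conv': "convolvable ((lin_shift c ^^ i) x) ((lin_shift c ^^ j) y)"
    if "truncated (\<lambda>q p. x p q)" "truncated (\<lambda>q p. y p q)" for c i j and x :: "'a grid" and y :: "'b grid"
    by (rule convolvable_flip, rule convolvable_truncated) (intro truncated_flip_funpow that)+
  show ?thesis
  proof (rule jacobi_gridsI)
    show "truncated (\<lambda>q p. convolve a a' p q)" "truncated (convolve b b')" "truncated (convolve d d')"
      by (intro truncated_flip_convolve truncated_convolve a b d a' b' d')+
    show "(lin_shift (- 1) ^^ (L + L')) (convolve a a') = (lin_shift (- 1) ^^ (L + L')) (convolve b b')"
    proof -
      have "(lin_shift (- 1) ^^ (L + L')) (convolve a a') = convolve ((lin_shift (- 1) ^^ L) a) ((lin_shift (- 1) ^^ L') a')"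
        by (rule convolve_funpow[symmetric]) (intro conv' a a')
      moreover have "(lin_shift (- 1) ^^ (L + L')) (convolve b b') = convolve ((lin_shift (- 1) ^^ L) b) ((lin_shift (- 1) ^^ L') b')"
        by (rule convolve_funpow[symmetric]) (intro conv b b')
      ultimately show ?thesis by (simp only: L L')
    qed
    show "convolve b b' p q = 0" if "p \<ge> int (m + m')" for p q
    proof -
      have "b i j \<otimes> b' (p - 1 - i) (q - 1 - j) = 0" for i j
      proof (cases "i \<ge> int m")
        case False
        then have "p - 1 - i \<ge> int m'" using that by linarith
        then show ?thesis by (simp only: m' pure_tensor_0)
      qed (simp only: m pure_tensor_0)
      then show ?thesis by (simp add: convolve_def)
    qed
    show "expand0 (convolve d d') l (int (m + m')) n = expand12 (convolve a a') l (int (m + m')) n" for l n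
    proof -
      \<comment> \<open>Associativity in multiplicative form: after clearing by a power of z0 + z2,
        the iterate equals the product with z1 = z0 + z2 substituted.\<close>
      have eq: "(lin_shift 1 ^^ m) d = (lin_shift 1 ^^ m) (taylor a)" "(lin_shift 1 ^^ m') d' = (lin_shift 1 ^^ m') (taylor a')"
        using assoc assoc'
        unfolding expand0_funpow[OF d] expand0_funpow[OF d'] expand12_funpow2[OF a] expand12_funpow2[OF a'] taylor_eq
        by (simp_all add: fun_eq_iff)
      have "expand0 (convolve d d') l (int (m + m')) n = (lin_shift 1 ^^ (m + m')) (convolve d d') l n"
        by (rule expand0_funpow) (intro truncated_convolve d d')
      also have "(lin_shift 1 ^^ (m + m')) (convolve d d') = convolve ((lin_shift 1 ^^ m) (taylor a)) ((lin_shift 1 ^^ m') (taylor a'))"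
        unfolding eq[symmetric] by (rule convolve_funpow[symmetric]) (intro conv d d')
      also have "\<dots> = (lin_shift 1 ^^ (m + m')) (convolve (taylor a) (taylor a'))"
        by (rule convolve_funpow) (intro conv' truncated_taylor a a')
      also have "convolve (taylor a) (taylor a') = taylor (convolve a a')"
        by (intro ext) (rule taylor_convolve[OF a a', symmetric])
      also have "(lin_shift 1 ^^ (m + m')) (taylor (convolve a a')) l n = expand12 (convolve a a') l (int (m + m')) n"
        unfolding expand12_funpow2[OF truncated_flip_convolve[OF a a']] taylor_eq ..
      finally show ?thesis .
    qed
  qed
qed

section \<open>Multilinearity of the Jacobi identity\<close>

text \<open>The linearity and truncation needed before the grids of an action can be handled; the
  tensor action acquires them before its Jacobi identity is known.\<close>

definition field_action :: "('v::complex_space \<Rightarrow> int \<Rightarrow> 'w::complex_space \<Rightarrow> 'w) \<Rightarrow> bool" where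
  "field_action act \<longleftrightarrow> (\<forall>n. cbilinear (\<lambda>v. act v n)) \<and> (\<forall>v w. \<exists>K. \<forall>n\<ge>K. act v n w = 0)"

context
  fixes act :: "'v::complex_space \<Rightarrow> int \<Rightarrow> 'w::complex_space \<Rightarrow> 'w"
  assumes act: "field_action act"
begin

lemma action_clinear: "clinear (act v n)" and action_clinear_left: "clinear (\<lambda>v. act v n w)"
  using act by (simp_all add: field_action_def cbilinear_def)

lemmas action_add = clinear_add[OF action_clinear] clinear_add[OF action_clinear_left]
lemmas action_scale = clinear_scale[OF action_clinear] clinear_scale[OF action_clinear_left]
lemmas action_0 = clinear_0[OF action_clinear] clinear_0[OF action_clinear_left]
lemmas action_diff = clinear_diff[OF action_clinear] clinear_diff[OF action_clinear_left]
lemmas action_minus = clinear_minus[OF action_clinear] clinear_minus[OF action_clinear_left]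

lemma action_truncation: obtains K where "\<And>n. n \<ge> K \<Longrightarrow> act v n w = 0"
  using act unfolding field_action_def by blast

end

lemma vertex_module_action: "vertex_module V act \<Longrightarrow> field_action act"
  by (simp add: vertex_module_def field_action_def)

text \<open>Isolating one triple of vectors allows a check on pure tensors followed by linear
  extension. The Koszul sign is absorbed into the second grid.\<close>

definition jacobi_triple ::
  "complex \<Rightarrow> ('v::complex_space \<Rightarrow> int \<Rightarrow> 'v \<Rightarrow> 'v) \<Rightarrow> ('v \<Rightarrow> int \<Rightarrow> 'w::complex_space \<Rightarrow> 'w) \<Rightarrow> 'v \<Rightarrow> 'v \<Rightarrow> 'w \<Rightarrow> bool" where
  "jacobi_triple \<kappa> Y act u v w \<longleftrightarrow>
     jacobi_grids (\<lambda>m n. act u m (act v n w)) (\<lambda>m n. \<kappa> *\<^sub>C act v n (act u m w)) (\<lambda>k n. act (Y u k v) n w)"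

lemma borcherds_identity_iff:
  "borcherds_identity V act \<longleftrightarrow>
    (\<forall>p q. \<forall>u\<in>part V p. \<forall>v\<in>part V q. \<forall>w. jacobi_triple (koszul p q) (mode V) act u v w)"
  unfolding borcherds_identity_def jacobi_triple_def jacobi_grids_def expand0_def expand12_def expand21_def
  by (simp add: mult_ac)

context
  fixes Y :: "'v::complex_space \<Rightarrow> int \<Rightarrow> 'v \<Rightarrow> 'v" and act :: "'v \<Rightarrow> int \<Rightarrow> 'w::complex_space \<Rightarrow> 'w"
  assumes Y: "field_action Y" and act: "field_action act"
begin

lemma truncated_products: "truncated (\<lambda>n m. act u m (act v n w))"
proof -
  obtain K where K: "\<And>n. n \<ge> K \<Longrightarrow> act v n w = 0" using action_truncation[OF act] by blast
  have "\<exists>K. \<forall>n\<ge>K. \<forall>m. act u m (act v n w) = 0"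
    by (rule exI[of _ K]) (simp add: K action_0[OF act])
  moreover have "\<exists>K. \<forall>m\<ge>K. act u m (act v n w) = 0" for n
    using action_truncation[OF act] by metis
  ultimately show ?thesis by (simp add: truncated_def)
qed

lemma truncated_scaled: "truncated a \<Longrightarrow> truncated (\<lambda>m n. \<kappa> *\<^sub>C a m n)" for a :: "'x::complex_space grid"
  unfolding truncated_def by (metis cvs.scale_zero_right)

lemma truncated_opposite_products: "truncated (\<lambda>m n. \<kappa> *\<^sub>C act v n (act u m w))"
  by (rule truncated_scaled) (rule truncated_products)

lemma truncated_iterates: "truncated (\<lambda>k n. act (Y u k v) n w)"
proof -
  obtain K where K: "\<And>n. n \<ge> K \<Longrightarrow> Y u n v = 0" using action_truncation[OF Y] by blast
  have "\<exists>K. \<forall>k\<ge>K. \<forall>n. act (Y u k v) n w = 0"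
    by (rule exI[of _ K]) (simp add: K action_0[OF act])
  moreover have "\<exists>K. \<forall>n\<ge>K. act (Y u k v) n w = 0" for k
    using action_truncation[OF act] by metis
  ultimately show ?thesis by (simp add: truncated_def)
qed

end

lemma Sum_any_combine:
  assumes "\<And>j::nat. j \<ge> J \<Longrightarrow> x j = 0" "\<And>j. j \<ge> J \<Longrightarrow> y j = 0"
  shows "Sum_any (\<lambda>j. k j *\<^sub>C (c *\<^sub>C x j + y j)) = c *\<^sub>C Sum_any (\<lambda>j. k j *\<^sub>C x j) + Sum_any (\<lambda>j. k j *\<^sub>C y j)"
proof -
  have s: "Sum_any (\<lambda>j. k j *\<^sub>C z j) = (\<Sum>j<J. k j *\<^sub>C z j)" if "\<And>j. j \<ge> J \<Longrightarrow> z j = 0" for z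
    by (rule Sum_any_superset) (auto simp: that not_less)
  have 1: "Sum_any (\<lambda>j. k j *\<^sub>C (c *\<^sub>C x j + y j)) = (\<Sum>j<J. k j *\<^sub>C (c *\<^sub>C x j + y j))"
    by (rule s) (simp add: assms)
  have 2: "Sum_any (\<lambda>j. k j *\<^sub>C x j) = (\<Sum>j<J. k j *\<^sub>C x j)" "Sum_any (\<lambda>j. k j *\<^sub>C y j) = (\<Sum>j<J. k j *\<^sub>C y j)"
    by (rule s; simp add: assms)+
  show ?thesis
    unfolding 1 2
    by (simp add: cvs.scale_right_distrib sum.distrib cvs.scale_sum_right mult.commute)
qed

text \<open>An expansion sums over all \<open>j\<close>, so its additivity rests on a truncation
  bound common to the two grids.\<close>

lemma jacobi_grids_combine:
  assumes a: "truncated (\<lambda>q p. a p q)" and b: "truncated b" and d: "truncated d" and J: "jacobi_grids a b d"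
    and a': "truncated (\<lambda>q p. a' p q)" and b': "truncated b'" and d': "truncated d'" and J': "jacobi_grids a' b' d'"
  shows "jacobi_grids (\<lambda>m n. c *\<^sub>C a m n + a' m n) (\<lambda>m n. c *\<^sub>C b m n + b' m n) (\<lambda>m n. c *\<^sub>C d m n + d' m n)"
proof -
  have common: "\<exists>J. \<forall>j\<ge>J. (\<forall>q. x (p + int j) q = 0) \<and> (\<forall>q. y (p + int j) q = 0)"
    if x: "truncated x" and y: "truncated y" for x y :: "'a grid" and p
  proof -
    obtain J1 where 1: "\<And>j::nat. j \<ge> J1 \<Longrightarrow> \<forall>q. x (p + int j) q = 0"
      using truncated_uniform_shift[OF x] by blast
    obtain J2 where 2: "\<And>j::nat. j \<ge> J2 \<Longrightarrow> \<forall>q. y (p + int j) q = 0"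
      using truncated_uniform_shift[OF y] by blast
    show ?thesis
      using 1 2 by (intro exI[of _ "max J1 J2"]) auto
  qed
  have "expand12 (\<lambda>m n. c *\<^sub>C a m n + a' m n) l m n = c *\<^sub>C expand12 a l m n + expand12 a' l m n" for l m n
  proof -
    obtain J where "\<forall>j\<ge>J. (\<forall>q. a q (n + int j) = 0) \<and> (\<forall>q. a' q (n + int j) = 0)"
      using common[OF a a'] by blast
    then show ?thesis
      unfolding expand12_def by (intro Sum_any_combine[of J]) auto
  qed
  moreover have "expand21 (\<lambda>m n. c *\<^sub>C b m n + b' m n) l m n = c *\<^sub>C expand21 b l m n + expand21 b' l m n" for l m n
  proof -
    obtain J where "\<forall>j\<ge>J. (\<forall>q. b (m + int j) q = 0) \<and> (\<forall>q. b' (m + int j) q = 0)"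
      using common[OF b b'] by blast
    then show ?thesis
      unfolding expand21_def by (intro Sum_any_combine[of J]) auto
  qed
  moreover have "expand0 (\<lambda>m n. c *\<^sub>C d m n + d' m n) l m n = c *\<^sub>C expand0 d l m n + expand0 d' l m n" for l m n
  proof -
    obtain J where "\<forall>j\<ge>J. (\<forall>q. d (l + int j) q = 0) \<and> (\<forall>q. d' (l + int j) q = 0)"
      using common[OF d d'] by blast
    then show ?thesis
      unfolding expand0_def by (intro Sum_any_combine[of J]) auto
  qed
  ultimately show ?thesis
    using J J' by (simp add: jacobi_grids_def cvs.scale_right_diff_distrib)
qed

lemma jacobi_grids_zero: "jacobi_grids (\<lambda>m n. 0) (\<lambda>m n. 0) (\<lambda>m n. 0)"
  by (simp add: jacobi_grids_def expand0_def expand12_def expand21_def)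

context
  fixes Y :: "'v::complex_space \<Rightarrow> int \<Rightarrow> 'v \<Rightarrow> 'v" and act :: "'v \<Rightarrow> int \<Rightarrow> 'w::complex_space \<Rightarrow> 'w"
  assumes Y: "field_action Y" and act: "field_action act"
begin

lemma jacobi_triple_combine:
  assumes "jacobi_triple \<kappa> Y act u v w" "jacobi_triple \<kappa> Y act u' v' w'"
    and "\<And>m n. act x m (act y n z) = c *\<^sub>C act u m (act v n w) + act u' m (act v' n w')"
    and "\<And>m n. act y n (act x m z) = c *\<^sub>C act v n (act u m w) + act v' n (act u' m w')"
    and "\<And>k n. act (Y x k y) n z = c *\<^sub>C act (Y u k v) n w + act (Y u' k v') n w'"
  shows "jacobi_triple \<kappa> Y act x y z"
  using jacobi_grids_combine[OF truncated_products[OF Y act] truncated_opposite_products[OF Y act] truncated_iterates[OF Y act]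
     assms(1)[unfolded jacobi_triple_def] truncated_products[OF Y act] truncated_opposite_products[OF Y act] truncated_iterates[OF Y act]
     assms(2)[unfolded jacobi_triple_def], of c]
  unfolding jacobi_triple_def assms(3-5) by (simp add: cvs.scale_right_distrib mult.commute)

lemma jacobi_triple_zero: "jacobi_triple \<kappa> Y act 0 v w" "jacobi_triple \<kappa> Y act u 0 w"
  by (simp_all add: jacobi_triple_def action_0[OF Y] action_0[OF act] jacobi_grids_zero)

text \<open>The homogeneous parts of a tensor product are spans of pure tensors; with the sign held
  fixed, this reduces the identity on them to pure tensors.\<close>

lemma jacobi_triple_span:
  assumes "\<And>u v. u \<in> A \<Longrightarrow> v \<in> B \<Longrightarrow> jacobi_triple \<kappa> Y act u v w" "u \<in> cvs.span A" "v \<in> cvs.span B"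
  shows "jacobi_triple \<kappa> Y act u v w"
  using assms(2)
proof (induction rule: cvs.span_induct_alt)
  case base
  show ?case by (rule jacobi_triple_zero)
next
  case (step c x u)
  have "jacobi_triple \<kappa> Y act x v w"
    using assms(3)
  proof (induction rule: cvs.span_induct_alt)
    case base
    show ?case by (rule jacobi_triple_zero)
  next
    case (step c y v)
    show ?case
      by (rule jacobi_triple_combine[OF assms(1)[OF \<open>x \<in> A\<close> step(1)] step(2), of _ _ _ c])
        (simp_all add: action_add[OF act] action_scale[OF act] action_add[OF Y] action_scale[OF Y])
  qed
  from jacobi_triple_combine[OF this step(2), of _ _ _ c] show ?case
    by (simp_all add: action_add[OF act] action_scale[OF act] action_add[OF Y] action_scale[OF Y])
qed

lemma jacobi_triple_add:
  assumes "jacobi_triple \<kappa> Y act u v w" "jacobi_triple \<kappa> Y act u v w'"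
  shows "jacobi_triple \<kappa> Y act u v (w + w')"
  by (rule jacobi_triple_combine[OF assms, of _ _ _ 1]) (simp_all add: action_add[OF act])

end

section \<open>Tensor products of vertex modules\<close>

context
  fixes Y :: "'m::complex_space \<Rightarrow> int \<Rightarrow> 'n::complex_space \<Rightarrow> 'n"
    and Z :: "'f::complex_space \<Rightarrow> int \<Rightarrow> 'g::complex_space \<Rightarrow> 'g"
  assumes Y: "field_action Y" and Z: "field_action Z"
begin

lemma finite_tensor_terms: "finite {i. Y x i w \<otimes> Z y (k - 1 - i) g \<noteq> 0}"
proof -
  obtain K where K: "\<And>n. n \<ge> K \<Longrightarrow> Y x n w = 0" using action_truncation[OF Y] by blast
  obtain L where L: "\<And>n. n \<ge> L \<Longrightarrow> Z y n g = 0" using action_truncation[OF Z] by blast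
  have "Y x i w \<otimes> Z y (k - 1 - i) g = 0" if "i \<notin> {k - 1 - L..K}" for i
  proof (cases "i \<ge> K")
    case False
    then have "k - 1 - i \<ge> L" using that by auto
    then show ?thesis by (simp only: L pure_tensor_0)
  qed (simp only: K pure_tensor_0)
  then have "{i. Y x i w \<otimes> Z y (k - 1 - i) g \<noteq> 0} \<subseteq> {k - 1 - L..K}"
    by blast
  then show ?thesis
    by (rule finite_subset) simp
qed

definition tensor_terms where
  "tensor_terms k w g x y = Sum_any (\<lambda>i. Y x i w \<otimes> Z y (k - 1 - i) g)"

lemma tensor_terms_linear:
  "clinear (tensor_terms k w g x)" "clinear (\<lambda>x. tensor_terms k w g x y)"
  "clinear (\<lambda>g. tensor_terms k w g x y)" "clinear (\<lambda>w. tensor_terms k w g x y)"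
  unfolding tensor_terms_def
  by (rule clinearI;
      simp add: action_add[OF Y] action_add[OF Z] action_scale[OF Y] action_scale[OF Z]
        pure_tensor_add_left pure_tensor_add_right pure_tensor_scale_left pure_tensor_scale_right
        Sum_any_add Sum_any_scaleC finite_tensor_terms)+

lemma cbilinear_tensor_terms: "cbilinear (tensor_terms k w g)"
  by (simp add: cbilinear_def tensor_terms_linear)

text \<open>\<open>tensor_lift\<close> is controlled only for bilinear maps, and
  \<open>tensor_action\<close> nests it twice. For the outer use, linearity in \<open>w\<close> and
  \<open>g\<close> passes from pure \<open>t\<close> to all \<open>t\<close> by induction.\<close>

lemma cbilinear_tensor_lift_terms: "cbilinear (\<lambda>w g. tensor_lift (tensor_terms k w g) t)"
proof -
  have l: "clinear (tensor_lift (tensor_terms k w g))" for w g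
    by (rule clinear_tensor_lift[OF cbilinear_tensor_terms])
  have p: "tensor_lift (tensor_terms k w g) (x \<otimes> y) = tensor_terms k w g x y" for w g x y
    by (rule tensor_lift_pure[OF cbilinear_tensor_terms])
  have "clinear (\<lambda>g. tensor_lift (tensor_terms k w g) t)" for w
    by (rule clinearI; induction t rule: tensor_induct)
      (simp_all add: p clinear_add[OF l] clinear_add[OF tensor_terms_linear(3)]
        clinear_scale[OF tensor_terms_linear(3)] cvs.scale_right_distrib)
  moreover have "clinear (\<lambda>w. tensor_lift (tensor_terms k w g) t)" for g
    by (rule clinearI; induction t rule: tensor_induct)
      (simp_all add: p clinear_add[OF l] clinear_add[OF tensor_terms_linear(4)]
        clinear_scale[OF tensor_terms_linear(4)] cvs.scale_right_distrib)
  ultimately show ?thesis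
    by (simp add: cbilinear_def)
qed

lemma tensor_action_eq: "tensor_action Y Z t k = tensor_lift (\<lambda>w g. tensor_lift (tensor_terms k w g) t)"
  unfolding tensor_action_def tensor_terms_def by (intro arg_cong[where f = tensor_lift] ext) simp

lemma clinear_tensor_action: "clinear (tensor_action Y Z t k)"
  unfolding tensor_action_eq by (rule clinear_tensor_lift[OF cbilinear_tensor_lift_terms])

lemma tensor_action_pure_right: "tensor_action Y Z t k (w \<otimes> g) = tensor_lift (tensor_terms k w g) t"
  unfolding tensor_action_eq by (rule tensor_lift_pure[OF cbilinear_tensor_lift_terms])

lemma tensor_action_pure:
  "tensor_action Y Z (x \<otimes> y) k (w \<otimes> g) = Sum_any (\<lambda>i. Y x i w \<otimes> Z y (k - 1 - i) g)"
  by (simp add: tensor_action_pure_right tensor_lift_pure[OF cbilinear_tensor_terms] tensor_terms_def)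

lemma clinear_tensor_action_left: "clinear (\<lambda>t. tensor_action Y Z t k s)"
proof (induction s rule: tensor_induct)
  case (pure x y)
  show ?case
    unfolding tensor_action_pure_right by (rule clinear_tensor_lift[OF cbilinear_tensor_terms])
next
  case (add s t)
  then show ?case
    by (simp add: clinear_add[OF clinear_tensor_action] clinear_plus)
qed

lemma tensor_action_truncation: "\<exists>K. \<forall>n\<ge>K. tensor_action Y Z t n s = 0"
proof (induction s rule: tensor_induct)
  case (pure w g)
  show ?case
  proof (induction t rule: tensor_induct)
    case (pure x y)
    obtain K where K: "\<And>n. n \<ge> K \<Longrightarrow> Y x n w = 0" using action_truncation[OF Y] by blast
    obtain L where L: "\<And>n. n \<ge> L \<Longrightarrow> Z y n g = 0" using action_truncation[OF Z] by blast
    have "Y x i w \<otimes> Z y (n - 1 - i) g = 0" if "n \<ge> K + L + 1" for n i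
    proof (cases "i \<ge> K")
      case False
      then have "n - 1 - i \<ge> L" using that by linarith
      then show ?thesis by (simp only: L pure_tensor_0)
    qed (simp only: K pure_tensor_0)
    then show ?case
      unfolding tensor_action_pure by (intro exI[of _ "K + L + 1"]) auto
  next
    case (add s t)
    then obtain K L where "\<forall>n\<ge>K. tensor_action Y Z s n (w \<otimes> g) = 0" "\<forall>n\<ge>L. tensor_action Y Z t n (w \<otimes> g) = 0"
      by blast
    then show ?case
      by (intro exI[of _ "max K L"]) (simp add: clinear_add[OF clinear_tensor_action_left])
  qed
next
  case (add r s)
  then obtain K L where "\<forall>n\<ge>K. tensor_action Y Z t n r = 0" "\<forall>n\<ge>L. tensor_action Y Z t n s = 0"
    by blast
  then show ?case
    by (intro exI[of _ "max K L"]) (simp add: clinear_add[OF clinear_tensor_action])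
qed

lemma field_action_tensor: "field_action (tensor_action Y Z)"
  by (simp add: field_action_def cbilinear_def clinear_tensor_action clinear_tensor_action_left tensor_action_truncation)

text \<open>Describes the mode on an arbitrary tensor, which the interpolation argument requires
  because elements of a submodule are in general not pure.\<close>

lemma tensor_action_expand:
  "tensor_action Y Z (x \<otimes> y) k t = Sum_any (\<lambda>i. tensor_map (Y x i) (Z y (k - 1 - i)) t)"
  and finite_tensor_action_expand: "finite {i. tensor_map (Y x i) (Z y (k - 1 - i)) t \<noteq> 0}"
proof (induction t rule: tensor_induct)
  case (pure w g)
  {
    case 1
    show ?case
      by (simp add: tensor_action_pure tensor_map_pure action_clinear[OF Y] action_clinear[OF Z])
  next
    case 2
    show ?case
      by (simp add: finite_tensor_terms tensor_map_pure action_clinear[OF Y] action_clinear[OF Z])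
  }
next
  case (add s t)
  have l: "clinear (tensor_map (Y x i) (Z y (k - 1 - i)))" for i
    by (rule clinear_tensor_map[OF action_clinear[OF Y] action_clinear[OF Z]])
  {
    case 1
    show ?case
      using add by (simp add: clinear_add[OF l] clinear_add[OF clinear_tensor_action] Sum_any_add)
  next
    case 2
    show ?case
      by (rule finite_subset[OF _ finite_UnI[OF add(2,4)]]) (auto simp: clinear_add[OF l])
  }
qed

end

section \<open>The Jacobi identity for the tensor action\<close>

context
  fixes YM :: "'m::complex_space \<Rightarrow> int \<Rightarrow> 'm \<Rightarrow> 'm" and Y :: "'m \<Rightarrow> int \<Rightarrow> 'n::complex_space \<Rightarrow> 'n"
    and YF :: "'f::complex_space \<Rightarrow> int \<Rightarrow> 'f \<Rightarrow> 'f" and Z :: "'f \<Rightarrow> int \<Rightarrow> 'g::complex_space \<Rightarrow> 'g"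
  assumes YM: "field_action YM" and Y: "field_action Y" and YF: "field_action YF" and Z: "field_action Z"
begin

text \<open>The outer sum runs over the modes that act first, and in that order the products are
  truncated. The grids are therefore convolved with exchanged arguments and flipped at the
  end.\<close>

lemma tensor_products_convolve:
  "tensor_action Y Z (x \<otimes> y) m (tensor_action Y Z (x' \<otimes> y') n (w \<otimes> g)) =
    convolve (\<lambda>m n. Y x m (Y x' n w)) (\<lambda>m n. Z y m (Z y' n g)) m n"
proof -
  let ?a = "\<lambda>j i. Y x i (Y x' j w)" and ?b = "\<lambda>j i. Z y i (Z y' j g)"
  have "tensor_action Y Z (x \<otimes> y) m (tensor_action Y Z (x' \<otimes> y') n (w \<otimes> g)) =
      Sum_any (\<lambda>j. tensor_action Y Z (x \<otimes> y) m (Y x' j w \<otimes> Z y' (n - 1 - j) g))"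
    unfolding tensor_action_pure[OF Y Z, of x' y' n w g]
    by (rule clinear_Sum_any[OF clinear_tensor_action[OF Y Z] finite_tensor_terms[OF Y Z]])
  also have "\<dots> = Sum_any (\<lambda>j. Sum_any (\<lambda>i. ?a j i \<otimes> ?b (n - 1 - j) (m - 1 - i)))"
    by (simp only: tensor_action_pure[OF Y Z])
  also have "\<dots> = Sum_any (\<lambda>(j, i). ?a j i \<otimes> ?b (n - 1 - j) (m - 1 - i))"
  proof (rule Sum_any_fubini)
    have "convolvable ?a ?b"
      by (rule convolvable_truncated) (intro truncated_products[OF YM Y] truncated_products[OF YF Z])+
    from finite_tensor_support[OF this] show "finite {(j, i). ?a j i \<otimes> ?b (n - 1 - j) (m - 1 - i) \<noteq> 0}"
      by (simp add: split_def)
  qed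
  also have "\<dots> = convolve ?a ?b n m"
    by (simp add: convolve_def)
  also have "\<dots> = convolve (\<lambda>m n. Y x m (Y x' n w)) (\<lambda>m n. Z y m (Z y' n g)) m n"
    by (rule convolve_flip)
  finally show ?thesis .
qed

lemma tensor_iterates_convolve:
  "tensor_action Y Z (tensor_action YM YF (x \<otimes> y) k (x' \<otimes> y')) n (w \<otimes> g) =
    convolve (\<lambda>k n. Y (YM x k x') n w) (\<lambda>k n. Z (YF y k y') n g) k n"
proof -
  let ?a = "\<lambda>k n. Y (YM x k x') n w" and ?b = "\<lambda>k n. Z (YF y k y') n g"
  have "tensor_action Y Z (tensor_action YM YF (x \<otimes> y) k (x' \<otimes> y')) n (w \<otimes> g) =
      Sum_any (\<lambda>j. tensor_action Y Z (YM x j x' \<otimes> YF y (k - 1 - j) y') n (w \<otimes> g))"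
    unfolding tensor_action_pure[OF YM YF]
    by (rule clinear_Sum_any[OF clinear_tensor_action_left[OF Y Z] finite_tensor_terms[OF YM YF]])
  also have "\<dots> = Sum_any (\<lambda>j. Sum_any (\<lambda>i. ?a j i \<otimes> ?b (k - 1 - j) (n - 1 - i)))"
    by (simp only: tensor_action_pure[OF Y Z])
  also have "\<dots> = Sum_any (\<lambda>(j, i). ?a j i \<otimes> ?b (k - 1 - j) (n - 1 - i))"
  proof (rule Sum_any_fubini)
    have "convolvable ?a ?b"
      by (rule convolvable_truncated) (intro truncated_iterates[OF YM Y] truncated_iterates[OF YF Z])+
    from finite_tensor_support[OF this] show "finite {(j, i). ?a j i \<otimes> ?b (k - 1 - j) (n - 1 - i) \<noteq> 0}"
      by (simp add: split_def)
  qed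
  also have "\<dots> = convolve ?a ?b k n"
    by (simp add: convolve_def)
  finally show ?thesis .
qed

text \<open>The first factor has sign 1, so the whole sign \<kappa> is attached to the second one
  before the grids are convolved.\<close>

lemma jacobi_triple_tensor_pure:
  assumes 1: "jacobi_triple 1 YM Y x x' w" and 2: "jacobi_triple \<kappa> YF Z y y' g"
  shows "jacobi_triple \<kappa> (tensor_action YM YF) (tensor_action Y Z) (x \<otimes> y) (x' \<otimes> y') (w \<otimes> g)"
proof -
  have opp: "\<kappa> *\<^sub>C tensor_action Y Z (x' \<otimes> y') n (tensor_action Y Z (x \<otimes> y) m (w \<otimes> g)) =
      convolve (\<lambda>m n. 1 *\<^sub>C Y x' n (Y x m w)) (\<lambda>m n. \<kappa> *\<^sub>C Z y' n (Z y m g)) m n" for m n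
  proof -
    let ?a = "\<lambda>m n. Y x' n (Y x m w)" and ?b = "\<lambda>m n. Z y' n (Z y m g)"
    have "convolvable ?a ?b"
      by (rule convolvable_truncated) (intro truncated_products[OF YM Y] truncated_products[OF YF Z])+
    then have "\<kappa> *\<^sub>C convolve ?a ?b m n = convolve ?a (\<lambda>m n. \<kappa> *\<^sub>C ?b m n) m n"
      unfolding convolve_def by (subst Sum_any_scaleC[OF finite_tensor_support]) (auto simp: pure_tensor_scale_right split_def)
    moreover have "tensor_action Y Z (x' \<otimes> y') n (tensor_action Y Z (x \<otimes> y) m (w \<otimes> g)) = convolve ?a ?b m n"
      unfolding tensor_products_convolve by (rule convolve_flip)
    ultimately show ?thesis by simp
  qed
  show ?thesis
    unfolding jacobi_triple_def tensor_products_convolve[of x] opp tensor_iterates_convolve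
    by (rule jacobi_grids_convolve[OF truncated_products[OF YM Y] truncated_opposite_products[OF YM Y] truncated_iterates[OF YM Y]
          1[unfolded jacobi_triple_def] truncated_products[OF YF Z] truncated_opposite_products[OF YF Z] truncated_iterates[OF YF Z]
          2[unfolded jacobi_triple_def]])
qed

end

lemma bit_cases: obtains "p = (0 :: bit)" | "p = 1"
  by (cases p) auto

lemma vertex_module_tensor:
  assumes M: "vertex_algebra M" and Y: "vertex_module M Y"
    and F: "vertex_superalgebra F" and Z: "vertex_module F Z"
  shows "vertex_module (tensor_vertex M F) (tensor_action Y Z)"
proof -
  have fM: "field_action (mode M)" and fF: "field_action (mode F)" and fY: "field_action Y" and fZ: "field_action Z"
    using M F Y Z by (auto simp: vertex_algebra_def vertex_superalgebra_def intro: vertex_module_action)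
  have fT: "field_action (tensor_action (mode M) (mode F))" "field_action (tensor_action Y Z)"
    by (intro field_action_tensor fM fF fY fZ)+
  have M1: "part M 1 = {0}"
    using M by (simp add: vertex_algebra_def)
  have "borcherds_identity (tensor_vertex M F) (tensor_action Y Z)"
    unfolding borcherds_identity_iff
  proof (intro allI ballI)
    fix p q u v w
    assume u: "u \<in> part (tensor_vertex M F) p" and v: "v \<in> part (tensor_vertex M F) q"
    have "jacobi_triple (koszul p q) (tensor_action (mode M) (mode F)) (tensor_action Y Z) u v w"
    proof (induction w rule: tensor_induct)
      case (pure w g)
      show ?case
      proof (rule jacobi_triple_span[OF fT _ u[unfolded tensor_vertex_def vertex_structure.simps] v[unfolded tensor_vertex_def vertex_structure.simps]])
        fix s t
        assume "s \<in> {x \<otimes> y |x y q r. x \<in> part M q \<and> y \<in> part F r \<and> q + r = p}"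
          and "t \<in> {x \<otimes> y |x y p r. x \<in> part M p \<and> y \<in> part F r \<and> p + r = q}"
        then obtain x y q' r x' y' p' r' where s: "s = x \<otimes> y" "x \<in> part M q'" "y \<in> part F r" "q' + r = p"
          and t: "t = x' \<otimes> y'" "x' \<in> part M p'" "y' \<in> part F r'" "p' + r' = q"
          by blast
        show "jacobi_triple (koszul p q) (tensor_action (mode M) (mode F)) (tensor_action Y Z) s t (w \<otimes> g)"
        \<comment> \<open>The odd part of \<open>M\<close> is zero, so a pure tensor with an odd
          left factor vanishes; otherwise its parity is that of the right factor.\<close>
        proof (cases "q' = 1 \<or> p' = 1")
          case True
          then have "s = 0 \<or> t = 0" using s t M1 by auto
          then show ?thesis using jacobi_triple_zero[OF fT] by blast
        next
          case False
          then have "q' = 0" "p' = 0" by (metis bit_cases)+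
          with s t have x: "x \<in> part M 0" "x' \<in> part M 0" and y: "y \<in> part F p" "y' \<in> part F q" by auto
          have "jacobi_triple (koszul 0 0) (mode M) Y x x' w"
            using Y x unfolding vertex_module_def borcherds_identity_iff by blast
          moreover have "jacobi_triple (koszul p q) (mode F) Z y y' g"
            using Z y unfolding vertex_module_def borcherds_identity_iff by blast
          ultimately show ?thesis
            unfolding s t by (intro jacobi_triple_tensor_pure[OF fM fY fF fZ]) (simp_all add: koszul_def)
        qed
      qed
    next
      case (add s t)
      then show ?case by (rule jacobi_triple_add[OF fT])
    qed
    then show "jacobi_triple (koszul p q) (mode (tensor_vertex M F)) (tensor_action Y Z) u v w"
      by (simp add: tensor_vertex_def)
  qed
  moreover have "tensor_action Y Z (vacuum M \<otimes> vacuum F) n t = (if n = - 1 then t else 0)" for n t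
  proof (induction t rule: tensor_induct)
    case (pure w g)
    have "Sum_any (\<lambda>i. Y (vacuum M) i w \<otimes> Z (vacuum F) (n - 1 - i) g) = Y (vacuum M) (- 1) w \<otimes> Z (vacuum F) n g"
      by (subst Sum_any_single[of "- 1"]) (use Y in \<open>simp_all add: vertex_module_def\<close>)
    then show ?case
      unfolding tensor_action_pure[OF fY fZ] using Y Z by (simp add: vertex_module_def)
  next
    case (add s t)
    then show ?case by (simp add: action_add[OF fT(2)])
  qed
  ultimately show ?thesis
    using fT(2) by (simp add: vertex_module_def field_action_def) (simp add: tensor_vertex_def)
qed

lemma vertex_module_pullback:
  assumes act: "vertex_module U act" and h: "vertex_hom V U h"
  shows "vertex_module V (\<lambda>v. act (h v))"
proof -
  have f: "field_action act" by (rule vertex_module_action[OF act])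
  have l: "clinear h" and h_vac: "h (vacuum V) = vacuum U" and h_part: "\<And>p v. v \<in> part V p \<Longrightarrow> h v \<in> part U p"
    and h_mode: "\<And>u n v. h (mode V u n v) = mode U (h u) n (h v)"
    using h by (auto simp: vertex_hom_def)
  have "borcherds_identity V (\<lambda>v. act (h v))"
    using act h_part unfolding borcherds_identity_iff vertex_module_def jacobi_triple_def h_mode by blast
  moreover have "cbilinear (\<lambda>v. act (h v) n)" for n
    using clinear_compose[OF action_clinear_left[OF f] l] action_clinear[OF f] by (simp add: cbilinear_def)
  ultimately show ?thesis
    using act by (simp add: vertex_module_def h_vac)
qed

section \<open>Consequences of the Borcherds identity\<close>

lemma gbinomial_neg_one: "(- 1) ^ j * ((- 1 :: complex) gchoose j) = 1"
  using gbinomial_negated_upper[of "- 1 :: complex" j] gbinomial_of_nat_symmetric[of j j, where 'a = complex]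
  by (simp flip: binomial_gbinomial)

lemma gbinomial_neg_two: "(- 1) ^ j * ((- 2 :: complex) gchoose j) = of_nat j + 1"
proof -
  have "(- 2 :: complex) gchoose j = (- 1) ^ j * ((of_nat (Suc j)) gchoose j)"
    using gbinomial_negated_upper[of "- 2 :: complex" j] by (simp add: algebra_simps)
  then show ?thesis
    by (simp add: binomial_gbinomial[symmetric] del: of_nat_Suc) simp
qed

context
  fixes V :: "'v::complex_space vertex_structure" and act :: "'v \<Rightarrow> int \<Rightarrow> 'w::complex_space \<Rightarrow> 'w"
  assumes V: "vertex_superalgebra V" and act: "vertex_module V act"
begin

lemma borcherds:
  assumes "u \<in> part V p" "v \<in> part V q"
  shows "Sum_any (\<lambda>j::nat. (of_int m gchoose j) *\<^sub>C act (mode V u (l + int j) v) (m + n - int j) w) =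
        Sum_any (\<lambda>j::nat. ((- 1) ^ j * (of_int l gchoose j)) *\<^sub>C act u (m + l - int j) (act v (n + int j) w)) -
        Sum_any (\<lambda>j::nat. (koszul p q * (- 1) powi l * (- 1) ^ j * (of_int l gchoose j)) *\<^sub>C
                      act v (l + n - int j) (act u (m + int j) w))"
  using act assms unfolding vertex_module_def borcherds_identity_def by blast

text \<open>The case \<open>m = 0\<close>: the binomials on the left vanish except for
  \<open>j = 0\<close>.\<close>

lemma borcherds_iterate:
  assumes "u \<in> part V p" "v \<in> part V q"
  shows "act (mode V u l v) n w =
        Sum_any (\<lambda>j::nat. ((- 1) ^ j * (of_int l gchoose j)) *\<^sub>C act u (l - int j) (act v (n + int j) w)) -
        Sum_any (\<lambda>j::nat. (koszul p q * (- 1) powi l * (- 1) ^ j * (of_int l gchoose j)) *\<^sub>C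
                      act v (l + n - int j) (act u (int j) w))"
proof -
  have "(0 gchoose j) = 0" if "j \<noteq> 0" for j :: nat
    using that by (cases j) auto
  then have "Sum_any (\<lambda>j::nat. (of_int 0 gchoose j) *\<^sub>C act (mode V u (l + int j) v) (0 + n - int j) w) = act (mode V u l v) n w"
    by (subst Sum_any_single[of 0]) auto
  then show ?thesis
    unfolding borcherds[OF assms, of 0] by simp
qed

lemma mode_decompose:
  obtains v0 v1 where "v = v0 + v1" "v0 \<in> part V 0" "v1 \<in> part V 1"
  using V unfolding vertex_superalgebra_def by blast

text \<open>The case \<open>l = m = 0\<close>: a zero mode acts as a derivation. As \<open>u\<close>
  is even, the sign is 1 for both parities of \<open>v\<close>, so homogeneous components can be
  added.\<close>

lemma zero_mode_commutator:
  assumes u: "u \<in> part V 0"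
  shows "act u 0 (act v n w) = act (mode V u 0 v) n w + act v n (act u 0 w)"
proof -
  have f: "field_action act" and fV: "field_action (mode V)"
    using act V by (auto simp: vertex_superalgebra_def intro: vertex_module_action)
  have z: "(0 gchoose j) = 0" if "j \<noteq> 0" for j :: nat
    using that by (cases j) auto
  have hom: "act u 0 (act v n w) = act (mode V u 0 v) n w + act v n (act u 0 w)" if "v \<in> part V q" for v q
  proof -
    have "Sum_any (\<lambda>j::nat. ((- 1) ^ j * (of_int 0 gchoose j)) *\<^sub>C act u (0 - int j) (act v (n + int j) w)) = act u 0 (act v n w)"
      by (subst Sum_any_single[of 0]) (auto simp: z)
    moreover have "Sum_any (\<lambda>j::nat. (koszul 0 q * (- 1) powi 0 * (- 1) ^ j * (of_int 0 gchoose j)) *\<^sub>C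
                      act v (0 + n - int j) (act u (int j) w)) = act v n (act u 0 w)"
      by (subst Sum_any_single[of 0]) (auto simp: z koszul_def)
    ultimately show ?thesis
      using borcherds_iterate[OF u that, of 0 n w] by simp
  qed
  obtain v0 v1 where v: "v = v0 + v1" "v0 \<in> part V 0" "v1 \<in> part V 1"
    by (rule mode_decompose)
  then show ?thesis
    using hom[OF v(2)] hom[OF v(3)] by (simp add: action_add[OF f] action_add[OF fV] algebra_simps)
qed

text \<open>The case \<open>l = -1\<close>, where the signed binomials are all 1: the modes of a
  normally ordered product.\<close>

lemma normal_ordered_modes:
  assumes "u \<in> part V p" "v \<in> part V q"
  shows "act (mode V u (- 1) v) n w = Sum_any (\<lambda>j::nat. act u (- 1 - int j) (act v (n + int j) w)) +
     Sum_any (\<lambda>j::nat. koszul p q *\<^sub>C act v (n - 1 - int j) (act u (int j) w))"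
proof -
  have f: "field_action act" by (rule vertex_module_action[OF act])
  obtain K where K: "\<And>n. n \<ge> K \<Longrightarrow> act u n w = 0" using action_truncation[OF f] by blast
  have "- Sum_any (\<lambda>j::nat. (koszul p q * (- 1) powi (- 1) * (- 1) ^ j * (of_int (- 1) gchoose j)) *\<^sub>C
                      act v (- 1 + n - int j) (act u (int j) w)) =
     Sum_any (\<lambda>j::nat. - ((koszul p q * (- 1) powi (- 1) * (- 1) ^ j * (of_int (- 1) gchoose j)) *\<^sub>C
                      act v (- 1 + n - int j) (act u (int j) w)))"
    by (rule clinear_Sum_any[OF _ finite_nat_eventually_0[of "nat K"]]) (auto simp: K action_0[OF f] clinearI)
  also have "\<dots> = Sum_any (\<lambda>j::nat. koszul p q *\<^sub>C act v (n - 1 - int j) (act u (int j) w))"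
  proof (rule arg_cong[where f = Sum_any], rule ext)
    fix j :: nat
    have "koszul p q * (- 1) powi (- 1) * (- 1) ^ j * (of_int (- 1) gchoose j) = - koszul p q"
      using gbinomial_neg_one[of j] by (simp add: mult.assoc)
    moreover have "- 1 + n - int j = n - 1 - int j" by simp
    ultimately show "- ((koszul p q * (- 1) powi (- 1) * (- 1) ^ j * (of_int (- 1) gchoose j)) *\<^sub>C
                      act v (- 1 + n - int j) (act u (int j) w)) = koszul p q *\<^sub>C act v (n - 1 - int j) (act u (int j) w)"
      by (simp only: cvs.scale_minus_left minus_minus)
  qed
  finally show ?thesis
    using borcherds_iterate[OF assms, of "- 1" n w] gbinomial_neg_one by simp
qed

text \<open>The mode -2 on the vacuum is the translation operator, so this is differentiation of a
  field. As the vacuum has a single nonzero mode, each sum keeps at most one term: the first when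
  \<open>n \<le> - 1\<close>, the second when \<open>n \<ge> 1\<close>.\<close>

lemma derivative_modes:
  assumes u: "u \<in> part V p"
  shows "act (mode V u (- 2) (vacuum V)) n w = (- of_int n) *\<^sub>C act u (n - 1) w"
proof -
  have f: "field_action act" by (rule vertex_module_action[OF act])
  have vac: "vacuum V \<in> part V 0" using V by (simp add: vertex_superalgebra_def)
  have v: "act (vacuum V) k x = (if k = - 1 then x else 0)" for k x
    using act by (simp add: vertex_module_def)
  have e: "(- 1) ^ j * (of_int (- 2) gchoose j) = (of_nat j + 1 :: complex)" for j :: nat
    using gbinomial_neg_two[of j] by simp
  have k: "koszul p 0 = 1" by (simp add: koszul_def)
  have "act (mode V u (- 2) (vacuum V)) n w =
      Sum_any (\<lambda>j::nat. (of_nat j + 1) *\<^sub>C act u (- 2 - int j) (act (vacuum V) (n + int j) w)) -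
      Sum_any (\<lambda>j::nat. (of_nat j + 1) *\<^sub>C act (vacuum V) (- 2 + n - int j) (act u (int j) w))"
    unfolding borcherds_iterate[OF u vac] k by (simp add: gbinomial_neg_two)
  also have "Sum_any (\<lambda>j::nat. (of_nat j + 1) *\<^sub>C act u (- 2 - int j) (act (vacuum V) (n + int j) w)) =
     (if n \<le> - 1 then (- of_int n) *\<^sub>C act u (n - 1) w else 0)"
  proof (cases "n \<le> - 1")
    case True
    then have "(of_nat (nat (- 1 - n)) :: complex) = of_int (- 1 - n)" by simp
    then show ?thesis
      using True by (subst Sum_any_single[of "nat (- 1 - n)"]) (auto simp: v action_0[OF f])
  qed (auto simp: v action_0[OF f])
  also have "Sum_any (\<lambda>j::nat. (of_nat j + 1) *\<^sub>C act (vacuum V) (- 2 + n - int j) (act u (int j) w)) =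
     (if n \<ge> 1 then of_int n *\<^sub>C act u (n - 1) w else 0)"
  proof (cases "n \<ge> 1")
    case True
    then have "(of_nat (nat (n - 1)) :: complex) = of_int (n - 1)" by simp
    then show ?thesis
      using True by (subst Sum_any_single[of "nat (n - 1)"]) (auto simp: v)
  qed (auto simp: v)
  finally show ?thesis
    by (cases "n = 0") auto
qed

end

lemma self_neg_eq_0: "x = - x \<Longrightarrow> x = 0" for x :: "'a::complex_space"
proof -
  assume "x = - x"
  then have "x + x = 0" by (metis add.right_inverse)
  then have "2 *\<^sub>C x = 0"
    by (metis cvs.scale_left_distrib cvs.scale_one one_add_one)
  then show "x = 0"
    by simp
qed

section \<open>The Clifford vertex superalgebra\<close>

locale clifford =
  fixes F :: "'f::complex_space vertex_structure" and \<psi> \<psi>s :: 'f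
  assumes clifford: "clifford_vertex_superalgebra F \<psi> \<psi>s"
begin

lemma F: "vertex_superalgebra F"
  and psi_odd: "\<psi> \<in> part F 1" "\<psi>s \<in> part F 1"
  and psi_psis: "mode F \<psi> m (mode F \<psi>s n x) = (if m + n + 1 = 0 then x else 0) - mode F \<psi>s n (mode F \<psi> m x)"
  and psi_psi: "mode F \<psi> m (mode F \<psi> n x) = - mode F \<psi> n (mode F \<psi> m x)"
  and psis_psis: "mode F \<psi>s m (mode F \<psi>s n x) = - mode F \<psi>s n (mode F \<psi>s m x)"
  using clifford by (auto simp: clifford_vertex_superalgebra_def eq_diff_eq eq_neg_iff_add_eq_0)

lemma module_F: "vertex_module F (mode F)"
  and mode_vacuum: "mode F v (- 1) (vacuum F) = v" "n \<ge> 0 \<Longrightarrow> mode F v n (vacuum F) = 0"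
  using F by (auto simp: vertex_superalgebra_def)

lemma action_F: "field_action (mode F)"
  by (rule vertex_module_action[OF module_F])

lemmas F_simps = action_0[OF action_F] action_minus[OF action_F] action_add[OF action_F]
  action_scale[OF action_F] action_diff[OF action_F]

text \<open>The Boolean selects \<open>\<psi>\<close> or \<open>\<psi>s\<close>. The annihilator
  with the same label is the conjugate mode of the other field, so that its anticommutator with the
  creator is 1.\<close>

definition cre :: "nat \<times> bool \<Rightarrow> 'f \<Rightarrow> 'f" where
  "cre x = mode F (if snd x then \<psi> else \<psi>s) (- int (fst x) - 1)"

definition ann :: "nat \<times> bool \<Rightarrow> 'f \<Rightarrow> 'f" where
  "ann x = mode F (if snd x then \<psi>s else \<psi>) (int (fst x))"

lemma clinear_cre: "clinear (cre x)" and clinear_ann: "clinear (ann x)"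
  by (simp_all add: cre_def ann_def action_clinear[OF action_F])

lemma cre_0 [simp]: "cre x 0 = 0" and ann_0 [simp]: "ann x 0 = 0"
  by (simp_all add: clinear_0[OF clinear_cre] clinear_0[OF clinear_ann])

lemma cre_cre: "cre x (cre y f) = - cre y (cre x f)"
  unfolding cre_def
  using psi_psi[of "- int (fst x) - 1" "- int (fst y) - 1" f] psis_psis[of "- int (fst x) - 1" "- int (fst y) - 1" f]
    psi_psis[of "- int (fst x) - 1" "- int (fst y) - 1" f] psi_psis[of "- int (fst y) - 1" "- int (fst x) - 1" f]
  by (cases "snd x"; cases "snd y"; simp)

lemma ann_ann: "ann x (ann y f) = - ann y (ann x f)"
  unfolding ann_def
  using psi_psi[of "int (fst x)" "int (fst y)" f] psis_psis[of "int (fst x)" "int (fst y)" f]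
    psi_psis[of "int (fst x)" "int (fst y)" f] psi_psis[of "int (fst y)" "int (fst x)" f]
  by (cases "snd x"; cases "snd y"; simp)

lemma ann_cre: "ann x (cre y f) = (if x = y then f else 0) - cre y (ann x f)"
  unfolding ann_def cre_def prod_eq_iff
  using psi_psi[of "int (fst x)" "- int (fst y) - 1" f] psis_psis[of "int (fst x)" "- int (fst y) - 1" f]
    psi_psis[of "int (fst x)" "- int (fst y) - 1" f] psi_psis[of "- int (fst y) - 1" "int (fst x)" f]
  by (cases "snd x"; cases "snd y"; auto)

lemma cre_cre_same: "cre x (cre x f) = 0"
  by (rule self_neg_eq_0[OF cre_cre])

text \<open>Arbitrary words, possibly with repeated letters, are closed under creation without any
  reordering or signs.\<close>

definition word :: "(nat \<times> bool) list \<Rightarrow> 'f" where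
  "word w = foldr cre w (vacuum F)"

lemma word_simps [simp]: "word [] = vacuum F" "word (x # w) = cre x (word w)"
  by (simp_all add: word_def)

lemma cre_word: "x \<in> set w \<Longrightarrow> cre x (word w) = 0"
proof (induction w)
  case (Cons y w)
  then show ?case
    using cre_cre[of x y "word w"] by (auto simp: cre_cre_same)
qed simp

lemma ann_word: "x \<notin> set w \<Longrightarrow> ann x (word w) = 0"
  by (induction w) (auto simp: ann_cre, auto simp: ann_def mode_vacuum)

text \<open>On words, this composite is the projection onto those without the letter
  \<open>x\<close>.\<close>

lemma ann_cre_word: "ann x (cre x (word w)) = (if x \<in> set w then 0 else word w)"
  by (cases "x \<in> set w") (simp_all add: cre_word, simp add: ann_cre ann_word)

lemma span_word: "cvs.span (range word) = UNIV"
proof -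
  have "clifford_monomial F \<psi> \<psi>s (A, B) =
      word (map (\<lambda>i. (i, True)) (sorted_list_of_set A) @ map (\<lambda>j. (j, False)) (sorted_list_of_set B))" for A B
    by (simp add: clifford_monomial_def word_def foldr_map comp_def cre_def)
  then have "clifford_monomial F \<psi> \<psi>s ` {(A, B). finite A \<and> finite B} \<subseteq> range word"
    by auto
  then have "cvs.span (clifford_monomial F \<psi> \<psi>s ` {(A, B). finite A \<and> finite B}) \<subseteq> cvs.span (range word)"
    by (rule cvs.span_mono)
  then show ?thesis
    using clifford by (simp add: clifford_vertex_superalgebra_def top.extremum_unique)
qed

abbreviation \<gamma> where "\<gamma> \<equiv> clifford_gamma F \<psi> \<psi>s"

lemma gamma_even: "\<gamma> \<in> part F 0"
proof -
  have "mode F \<psi> (- 1) \<psi>s \<in> part F (1 + 1)"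
    using F psi_odd unfolding vertex_superalgebra_def by blast
  then show ?thesis
    by (simp add: clifford_gamma_def mode_vacuum)
qed

lemma gamma_modes: "mode F \<gamma> n f = Sum_any (\<lambda>j::nat. mode F \<psi> (- 1 - int j) (mode F \<psi>s (n + int j) f)) +
     Sum_any (\<lambda>j::nat. - mode F \<psi>s (n - 1 - int j) (mode F \<psi> (int j) f))"
  using normal_ordered_modes[OF F module_F psi_odd, of n f]
  by (simp add: clifford_gamma_def mode_vacuum koszul_def)

lemma psi_vacuum_eqs:
  "mode F \<psi>s n \<psi> = (if n = 0 then vacuum F else 0) - mode F \<psi> (- 1) (mode F \<psi>s n (vacuum F))"
  "mode F \<psi> n \<psi> = - mode F \<psi> (- 1) (mode F \<psi> n (vacuum F))"
  "mode F \<psi> n \<psi>s = (if n = 0 then vacuum F else 0) - mode F \<psi>s (- 1) (mode F \<psi> n (vacuum F))"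
  "mode F \<psi>s n \<psi>s = - mode F \<psi>s (- 1) (mode F \<psi>s n (vacuum F))"
  using psi_psis[of "- 1" n "vacuum F"] psi_psi[of n "- 1" "vacuum F"] psi_psis[of n "- 1" "vacuum F"]
    psis_psis[of n "- 1" "vacuum F"]
  by (simp_all add: mode_vacuum)

lemma psi_regular: "n \<ge> 0 \<Longrightarrow> mode F \<psi> n \<psi> = 0" "n \<ge> 0 \<Longrightarrow> mode F \<psi>s n \<psi>s = 0"
  "n \<ge> 0 \<Longrightarrow> mode F \<psi>s n \<psi> = (if n = 0 then vacuum F else 0)"
  "n \<ge> 0 \<Longrightarrow> mode F \<psi> n \<psi>s = (if n = 0 then vacuum F else 0)"
  by (simp_all add: psi_vacuum_eqs mode_vacuum F_simps)

lemma gamma_0: "mode F \<gamma> 0 \<psi> = \<psi>" "mode F \<gamma> 0 \<psi>s = - \<psi>s"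
proof -
  have "Sum_any (\<lambda>j::nat. mode F \<psi> (- 1 - int j) (mode F \<psi>s (0 + int j) \<psi>)) = \<psi>"
    by (subst Sum_any_single[of 0]) (auto simp: psi_regular F_simps mode_vacuum)
  then show "mode F \<gamma> 0 \<psi> = \<psi>"
    by (simp add: gamma_modes psi_regular F_simps)
  have "Sum_any (\<lambda>j::nat. - mode F \<psi>s (0 - 1 - int j) (mode F \<psi> (int j) \<psi>s)) = - \<psi>s"
    by (subst Sum_any_single[of 0]) (auto simp: psi_regular F_simps mode_vacuum)
  then show "mode F \<gamma> 0 \<psi>s = - \<psi>s"
    by (simp add: gamma_modes psi_regular F_simps)
qed

text \<open>\<open>\<psi>\<close> and \<open>\<psi>s\<close> have charge 1 and -1 under the
  Heisenberg current \<gamma>, and like vertex operators of that charge they have as derivative plus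
  or minus the normally ordered product with \<gamma>.\<close>

lemma gamma_minus_1: "mode F \<gamma> (- 1) \<psi> = mode F \<psi> (- 2) (vacuum F)"
  "mode F \<gamma> (- 1) \<psi>s = - mode F \<psi>s (- 2) (vacuum F)"
proof -
  have 1: "mode F \<psi> (- 1) (mode F \<psi> (- 1) f) = 0" and 2: "mode F \<psi>s (- 1) (mode F \<psi>s (- 1) f) = 0" for f
    using psi_psi[of "- 1" "- 1" f] psis_psis[of "- 1" "- 1" f] by (auto dest: self_neg_eq_0)
  have 3: "Sum_any (\<lambda>j::nat. mode F \<psi> (- 1 - int j) (mode F \<psi>s (- 1 + int j) \<psi>)) = mode F \<psi> (- 2) (vacuum F)"
  \<comment> \<open>For \<open>j = 0\<close> a square of \<open>\<psi>(-1/2)\<close> appears; for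
    \<open>j > 1\<close> the mode of \<open>\<psi>s\<close> on \<open>\<psi>\<close> is 0.\<close>
  proof (subst Sum_any_single[of 1])
    show "mode F \<psi> (- 1 - int j) (mode F \<psi>s (- 1 + int j) \<psi>) = 0" if "j \<noteq> 1" for j
      using that by (cases "j = 0") (auto simp: psi_regular F_simps psi_vacuum_eqs(1)[of "- 1"] 1)
  qed (simp add: psi_regular)
  have 4: "- mode F \<psi>s (- 1 - 1 - int j) (mode F \<psi> (int j) \<psi>) = 0" for j
    by (simp add: psi_regular F_simps)
  show "mode F \<gamma> (- 1) \<psi> = mode F \<psi> (- 2) (vacuum F)"
    unfolding gamma_modes[of "- 1" \<psi>] 3 4 by simp
  have 5: "mode F \<psi> (- 1 - int j) (mode F \<psi>s (- 1 + int j) \<psi>s) = 0" for j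
    using 2[of "vacuum F"] by (cases "j = 0") (auto simp: psi_regular F_simps mode_vacuum)
  have 6: "Sum_any (\<lambda>j::nat. - mode F \<psi>s (- 1 - 1 - int j) (mode F \<psi> (int j) \<psi>s)) = - mode F \<psi>s (- 2) (vacuum F)"
    by (subst Sum_any_single[of 0]) (auto simp: psi_regular F_simps mode_vacuum)
  show "mode F \<gamma> (- 1) \<psi>s = - mode F \<psi>s (- 2) (vacuum F)"
    unfolding gamma_modes[of "- 1" \<psi>s] 5 6 by simp
qed

lemma gamma_psi: "mode F \<gamma> 0 (mode F \<psi> n f) = mode F \<psi> n f + mode F \<psi> n (mode F \<gamma> 0 f)"
  and gamma_psis: "mode F \<gamma> 0 (mode F \<psi>s n f) = - mode F \<psi>s n f + mode F \<psi>s n (mode F \<gamma> 0 f)"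
  using zero_mode_commutator[OF F module_F gamma_even] by (simp_all add: gamma_0 F_simps)

text \<open>The eigenvalue is the charge: letters of type \<open>\<psi>\<close> count 1, letters of
  type \<open>\<psi>s\<close> count -1.\<close>

lemma gamma_word: "\<exists>c. mode F \<gamma> 0 (word w) = c *\<^sub>C word w"
proof (induction w)
  case Nil
  show ?case by (rule exI[of _ 0]) (simp add: mode_vacuum)
next
  case (Cons x w)
  then obtain c where "mode F \<gamma> 0 (word w) = c *\<^sub>C word w" by blast
  then have "mode F \<gamma> 0 (word (x # w)) = ((if snd x then 1 else - 1) + c) *\<^sub>C word (x # w)"
    by (simp add: cre_def gamma_psi gamma_psis F_simps cvs.scale_left_distrib)
  then show ?case ..
qed

end

section \<open>The Weyl vertex algebra\<close>

locale weyl =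
  fixes M :: "'m::complex_space vertex_structure" and a astar :: 'm
  assumes weyl: "weyl_vertex_algebra M a astar"
begin

lemma M: "vertex_algebra M" and M_super: "vertex_superalgebra M"
  using weyl by (auto simp: weyl_vertex_algebra_def vertex_algebra_def)

lemma M_even: "x \<in> part M 0"
  using M_super M unfolding vertex_algebra_def vertex_superalgebra_def
  by (metis add_0_right singletonD)

lemma module_M: "vertex_module M (mode M)"
  and mode_M_vacuum: "mode M v (- 1) (vacuum M) = v" "n \<ge> 0 \<Longrightarrow> mode M v n (vacuum M) = 0"
  using M_super by (auto simp: vertex_superalgebra_def)

lemma action_M: "field_action (mode M)"
  by (rule vertex_module_action[OF module_M])

lemmas M_simps = action_0[OF action_M] action_minus[OF action_M] action_add[OF action_M]
  action_scale[OF action_M] action_diff[OF action_M]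

lemma a_astar: "mode M a m (mode M astar n x) = mode M astar n (mode M a m x) + (if m + n + 1 = 0 then x else 0)"
  and a_a: "mode M a m (mode M a n x) = mode M a n (mode M a m x)"
  and astar_astar: "mode M astar m (mode M astar n x) = mode M astar n (mode M astar m x)"
proof -
  have 1: "weyl_a M a k (weyl_astar M astar l x) - weyl_astar M astar l (weyl_a M a k x) = (if k + l = 0 then x else 0)"
    and 2: "weyl_a M a k (weyl_a M a l x) = weyl_a M a l (weyl_a M a k x)"
    and 3: "weyl_astar M astar k (weyl_astar M astar l x) = weyl_astar M astar l (weyl_astar M astar k x)" for k l
    by (rule weyl[unfolded weyl_vertex_algebra_def, THEN conjunct2, THEN conjunct1, rule_format]
        weyl[unfolded weyl_vertex_algebra_def, THEN conjunct2, THEN conjunct2, THEN conjunct1, rule_format]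
        weyl[unfolded weyl_vertex_algebra_def, THEN conjunct2, THEN conjunct2, THEN conjunct2, THEN conjunct1, rule_format])+
  show "mode M a m (mode M astar n x) = mode M astar n (mode M a m x) + (if m + n + 1 = 0 then x else 0)"
    using 1[of m "n + 1"] by (simp add: weyl_a_def weyl_astar_def diff_eq_eq add_ac)
  show "mode M a m (mode M a n x) = mode M a n (mode M a m x)"
    using 2[of m n] unfolding weyl_a_def .
  show "mode M astar m (mode M astar n x) = mode M astar n (mode M astar m x)"
    using 3[of "m + 1" "n + 1"] by (simp add: weyl_astar_def)
qed

lemma a_regular: "n \<ge> 0 \<Longrightarrow> mode M a n a = 0" "n \<ge> 0 \<Longrightarrow> mode M astar n astar = 0"
  "n \<ge> 0 \<Longrightarrow> mode M astar n a = (if n = 0 then - vacuum M else 0)"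
  "n \<ge> 0 \<Longrightarrow> mode M a n astar = (if n = 0 then vacuum M else 0)"
  using a_a[of n "- 1" "vacuum M"] astar_astar[of n "- 1" "vacuum M"] a_astar[of "- 1" n "vacuum M"]
    a_astar[of n "- 1" "vacuum M"]
  by (auto simp: mode_M_vacuum M_simps eq_neg_iff_add_eq_0 split: if_splits)

abbreviation \<beta> where "\<beta> \<equiv> weyl_beta M a astar"

lemma beta_eq: "\<beta> = mode M a (- 1) astar"
  by (simp add: weyl_beta_def weyl_a_def weyl_astar_def mode_M_vacuum)

lemma beta_modes: "mode M \<beta> n f = Sum_any (\<lambda>j::nat. mode M a (- 1 - int j) (mode M astar (n + int j) f)) +
     Sum_any (\<lambda>j::nat. mode M astar (n - 1 - int j) (mode M a (int j) f))"
  using normal_ordered_modes[OF M_super module_M M_even M_even, of a astar n f]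
  by (simp add: beta_eq koszul_def)

text \<open>These charges are opposite to those of \<open>\<psi>\<close> and \<open>\<psi>s\<close>
  under \<gamma>, so both odd generators have charge 0 under E(0).\<close>

lemma beta_0: "mode M \<beta> 0 a = - a" "mode M \<beta> 0 astar = astar"
proof -
  have "Sum_any (\<lambda>j::nat. mode M a (- 1 - int j) (mode M astar (0 + int j) a)) = - a"
    by (subst Sum_any_single[of 0]) (auto simp: a_regular M_simps mode_M_vacuum)
  then show "mode M \<beta> 0 a = - a"
    by (simp add: beta_modes a_regular M_simps)
  have "Sum_any (\<lambda>j::nat. mode M astar (0 - 1 - int j) (mode M a (int j) astar)) = astar"
    by (subst Sum_any_single[of 0]) (auto simp: a_regular M_simps mode_M_vacuum)
  then show "mode M \<beta> 0 astar = astar"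
    by (simp add: beta_modes a_regular M_simps)
qed

end

locale weyl_module = weyl M a astar
  for M :: "'m::complex_space vertex_structure" and a astar :: 'm +
  fixes Y :: "'m \<Rightarrow> int \<Rightarrow> 'n::complex_space \<Rightarrow> 'n"
  assumes module_Y: "vertex_module M Y"
begin

lemma action_Y: "field_action Y"
  by (rule vertex_module_action[OF module_Y])

lemmas Y_simps = action_0[OF action_Y] action_minus[OF action_Y] action_add[OF action_Y]
  action_scale[OF action_Y] action_diff[OF action_Y]

lemma beta_a: "Y \<beta> 0 (Y a n w) = - Y a n w + Y a n (Y \<beta> 0 w)"
  and beta_astar: "Y \<beta> 0 (Y astar n w) = Y astar n w + Y astar n (Y \<beta> 0 w)"
  using zero_mode_commutator[OF M_super module_Y M_even, of \<beta>] by (simp_all add: beta_0 Y_simps)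

text \<open>The Weyl relations are postulated on \<open>M\<close>; on a module this one is the
  Borcherds identity at \<open>l = 0\<close>, where only the zero mode of \<open>a\<close> on
  \<open>astar\<close>, the vacuum, contributes.\<close>

lemma Y_a_astar: "Y a m (Y astar n w) = Y astar n (Y a m w) + (if m + n + 1 = 0 then w else 0)"
proof -
  have z: "(0 gchoose j) = 0" if "j \<noteq> 0" for j :: nat
    using that by (cases j) auto
  have "Sum_any (\<lambda>j::nat. (of_int m gchoose j) *\<^sub>C Y (mode M a (0 + int j) astar) (m + n - int j) w) = (if m + n + 1 = 0 then w else 0)"
    by (subst Sum_any_single[of 0]) (use module_Y in \<open>auto simp: a_regular Y_simps vertex_module_def\<close>)
  moreover have "Sum_any (\<lambda>j::nat. ((- 1) ^ j * (of_int 0 gchoose j)) *\<^sub>C Y a (m + 0 - int j) (Y astar (n + int j) w)) = Y a m (Y astar n w)"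
    by (subst Sum_any_single[of 0]) (auto simp: z)
  moreover have "Sum_any (\<lambda>j::nat. (koszul 0 0 * (- 1) powi 0 * (- 1) ^ j * (of_int 0 gchoose j)) *\<^sub>C
                      Y astar (0 + n - int j) (Y a (m + int j) w)) = Y astar n (Y a m w)"
    by (subst Sum_any_single[of 0]) (auto simp: z koszul_def)
  ultimately show ?thesis
    using borcherds[OF M_super module_Y M_even M_even, of m a 0 astar n w] by (simp add: algebra_simps)
qed

text \<open>By the iterate formula, the vectors all of whose modes preserve \<open>T\<close> are
  closed under modes. They contain the vacuum and both generators, hence everything.\<close>

lemma submodule_generators:
  assumes T: "cvs.subspace T" and "\<And>n w. w \<in> T \<Longrightarrow> Y a n w \<in> T" "\<And>n w. w \<in> T \<Longrightarrow> Y astar n w \<in> T"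
  shows "submodule Y T"
proof -
  define R where "R = {v. \<forall>n. \<forall>w\<in>T. Y v n w \<in> T}"
  have sub: "cvs.subspace R"
    using T by (auto simp: R_def cvs.subspace_def Y_simps)
  have closed: "mode M u l v \<in> R" if "u \<in> R" "v \<in> R" for u v l
    unfolding R_def
  proof (intro CollectI allI ballI)
    fix n w assume "w \<in> T"
    with that show "Y (mode M u l v) n w \<in> T"
      unfolding borcherds_iterate[OF M_super module_Y M_even M_even] R_def
      by (intro cvs.subspace_diff[OF T] Sum_any_in_subspace[OF T] cvs.subspace_scale[OF T]) auto
  qed
  have "a \<in> R" "astar \<in> R" "vacuum M \<in> R"
    using assms module_Y by (auto simp: R_def vertex_module_def cvs.subspace_def)
  then have "weyl_submodule M a astar R" "vacuum M \<in> R"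
    using sub closed by (auto simp: weyl_submodule_def weyl_a_def weyl_astar_def)
  then have "R = UNIV"
    using weyl unfolding weyl_vertex_algebra_def by blast
  then show ?thesis
    using T by (auto simp: submodule_def R_def)
qed

text \<open>Up to sign the coefficient is (m + 1) ... (m + i), of degree \<open>i\<close> in
  \<open>m\<close>. The index \<open>m + i\<close> makes the same mode \<open>Y x m\<close> appear
  for every \<open>i\<close>, as interpolation requires.\<close>

lemma derivative_iterate:
  "Y (((\<lambda>v. mode M v (- 2) (vacuum M)) ^^ i) x) (m + int i) w = (\<Prod>j<i. - of_int (m + int j + 1)) *\<^sub>C Y x m w"
proof (induction i arbitrary: m)
  case (Suc i)
  have "Y (((\<lambda>v. mode M v (- 2) (vacuum M)) ^^ Suc i) x) (m + int (Suc i)) w =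
      (- of_int (m + int i + 1)) *\<^sub>C Y (((\<lambda>v. mode M v (- 2) (vacuum M)) ^^ i) x) (m + int i) w"
    using derivative_modes[OF M_super module_Y M_even, of "((\<lambda>v. mode M v (- 2) (vacuum M)) ^^ i) x" "m + int (Suc i)" w]
    by (simp add: add.assoc)
  then show ?case
    unfolding Suc by (simp add: mult.commute)
qed simp

end

section \<open>Eigenspaces and ladder operators\<close>

definition eigenspace :: "('w::complex_space \<Rightarrow> 'w) \<Rightarrow> complex \<Rightarrow> 'w set" where
  "eigenspace E c = {w. E w = c *\<^sub>C w}"

lemma subspace_eigenspace: "clinear E \<Longrightarrow> cvs.subspace (eigenspace E c)"
  by (auto simp: eigenspace_def cvs.subspace_def clinear_0 clinear_add clinear_scale
      cvs.scale_right_distrib mult.commute)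

text \<open>A finite product of factors E - d with d different from c kills the given element of the
  span, but multiplies an eigenvector of value c by a nonzero number.\<close>

lemma eigenspace_independent:
  assumes E: "clinear E" and w: "w \<in> eigenspace E c" "w \<in> cvs.span (\<Union>d\<in>- {c}. eigenspace E d)"
  shows "w = 0"
proof -
  define K where "K L = foldr (\<lambda>d v. E v - d *\<^sub>C v) L" for L
  have K_Nil: "K [] = (\<lambda>v. v)" and K_Cons: "K (d # L) v = E (K L v) - d *\<^sub>C K L v" for d L v
    by (auto simp: K_def)
  have linE: "clinear (\<lambda>v. E v - d *\<^sub>C v)" for d
    using E by (simp add: clinear_iff algebra_simps cvs.scale_right_distrib cvs.scale_right_diff_distrib)
  have linK: "clinear (K L)" for L
  proof (induction L)
    case (Cons d L)
    show ?case
      using clinear_compose[OF linE Cons, of d] by (simp add: K_Cons[abs_def])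
  qed (simp add: K_Nil clinear_id)
  have com: "K L (E v) = E (K L v)" for L v
    by (induction L) (simp_all add: K_Nil K_Cons clinear_diff[OF E] clinear_scale[OF E])
  \<comment> \<open>The factors commute, so a factor appended on the right, which acts first, may
    also be read as acting last.\<close>
  have last: "K (L @ [d]) v = E (K L v) - d *\<^sub>C K L v" for L d v
    using com[of L v] by (simp add: K_def clinear_diff[OF linK, unfolded K_def] clinear_scale[OF linK, unfolded K_def])
  have "\<exists>L. c \<notin> set L \<and> K L w = 0"
    using w(2)
  proof (induction rule: cvs.span_induct_alt)
    case base
    show ?case by (rule exI[of _ "[]"]) (simp add: K_Nil)
  next
    case (step k x y)
    obtain d where d: "d \<noteq> c" "E x = d *\<^sub>C x" using step(1) by (auto simp: eigenspace_def)
    obtain L where L: "c \<notin> set L" "K L y = 0" using step(2) by blast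
    have "K L (E x - d *\<^sub>C x) = 0"
      using d(2) clinear_0[OF linK] by simp
    then have "K (L @ [d]) x = 0"
      by (simp add: last com clinear_diff[OF linK] clinear_scale[OF linK])
    moreover have "K (L @ [d]) y = 0"
      by (simp add: last L clinear_0[OF E])
    ultimately have "K (L @ [d]) (k *\<^sub>C x + y) = 0"
      by (simp add: clinear_add[OF linK] clinear_scale[OF linK])
    then show ?case
      using L(1) d(1) by (intro exI[of _ "L @ [d]"]) auto
  qed
  then obtain L where L: "c \<notin> set L" "K L w = 0" by blast
  have "\<exists>k\<noteq>0. K L w = k *\<^sub>C w"
    using L(1)
  proof (induction L)
    case Nil
    show ?case by (rule exI[of _ 1]) (simp add: K_Nil)
  next
    case (Cons d L)
    then obtain k where k: "k \<noteq> 0" "K L w = k *\<^sub>C w" by auto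
    have "K (d # L) w = ((c - d) * k) *\<^sub>C w"
      using w(1) k(2) by (simp add: K_Cons clinear_scale[OF E] eigenspace_def algebra_simps cvs.scale_left_diff_distrib)
    moreover have "(c - d) * k \<noteq> 0" using k(1) Cons.prems by auto
    ultimately show ?case by blast
  qed
  with L(2) show ?thesis
    by (metis cvs.scale_eq_0_iff)
qed

section \<open>Words in ladder operators over a subspace of an eigenspace\<close>

primrec level :: "('w::complex_space \<Rightarrow> 'w) set \<Rightarrow> 'w set \<Rightarrow> nat \<Rightarrow> 'w set" where
  "level X S 0 = S"
| "level X S (Suc k) = cvs.span {x w |x w. x \<in> X \<and> w \<in> level X S k}"

lemma subspace_level: "cvs.subspace S \<Longrightarrow> cvs.subspace (level X S k)"
  by (cases k) auto

lemma level_up: "x \<in> X \<Longrightarrow> w \<in> level X S k \<Longrightarrow> x w \<in> level X S (Suc k)"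
  by (auto intro: cvs.span_base)

text \<open>Moving \<open>y\<close> to the right through a word in \<open>X\<close>.\<close>

lemma level_down:
  assumes S: "cvs.subspace S" and y: "clinear y"
    and rel: "\<And>x. x \<in> X \<Longrightarrow> clinear x \<and> (\<exists>\<epsilon> c. \<forall>w. y (x w) = \<epsilon> *\<^sub>C x (y w) + c *\<^sub>C w)"
    and inv: "\<And>x w. x \<in> X \<Longrightarrow> w \<in> S \<Longrightarrow> y (x w) \<in> S"
    and w: "w \<in> level X S (Suc k)"
  shows "y w \<in> level X S k"
  using w
proof (induction k arbitrary: w)
  case 0
  have "w \<in> cvs.span {x w |x w. x \<in> X \<and> w \<in> S}" using 0 by simp
  then show ?case
    by (induction rule: cvs.span_induct_alt)
      (auto simp: clinear_0[OF y] clinear_add[OF y] clinear_scale[OF y] inv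
        intro!: cvs.subspace_0[OF S] cvs.subspace_add[OF S] cvs.subspace_scale[OF S])
next
  case (Suc k)
  note sub = subspace_level[OF S, of X "Suc k"]
  have "w \<in> cvs.span {x w |x w. x \<in> X \<and> w \<in> level X S (Suc k)}" using Suc.prems by simp
  then show ?case
  proof (induction rule: cvs.span_induct_alt)
    case base
    show ?case by (simp only: clinear_0[OF y] cvs.subspace_0[OF sub])
  next
    case (step d z z')
    obtain x v where z: "z = x v" "x \<in> X" "v \<in> level X S (Suc k)" using step(1) by blast
    obtain \<epsilon> c where e: "y (x v) = \<epsilon> *\<^sub>C x (y v) + c *\<^sub>C v" using rel[OF z(2)] by blast
    have "x (y v) \<in> level X S (Suc k)"
      using level_up[OF z(2) Suc.IH[OF z(3)]] .
    then have "y z \<in> level X S (Suc k)"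
      unfolding z(1) e using z(3) by (intro cvs.subspace_add[OF sub] cvs.subspace_scale[OF sub])
    then show ?case
      unfolding clinear_add[OF y] clinear_scale[OF y]
      using step(2) by (intro cvs.subspace_add[OF sub] cvs.subspace_scale[OF sub])
  qed
qed

lemma level_eigenspace:
  assumes E: "clinear E" and S: "S \<subseteq> eigenspace E c" and X: "\<And>x w. x \<in> X \<Longrightarrow> E (x w) = x (E w) + s *\<^sub>C x w" "\<And>x. x \<in> X \<Longrightarrow> clinear x"
  shows "level X S k \<subseteq> eigenspace E (c + of_nat k * s)"
proof (induction k)
  case 0
  show ?case using S by simp
next
  case (Suc k)
  have "{x w |x w. x \<in> X \<and> w \<in> level X S k} \<subseteq> eigenspace E (c + of_nat (Suc k) * s)"
  proof clarify
    fix x w assume x: "x \<in> X" and "w \<in> level X S k"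
    then have "E w = (c + of_nat k * s) *\<^sub>C w" using Suc by (auto simp: eigenspace_def)
    then have "E (x w) = (c + of_nat k * s) *\<^sub>C x w + s *\<^sub>C x w"
      using X[OF x] x by (simp add: clinear_scale X(2))
    then show "x w \<in> eigenspace E (c + of_nat (Suc k) * s)"
      by (simp add: eigenspace_def algebra_simps flip: cvs.scale_left_distrib)
  qed
  then show ?case
    using cvs.span_minimal[OF _ subspace_eigenspace[OF E]] by simp
qed

text \<open>An operator of \<open>X\<close> climbs the levels of \<open>X\<close>, descends those of
  \<open>Y\<close> by \<open>level_down\<close>, and takes the common bottom level \<open>S\<close>
  to the first level of \<open>X\<close>. The statement is symmetric, so it covers raising and
  lowering operators alike.\<close>

lemma span_level_invariant:
  assumes S: "cvs.subspace S" and X: "\<And>x. x \<in> X \<Longrightarrow> clinear x" and Y: "\<And>y. y \<in> Y \<Longrightarrow> clinear y"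
    and rel: "\<And>x y. x \<in> X \<Longrightarrow> y \<in> Y \<Longrightarrow> \<exists>\<epsilon> c. \<forall>w. x (y w) = \<epsilon> *\<^sub>C y (x w) + c *\<^sub>C w"
    and inv: "\<And>x y w. x \<in> X \<Longrightarrow> y \<in> Y \<Longrightarrow> w \<in> S \<Longrightarrow> x (y w) \<in> S"
    and x: "x \<in> X" and w: "w \<in> cvs.span (\<Union>k. level X S k \<union> level Y S k)"
  shows "x w \<in> cvs.span (\<Union>k. level X S k \<union> level Y S k)"
  using w
proof (induction rule: cvs.span_induct_alt)
  case base
  show ?case by (simp add: clinear_0[OF X[OF x]] cvs.span_zero)
next
  case (step c z z')
  have "x z \<in> (\<Union>k. level X S k \<union> level Y S k)"
  proof -
    obtain k where "z \<in> level X S k \<or> z \<in> level Y S k" using step(1) by blast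
    then show ?thesis
    proof
      assume "z \<in> level X S k"
      then have "x z \<in> level X S (Suc k)" by (rule level_up[OF x])
      then show ?thesis by blast
    next
      assume z: "z \<in> level Y S k"
      show ?thesis
      proof (cases k)
        case 0
        then have "x z \<in> level X S (Suc 0)" using z by (intro level_up[OF x]) simp
        then show ?thesis by blast
      next
        case (Suc j)
        have "x z \<in> level Y S j"
          by (rule level_down[OF S X[OF x] _ _ z[unfolded Suc]]) (use Y rel inv x in blast)+
        then show ?thesis by blast
      qed
    qed
  qed
  then show ?case
    unfolding clinear_add[OF X[OF x]] clinear_scale[OF X[OF x]]
    using step(2) by (intro cvs.span_add cvs.span_scale) (auto intro: cvs.span_base)
qed

text \<open>A word of positive length k shifts the eigenvalue to c + k or c - k, neither equal to c.
  Modulo the other eigenspaces, every vector of the span is therefore represented by one of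
  \<open>S\<close>.\<close>

lemma invariant_subspace_meets_eigenspace:
  assumes E: "clinear E" and S: "cvs.subspace S" "S \<subseteq> eigenspace E c"
    and X: "\<And>x. x \<in> X \<Longrightarrow> clinear x" "\<And>x w. x \<in> X \<Longrightarrow> E (x w) = x (E w) + 1 *\<^sub>C x w"
    and Y: "\<And>y. y \<in> Y \<Longrightarrow> clinear y" "\<And>y w. y \<in> Y \<Longrightarrow> E (y w) = y (E w) + (- 1) *\<^sub>C y w"
    and w: "w \<in> cvs.span (\<Union>k. level X S k \<union> level Y S k)" "w \<in> eigenspace E c"
  shows "w \<in> S"
proof -
  let ?R = "cvs.span (\<Union>d\<in>- {c}. eigenspace E d)"
  have "\<exists>s\<in>S. w - s \<in> ?R"
    using w(1)
  proof (induction rule: cvs.span_induct_alt)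
    case base
    show ?case using cvs.subspace_0[OF S(1)] by (intro bexI[of _ 0]) (auto simp: cvs.span_zero)
  next
    case (step k z z')
    have "\<exists>s\<in>S. z - s \<in> ?R"
    proof -
      obtain j where j: "z \<in> level X S j \<or> z \<in> level Y S j" using step(1) by blast
      show ?thesis
      proof (cases j)
        case 0
        then show ?thesis using j by (intro bexI[of _ z]) (auto simp: cvs.span_zero)
      next
        case (Suc i)
        have "z \<in> eigenspace E (c + of_nat j * 1) \<or> z \<in> eigenspace E (c + of_nat j * - 1)"
          using level_eigenspace[OF E S(2) X(2,1), of X j] level_eigenspace[OF E S(2) Y(2,1), of Y j] j by blast
        moreover have "c + of_nat j * 1 \<in> - {c}" "c + of_nat j * - 1 \<in> - {c}"
          using Suc by (auto simp del: of_nat_Suc)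
        ultimately have "z \<in> ?R" by (blast intro: cvs.span_base)
        then show ?thesis using cvs.subspace_0[OF S(1)] by (intro bexI[of _ 0]) auto
      qed
    qed
    then obtain s where s: "s \<in> S" "z - s \<in> ?R" by blast
    obtain s' where s': "s' \<in> S" "z' - s' \<in> ?R" using step(2) by blast
    have "(k *\<^sub>C z + z') - (k *\<^sub>C s + s') = k *\<^sub>C (z - s) + (z' - s')"
      by (simp add: cvs.scale_right_diff_distrib)
    also have "\<dots> \<in> ?R" using s s' by (intro cvs.span_add cvs.span_scale)
    finally show ?case
      using s s' by (intro bexI[of _ "k *\<^sub>C s + s'"]) (auto intro: cvs.subspace_add[OF S(1)] cvs.subspace_scale[OF S(1)])
  qed
  then obtain s where s: "s \<in> S" "w - s \<in> ?R" by blast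
  moreover have "w - s \<in> eigenspace E c"
    using s(1) S(2) w(2) by (auto intro: cvs.subspace_diff[OF subspace_eigenspace[OF E]])
  ultimately have "w - s = 0"
    by (intro eigenspace_independent[OF E])
  then show ?thesis using s by simp
qed

text \<open>The coefficients form a basis of the polynomials in \<open>m\<close>, one in each
  degree, so the Lagrange polynomial that isolates one point of the finite support is
  available.\<close>

lemma interpolation_in_subspace:
  fixes f :: "int \<Rightarrow> 'w::complex_space"
  assumes S: "cvs.subspace S" and fin: "finite {m. f m \<noteq> 0}"
    and mem: "\<And>i. Sum_any (\<lambda>m. (\<Prod>j<i. - of_int (m + int j + 1)) *\<^sub>C f m) \<in> S"
  shows "f m \<in> S"
proof -
  define A where "A = {m. f m \<noteq> 0}"
  define c where "c i m = (\<Prod>j<i. - of_int (m + int j + 1) :: complex)" for i :: nat and m :: int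
  have base: "(\<Sum>m\<in>A. c i m *\<^sub>C f m) \<in> S" for i
    using mem[of i] Sum_any_superset[of A "\<lambda>m. c i m *\<^sub>C f m"] fin by (simp add: A_def c_def)
  have "(\<Sum>m\<in>A. ((\<Prod>z\<in>B. of_int m - of_int z) * c i m) *\<^sub>C f m) \<in> S" if "finite B" for B :: "int set" and i
    using that
  proof (induction B arbitrary: i rule: finite_induct)
    case empty
    show ?case using base by simp
  next
    case (insert z B)
    let ?P = "\<lambda>m. \<Prod>z\<in>B. of_int m - of_int z :: complex"
    \<comment> \<open>Multiplication by a linear polynomial stays within two consecutive
      coefficients, so linear factors can be inserted one at a time without a change of
      basis.\<close>
    have c: "(of_int m - of_int z) * c i m = - c (Suc i) m - (of_nat i + 1 + of_int z) * c i m" for m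
      by (simp add: c_def algebra_simps)
    have "(\<Sum>m\<in>A. ((\<Prod>z\<in>insert z B. of_int m - of_int z) * c i m) *\<^sub>C f m) =
        (\<Sum>m\<in>A. - ((?P m * c (Suc i) m) *\<^sub>C f m) - (of_nat i + 1 + of_int z) *\<^sub>C ((?P m * c i m) *\<^sub>C f m))"
    proof (rule sum.cong[OF refl])
      fix m
      have "(\<Prod>z\<in>insert z B. of_int m - of_int z) * c i m = ?P m * ((of_int m - of_int z) * c i m)"
        using insert by (simp add: mult_ac)
      also have "\<dots> = - (?P m * c (Suc i) m) - (of_nat i + 1 + of_int z) * (?P m * c i m)"
        unfolding c by (simp add: algebra_simps)
      finally show "((\<Prod>z\<in>insert z B. of_int m - of_int z) * c i m) *\<^sub>C f m =
          - ((?P m * c (Suc i) m) *\<^sub>C f m) - (of_nat i + 1 + of_int z) *\<^sub>C ((?P m * c i m) *\<^sub>C f m)"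
        by (simp add: cvs.scale_left_diff_distrib)
    qed
    also have "\<dots> = - (\<Sum>m\<in>A. (?P m * c (Suc i) m) *\<^sub>C f m) - (of_nat i + 1 + of_int z) *\<^sub>C (\<Sum>m\<in>A. (?P m * c i m) *\<^sub>C f m)"
      by (simp only: sum_subtractf sum_negf cvs.scale_sum_right)
    also have "\<dots> \<in> S"
      by (intro cvs.subspace_diff[OF S] cvs.subspace_neg[OF S] cvs.subspace_scale[OF S] insert.IH)
    finally show ?case .
  qed
  \<comment> \<open>The Lagrange numerator, which vanishes on the rest of the support.\<close>
  from this[of "A - {m}" 0] have "(\<Sum>k\<in>A. (\<Prod>z\<in>A - {m}. of_int k - of_int z) *\<^sub>C f k) \<in> S"
    using fin by (simp add: A_def c_def)
  moreover have "(\<Sum>k\<in>A. (\<Prod>z\<in>A - {m}. of_int k - of_int z) *\<^sub>C f k) = (\<Prod>z\<in>A - {m}. of_int m - of_int z) *\<^sub>C f m"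
  proof (cases "m \<in> A")
    case True
    have "(\<Sum>k\<in>A. (\<Prod>z\<in>A - {m}. of_int k - of_int z) *\<^sub>C f k) = (\<Sum>k\<in>{m}. (\<Prod>z\<in>A - {m}. of_int k - of_int z) *\<^sub>C f k)"
      by (rule sum.mono_neutral_right) (use fin True in \<open>auto simp: A_def\<close>)
    then show ?thesis by simp
  next
    case False
    then have "(\<Prod>z\<in>A - {m}. of_int k - of_int z) = (0 :: complex)" if "k \<in> A" for k
      using that fin by (intro prod_zero) (auto simp: A_def)
    then show ?thesis using False by (simp add: A_def)
  qed
  ultimately have 1: "(\<Prod>z\<in>A - {m}. of_int m - of_int z) *\<^sub>C f m \<in> S" by simp
  have nz: "(\<Prod>z\<in>A - {m}. of_int m - of_int z) \<noteq> (0 :: complex)"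
    using fin by (simp add: A_def)
  show ?thesis
    using cvs.subspace_scale[OF S 1, of "inverse (\<Prod>z\<in>A - {m}. of_int m - of_int z)"] nz by simp
qed

section \<open>Complete reducibility\<close>

locale realization = clifford F \<psi> \<psi>s + weyl_module M a astar Y
  for F :: "'f::complex_space vertex_structure" and \<psi> \<psi>s
    and M :: "'m::complex_space vertex_structure" and a astar
    and Y :: "'m \<Rightarrow> int \<Rightarrow> 'n::complex_space \<Rightarrow> 'n" +
  fixes V :: "'v::complex_space vertex_structure" and g :: "gl11 \<Rightarrow> 'v"
    and h :: "'v \<Rightarrow> ('m, 'f) tensor"
  assumes affine: "simple_affine_gl11 1 V g"
    and real: "gl11_realization V g M a astar F \<psi> \<psi>s h"
    and irr: "irreducible_module M Y"
    and weight: "weight_module M a astar Y"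
begin

definition act :: "'v \<Rightarrow> int \<Rightarrow> ('n, 'f) tensor \<Rightarrow> ('n, 'f) tensor" where
  "act v = tensor_action Y (mode F) (h v)"

lemma hom: "vertex_hom V (tensor_vertex M F) h"
  using real by (simp add: gl11_realization_def)

lemma clinear_h: "clinear h" and h_vacuum: "h (vacuum V) = vacuum M \<otimes> vacuum F"
  and h_mode: "h (mode V u n v) = tensor_action (mode M) (mode F) (h u) n (h v)"
  using hom by (simp_all add: vertex_hom_def tensor_vertex_def)

lemma h_generators: "h (g Psi_plus) = a \<otimes> \<psi>" "h (g Psi_minus) = astar \<otimes> \<psi>s"
  "h (g gl_E) = vacuum M \<otimes> \<gamma> + \<beta> \<otimes> vacuum F"
  "h (g gl_N) = (1 / 2) *\<^sub>C (vacuum M \<otimes> \<gamma> - \<beta> \<otimes> vacuum F)"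
  using real by (simp_all add: gl11_realization_def)

lemma V: "vertex_superalgebra V"
  using affine by (simp_all add: simple_affine_gl11_def simple_vertex_superalgebra_def)

lemma module_V: "vertex_module V (mode V)"
  and mode_V_vacuum: "mode V v (- 1) (vacuum V) = v" "n \<ge> 0 \<Longrightarrow> mode V v n (vacuum V) = 0"
  using V by (auto simp: vertex_superalgebra_def)

lemma module_act: "vertex_module V act"
  using vertex_module_pullback[OF vertex_module_tensor[OF M module_Y F module_F] hom]
  by (simp add: act_def[abs_def])

lemma action_act: "field_action act"
  by (rule vertex_module_action[OF module_act])

definition opA where "opA n = tensor_map (Y a n) (\<lambda>f :: 'f. f)"
definition opAs where "opAs n = tensor_map (Y astar n) (\<lambda>f :: 'f. f)"
definition opP where "opP n = tensor_map (\<lambda>w :: 'n. w) (mode F \<psi> n)"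
definition opPs where "opPs n = tensor_map (\<lambda>w :: 'n. w) (mode F \<psi>s n)"

lemmas lin_ops = action_clinear[OF action_Y] action_clinear[OF action_F] clinear_id

lemma op_pure [simp]: "opA n (w \<otimes> f) = Y a n w \<otimes> f" "opAs n (w \<otimes> f) = Y astar n w \<otimes> f"
  "opP n (w \<otimes> f) = w \<otimes> mode F \<psi> n f" "opPs n (w \<otimes> f) = w \<otimes> mode F \<psi>s n f"
  by (simp_all add: opA_def opAs_def opP_def opPs_def tensor_map_pure lin_ops)

lemma clinear_op: "clinear (opA n)" "clinear (opAs n)" "clinear (opP n)" "clinear (opPs n)"
  by (simp_all add: opA_def opAs_def opP_def opPs_def clinear_tensor_map lin_ops)

lemmas op_add [simp] = clinear_op[THEN clinear_add]
lemmas op_0 [simp] = clinear_op[THEN clinear_0]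
lemmas op_minus [simp] = clinear_op[THEN clinear_minus]
lemmas op_scale [simp] = clinear_op[THEN clinear_scale]

lemma tensor_minus_right: "x \<otimes> (- y) = - (x \<otimes> y)" and tensor_minus_left: "(- x) \<otimes> y = - (x \<otimes> y)"
  for x :: "'x::complex_space" and y :: "'y::complex_space"
  by (rule clinear_minus[OF clinear_pure_right] clinear_minus[OF clinear_pure_left])+

lemma op_commute:
  "opA m (opP n t) = opP n (opA m t)" "opA m (opPs n t) = opPs n (opA m t)"
  "opAs m (opP n t) = opP n (opAs m t)" "opAs m (opPs n t) = opPs n (opAs m t)"
  by (induction t rule: tensor_induct) simp_all

lemma opA_opAs: "opA m (opAs n t) = opAs n (opA m t) + (if m + n + 1 = 0 then t else 0)"
  by (induction t rule: tensor_induct) (auto simp: Y_a_astar pure_tensor_add_left)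

lemma opP_opPs: "opP m (opPs n t) = - opPs n (opP m t) + (if m + n + 1 = 0 then t else 0)"
  by (induction t rule: tensor_induct)
    (auto simp: psi_psis[of m n] pure_tensor_add_right tensor_minus_right clinear_diff[OF clinear_pure_right])

lemma opAs_truncation: "\<exists>K. \<forall>n\<ge>K. opAs n t = 0"
  and opP_truncation: "\<exists>K. \<forall>n\<ge>K. opP n t = 0"
  and opPs_truncation: "\<exists>K. \<forall>n\<ge>K. opPs n t = 0"
proof -
  have add: "\<exists>K. \<forall>n\<ge>K. f n (s + t) = 0"
    if s: "\<exists>K. \<forall>n\<ge>K. f n s = 0" and t: "\<exists>K. \<forall>n\<ge>K. f n t = 0" and f: "\<And>n. clinear (f n)"
    for f :: "int \<Rightarrow> ('n, 'f) tensor \<Rightarrow> ('n, 'f) tensor" and s t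
  proof -
    obtain K L where "\<forall>n\<ge>K. f n s = 0" "\<forall>n\<ge>L. f n t = 0" using s t by blast
    then show ?thesis by (intro exI[of _ "max K L"]) (simp add: clinear_add[OF f])
  qed
  show "\<exists>K. \<forall>n\<ge>K. opAs n t = 0"
  proof (induction t rule: tensor_induct)
    case (pure w f)
    obtain K where "\<And>n. n \<ge> K \<Longrightarrow> Y astar n w = 0" using action_truncation[OF action_Y] by blast
    then show ?case by (intro exI[of _ K]) simp
  qed (rule add; simp add: clinear_op)
  show "\<exists>K. \<forall>n\<ge>K. opP n t = 0"
  proof (induction t rule: tensor_induct)
    case (pure w f)
    obtain K where "\<And>n. n \<ge> K \<Longrightarrow> mode F \<psi> n f = 0" using action_truncation[OF action_F] by blast
    then show ?case by (intro exI[of _ K]) simp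
  qed (rule add; simp add: clinear_op)
  show "\<exists>K. \<forall>n\<ge>K. opPs n t = 0"
  proof (induction t rule: tensor_induct)
    case (pure w f)
    obtain K where "\<And>n. n \<ge> K \<Longrightarrow> mode F \<psi>s n f = 0" using action_truncation[OF action_F] by blast
    then show ?case by (intro exI[of _ K]) simp
  qed (rule add; simp add: clinear_op)
qed

subsection \<open>The operator $E(0)$\<close>

abbreviation E where "E \<equiv> act (g gl_E) 0"

lemma clinear_E: "clinear E"
  by (rule action_clinear[OF action_act])

text \<open>A vacuum has only the mode -1, so each summand of E contributes the zero mode of one
  factor.\<close>

lemma E_pure: "E (w \<otimes> f) = w \<otimes> mode F \<gamma> 0 f + Y \<beta> 0 w \<otimes> f"
proof -
  have "tensor_action Y (mode F) (vacuum M \<otimes> \<gamma>) 0 (w \<otimes> f) = w \<otimes> mode F \<gamma> 0 f"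
    unfolding tensor_action_pure[OF action_Y action_F]
    by (subst Sum_any_single[of "- 1"]) (use module_Y in \<open>auto simp: vertex_module_def\<close>)
  moreover have "tensor_action Y (mode F) (\<beta> \<otimes> vacuum F) 0 (w \<otimes> f) = Y \<beta> 0 w \<otimes> f"
    unfolding tensor_action_pure[OF action_Y action_F]
    by (subst Sum_any_single[of 0]) (use module_F in \<open>auto simp: vertex_module_def\<close>)
  ultimately show ?thesis
    unfolding act_def h_generators clinear_add[OF clinear_tensor_action_left[OF action_Y action_F]] by simp
qed

lemma E_op: "E (opA n t) = opA n (E t) - opA n t" "E (opAs n t) = opAs n (E t) + opAs n t"
  "E (opP n t) = opP n (E t) + opP n t" "E (opPs n t) = opPs n (E t) - opPs n t"
  by (induction t rule: tensor_induct)
    (simp_all add: E_pure beta_a beta_astar gamma_psi gamma_psis pure_tensor_add_left pure_tensor_add_right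
      clinear_diff[OF clinear_pure_left] clinear_diff[OF clinear_pure_right] tensor_minus_left tensor_minus_right
      clinear_add[OF clinear_E])

text \<open>E has zero bracket with every basis element, so E(0) kills the generators; its kernel is
  a subalgebra because E(0) is a derivation.\<close>

lemma E_central: "mode V (g gl_E) 0 v = 0"
proof -
  have even: "g gl_E \<in> part V 0"
    using affine unfolding simple_affine_gl11_def by (metis gl11_parity.simps(1))
  have fV: "field_action (mode V)" by (rule vertex_module_action[OF module_V])
  define A where "A = {v. mode V (g gl_E) 0 v = 0}"
  have "cvs.subspace A"
    by (auto simp: A_def cvs.subspace_def action_0[OF fV] action_add[OF fV] action_scale[OF fV])
  moreover have "mode V u n v \<in> A" if "u \<in> A" "v \<in> A" for u v n
    using that zero_mode_commutator[OF V module_V even, of u n v] by (simp add: A_def action_0[OF fV])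
  moreover have "vacuum V \<in> A"
    by (simp add: A_def mode_V_vacuum)
  moreover have "g x \<in> A" for x
  proof -
    have "mode V (g gl_E) 0 (mode V (g x) (- 1) (vacuum V)) -
          koszul (gl11_parity gl_E) (gl11_parity x) *\<^sub>C mode V (g x) (- 1) (mode V (g gl_E) 0 (vacuum V)) =
        (\<Sum>z\<in>UNIV. gl11_bracket gl_E x z *\<^sub>C mode V (g z) (0 + - 1) (vacuum V)) +
          (if 0 + - 1 = (0 :: int) then (of_int 0 * gl11_form gl_E x * 1) *\<^sub>C vacuum V else 0)"
      using affine unfolding simple_affine_gl11_def by blast
    then show ?thesis
      by (simp add: A_def mode_V_vacuum action_0[OF fV])
  qed
  ultimately have "vertex_subalgebra V A" "range g \<subseteq> A"
    by (auto simp: vertex_subalgebra_def)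
  then have "A = UNIV"
    using affine unfolding simple_affine_gl11_def vertex_generated_def by blast
  then show ?thesis by (auto simp: A_def)
qed

lemma E_act: "E (act v n t) = act v n (E t)"
proof -
  have even: "g gl_E \<in> part V 0"
    using affine unfolding simple_affine_gl11_def by (metis gl11_parity.simps(1))
  show ?thesis
    using zero_mode_commutator[OF V module_act even, of v n t] by (simp add: E_central action_0[OF action_act])
qed

lemma submodule_eigenspace: "submodule act (eigenspace E c)"
  unfolding submodule_def using subspace_eigenspace[OF clinear_E, of c]
  by (auto simp: eigenspace_def E_act action_scale[OF action_act])

text \<open>Eigenvectors of \<beta>(0) span \<N>, and words, which are eigenvectors of \<gamma>(0),
  span F; on their tensors E(0) acts by the sum of the two eigenvalues.\<close>

lemma span_eigenspaces: "cvs.span (\<Union>c. eigenspace E c) = UNIV"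
proof -
  have 1: "w \<otimes> f \<in> cvs.span (\<Union>c. eigenspace E c)" if w: "Y \<beta> 0 w = b *\<^sub>C w" for w b f
  proof -
    have "f \<in> cvs.span (range word)" by (simp add: span_word)
    then show ?thesis
    proof (induction rule: cvs.span_induct_alt)
      case base
      show ?case by (simp add: cvs.span_zero)
    next
      case (step k x y)
      obtain c where c: "mode F \<gamma> 0 x = c *\<^sub>C x" using step(1) gamma_word by blast
      have "E (w \<otimes> x) = (c + b) *\<^sub>C (w \<otimes> x)"
        by (simp add: E_pure w c pure_tensor_scale_left pure_tensor_scale_right cvs.scale_left_distrib)
      then have "w \<otimes> x \<in> (\<Union>c. eigenspace E c)" by (auto simp: eigenspace_def)
      then show ?case
        using step(2) by (simp add: pure_tensor_add_right pure_tensor_scale_right cvs.span_add cvs.span_scale cvs.span_base)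
    qed
  qed
  have 2: "w \<otimes> f \<in> cvs.span (\<Union>c. eigenspace E c)" for w f
  proof -
    have "w \<in> cvs.span {w. \<exists>c. Y \<beta> 0 w = c *\<^sub>C w}"
      using weight by (simp add: weight_module_def diagonalizable_def)
    then show ?thesis
    proof (induction rule: cvs.span_induct_alt)
      case base
      show ?case by (simp add: cvs.span_zero)
    next
      case (step k x y)
      then show ?case
        using 1[of x] by (auto simp: pure_tensor_add_left pure_tensor_scale_left intro!: cvs.span_add cvs.span_scale)
    qed
  qed
  have "t \<in> cvs.span (\<Union>c. eigenspace E c)" for t
    by (induction t rule: tensor_induct) (auto intro: 2 cvs.span_add)
  then show ?thesis by blast
qed

subsection \<open>Submodules are invariant under quadratic operators\<close>

lemma range_h_mode: "s \<in> range h \<Longrightarrow> t \<in> range h \<Longrightarrow> tensor_action (mode M) (mode F) s n t \<in> range h"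
  by (metis h_mode imageE rangeI)

lemma subspace_range_h: "cvs.subspace (range h)"
  unfolding cvs.subspace_def
  by (auto simp flip: clinear_0[OF clinear_h] clinear_add[OF clinear_h] clinear_scale[OF clinear_h])

text \<open>This current acts on the Clifford factor alone, which allows the two factors to be
  differentiated separately.\<close>

lemma gamma_range_h: "vacuum M \<otimes> \<gamma> \<in> range h"
proof -
  have "vacuum M \<otimes> \<gamma> = (1 / 2) *\<^sub>C h (g gl_E) + h (g gl_N)"
    unfolding h_generators
    by (simp add: cvs.scale_right_distrib cvs.scale_right_diff_distrib flip: cvs.scale_left_distrib)
  also have "\<dots> \<in> range h"
    by (intro cvs.subspace_add[OF subspace_range_h] cvs.subspace_scale[OF subspace_range_h] rangeI)
  finally show ?thesis .
qed

abbreviation D where "D \<equiv> \<lambda>v. mode M v (- 2) (vacuum M)"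

text \<open>The current \<gamma> differentiates \<open>y\<close> alone; the mode -2 on the vacuum
  differentiates the whole tensor. The difference is the tensor with \<open>x\<close>
  differentiated.\<close>

lemma derivative_range_h:
  assumes "x \<otimes> y \<in> range h" and y: "mode F \<gamma> (- 1) y = \<epsilon> *\<^sub>C mode F y (- 2) (vacuum F)" and \<epsilon>: "\<epsilon> \<noteq> 0"
  shows "(D ^^ i) x \<otimes> y \<in> range h"
proof (induction i)
  case 0
  show ?case using assms by simp
next
  case (Suc i)
  let ?x = "(D ^^ i) x"
  note sub = subspace_range_h
  have "tensor_action (mode M) (mode F) (vacuum M \<otimes> \<gamma>) (- 1) (?x \<otimes> y) = ?x \<otimes> mode F \<gamma> (- 1) y"
    unfolding tensor_action_pure[OF action_M action_F]
    by (subst Sum_any_single[of "- 1"]) (use module_M in \<open>auto simp: vertex_module_def\<close>)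
  then have "\<epsilon> *\<^sub>C (?x \<otimes> mode F y (- 2) (vacuum F)) \<in> range h"
    using range_h_mode[OF gamma_range_h Suc, of "- 1"] by (simp add: y pure_tensor_scale_right)
  from cvs.subspace_scale[OF sub this, of "inverse \<epsilon>"]
  have 1: "?x \<otimes> mode F y (- 2) (vacuum F) \<in> range h"
    using \<epsilon> by simp
  have "tensor_action (mode M) (mode F) (?x \<otimes> y) (- 2) (vacuum M \<otimes> vacuum F) =
      Sum_any (\<lambda>i. mode M ?x i (vacuum M) \<otimes> mode F y (- 3 - i) (vacuum F))"
    unfolding tensor_action_pure[OF action_M action_F] by simp
  \<comment> \<open>Only negative modes act nontrivially on a vacuum, so both \<open>i\<close> and
    \<open>- 3 - i\<close> have to be negative.\<close>
  also have "\<dots> = (\<Sum>i\<in>{- 1, - 2}. mode M ?x i (vacuum M) \<otimes> mode F y (- 3 - i) (vacuum F))"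
  proof (rule Sum_any_superset)
    fix i :: int assume "i \<notin> {- 1, - 2}"
    then have "i \<ge> 0 \<or> - 3 - i \<ge> 0" by auto
    then show "mode M ?x i (vacuum M) \<otimes> mode F y (- 3 - i) (vacuum F) = 0"
      by (elim disjE) (simp_all only: mode_M_vacuum mode_vacuum pure_tensor_0)
  qed simp
  also have "\<dots> = ?x \<otimes> mode F y (- 2) (vacuum F) + (D ^^ Suc i) x \<otimes> y"
    by (simp add: mode_M_vacuum mode_vacuum)
  finally have "?x \<otimes> mode F y (- 2) (vacuum F) + (D ^^ Suc i) x \<otimes> y \<in> range h"
    using range_h_mode[OF Suc rangeI[of h "vacuum V"], of "- 2"] by (simp add: h_vacuum)
  from cvs.subspace_diff[OF sub this 1] show ?case by simp
qed

text \<open>For fixed \<open>m + n\<close>, suitable modes of the tensors with \<open>i\<close>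
  derivatives on \<open>x\<close> act by the same finitely many products of modes of
  \<open>x\<close> and \<open>y\<close>, weighted by polynomials of degree \<open>i\<close>.
  Interpolation extracts each product.\<close>

lemma quadratic_invariant:
  assumes S: "submodule act S" and s: "s \<in> S"
    and xy: "x \<otimes> y \<in> range h" "mode F \<gamma> (- 1) y = \<epsilon> *\<^sub>C mode F y (- 2) (vacuum F)" "\<epsilon> \<noteq> 0"
  shows "tensor_map (Y x m) (mode F y n) s \<in> S"
proof -
  define f where "f i = tensor_map (Y x i) (mode F y (m + n - i)) s" for i
  have "f m \<in> S"
  proof (rule interpolation_in_subspace)
    show "cvs.subspace S" using S by (simp add: submodule_def)
    show "finite {i. f i \<noteq> 0}"
      using finite_tensor_action_expand[OF action_Y action_F, of x y "m + n + 1" s] by (simp add: f_def)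
    fix i
    let ?x = "(D ^^ i) x"
    obtain v where v: "h v = ?x \<otimes> y" using derivative_range_h[OF xy, of i] by (metis imageE)
    \<comment> \<open>The 1 is the offset of the tensor action; the \<open>i\<close> compensates for
      the index shift of \<open>i\<close> derivatives.\<close>
    have "act v (m + n + 1 + int i) s = Sum_any (\<lambda>k. tensor_map (Y ?x k) (mode F y (m + n + 1 + int i - 1 - k)) s)"
      unfolding act_def v by (rule tensor_action_expand[OF action_Y action_F])
    also have "\<dots> = Sum_any (\<lambda>k. tensor_map (Y ?x (k + int i)) (mode F y (m + n + 1 + int i - 1 - (k + int i))) s)"
      by (rule Sum_any_reindex_bij) (rule o_bij[of "\<lambda>k. k - int i"]; auto)
    also have "\<dots> = Sum_any (\<lambda>k. (\<Prod>j<i. - of_int (k + int j + 1)) *\<^sub>C f k)"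
    proof (rule arg_cong[where f = Sum_any], rule ext)
      fix k
      let ?c = "\<Prod>j<i. - of_int (k + int j + 1) :: complex"
      have "tensor_map (Y ?x (k + int i)) (mode F y (m + n - k)) s = ?c *\<^sub>C tensor_map (Y x k) (mode F y (m + n - k)) s"
        by (rule clinear_eq_tensorI)
          (simp_all add: clinear_tensor_map clinear_scaled lin_ops tensor_map_pure derivative_iterate pure_tensor_scale_left)
      moreover have "m + n + 1 + int i - 1 - (k + int i) = m + n - k" by simp
      ultimately show "tensor_map (Y ?x (k + int i)) (mode F y (m + n + 1 + int i - 1 - (k + int i))) s = ?c *\<^sub>C f k"
        by (simp only: f_def)
    qed
    finally have "Sum_any (\<lambda>k. (\<Prod>j<i. - of_int (k + int j + 1)) *\<^sub>C f k) = act v (m + n + 1 + int i) s"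
      by (rule sym)
    also have "\<dots> \<in> S"
      using S s by (auto simp: submodule_def)
    finally show "Sum_any (\<lambda>k. (\<Prod>j<i. - of_int (k + int j + 1)) *\<^sub>C f k) \<in> S" .
  qed
  then show ?thesis by (simp add: f_def)
qed

lemma tensor_map_ops: "tensor_map (Y a m) (mode F \<psi> n) t = opA m (opP n t)"
  "tensor_map (Y astar m) (mode F \<psi>s n) t = opAs m (opPs n t)"
  by (induction t rule: tensor_induct)
    (simp_all add: tensor_map_pure lin_ops clinear_add[OF clinear_tensor_map[OF action_clinear[OF action_Y] action_clinear[OF action_F]]])

context
  fixes S assumes S: "submodule act S"
begin

lemma sub: "cvs.subspace S"
  using S by (simp add: submodule_def)

lemma A_P: "s \<in> S \<Longrightarrow> opA m (opP n s) \<in> S"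
  using quadratic_invariant[OF S, of s a \<psi> 1 m n] h_generators(1) gamma_minus_1
  by (simp add: tensor_map_ops) (metis rangeI)

lemma As_Ps: "s \<in> S \<Longrightarrow> opAs m (opPs n s) \<in> S"
  using quadratic_invariant[OF S, of s astar \<psi>s "- 1" m n] h_generators(2) gamma_minus_1
  by (simp add: tensor_map_ops) (metis rangeI)

text \<open>Insert \<open>\<psi>(r) \<psi>\<^sup>*(-r)\<close> with \<open>r\<close> so large that \<open>\<psi>(r)\<close> kills the vector.\<close>

lemma A_As: assumes s: "s \<in> S" shows "opA m (opAs k s) \<in> S"
proof -
  obtain K where K: "\<And>n. n \<ge> K \<Longrightarrow> opP n s = 0" using opP_truncation by blast
  have "opA m (opP K (opAs k (opPs (- K - 1) s))) \<in> S"
    using s by (intro A_P As_Ps)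
  also have "opA m (opP K (opAs k (opPs (- K - 1) s))) = opA m (opAs k s)"
    by (simp add: op_commute(3)[symmetric] opP_opPs K)
  finally show ?thesis .
qed

text \<open>The same insertion with a Weyl pair: as \<open>opAs K\<close> kills \<open>s\<close>,
  the commutator leaves the scalar -1.\<close>

lemma Ps_P: assumes s: "s \<in> S" shows "opPs l (opP n s) \<in> S"
proof -
  obtain K where K: "\<And>n. n \<ge> K \<Longrightarrow> opAs n s = 0" using opAs_truncation by blast
  have "opAs K (opPs l (opA (- K - 1) (opP n s))) \<in> S"
    using s by (intro A_P As_Ps)
  also have "opAs K (opPs l (opA (- K - 1) (opP n s))) = opPs l (opP n (opAs K (opA (- K - 1) s)))"
    by (simp add: op_commute)
  also have "opAs K (opA (- K - 1) s) = - s"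
    using opA_opAs[of "- K - 1" K s] by (simp add: K eq_neg_iff_add_eq_0 add.commute)
  finally show ?thesis
    using cvs.subspace_neg[OF sub, of "- opPs l (opP n s)"] by simp
qed

end

section \<open>Raising and lowering operators for E(0)\<close>

definition raising where "raising = range opAs \<union> range opP"
definition lowering where "lowering = range opA \<union> range opPs"

lemma clinear_raising: "x \<in> raising \<Longrightarrow> clinear x" and clinear_lowering: "x \<in> lowering \<Longrightarrow> clinear x"
  by (auto simp: raising_def lowering_def clinear_op)

lemma E_raising: "x \<in> raising \<Longrightarrow> E (x w) = x (E w) + 1 *\<^sub>C x w"
  and E_lowering: "x \<in> lowering \<Longrightarrow> E (x w) = x (E w) + (- 1) *\<^sub>C x w"
  by (auto simp: raising_def lowering_def E_op)

text \<open>The sign is -1 only for two Clifford modes. That \<epsilon> is nonzero is recorded so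
  that the relation can be solved for the opposite order.\<close>

lemma lowering_raising:
  assumes "y \<in> lowering" "x \<in> raising"
  obtains \<epsilon> c where "\<epsilon> \<noteq> 0" "\<And>w. y (x w) = \<epsilon> *\<^sub>C x (y w) + c *\<^sub>C w"
proof -
  have 1: "\<exists>\<epsilon> c. \<epsilon> \<noteq> 0 \<and> (\<forall>w. opA m (opAs n w) = \<epsilon> *\<^sub>C opAs n (opA m w) + c *\<^sub>C w)" for m n
    by (rule exI[of _ 1], rule exI[of _ "if m + n + 1 = 0 then 1 else 0"]) (simp add: opA_opAs)
  have 2: "\<exists>\<epsilon> c. \<epsilon> \<noteq> 0 \<and> (\<forall>w. opPs m (opP n w) = \<epsilon> *\<^sub>C opP n (opPs m w) + c *\<^sub>C w)" for m n
    by (rule exI[of _ "- 1"], rule exI[of _ "if n + m + 1 = 0 then 1 else 0"]) (simp add: opP_opPs)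
  have 3: "\<exists>\<epsilon> c. \<epsilon> \<noteq> 0 \<and> (\<forall>w. opA m (opP n w) = \<epsilon> *\<^sub>C opP n (opA m w) + c *\<^sub>C w)" for m n
    by (rule exI[of _ 1], rule exI[of _ 0]) (simp add: op_commute)
  have 4: "\<exists>\<epsilon> c. \<epsilon> \<noteq> 0 \<and> (\<forall>w. opPs m (opAs n w) = \<epsilon> *\<^sub>C opAs n (opPs m w) + c *\<^sub>C w)" for m n
    by (rule exI[of _ 1], rule exI[of _ 0]) (simp add: op_commute)
  have "\<exists>\<epsilon> c. \<epsilon> \<noteq> 0 \<and> (\<forall>w. y (x w) = \<epsilon> *\<^sub>C x (y w) + c *\<^sub>C w)"
    using assms 1 2 3 4 unfolding raising_def lowering_def by blast
  then show thesis using that by blast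
qed

lemma submodule_lowering_raising:
  assumes S: "submodule act S" and yx: "y \<in> lowering" "x \<in> raising" and s: "s \<in> S"
  shows "y (x s) \<in> S" "x (y s) \<in> S"
proof -
  show yxs: "y (x s) \<in> S"
    using yx A_P[OF S s] As_Ps[OF S s] A_As[OF S s] Ps_P[OF S s]
    unfolding raising_def lowering_def by (auto simp: op_commute(4)[symmetric])
  obtain \<epsilon> c where e: "\<epsilon> \<noteq> 0" "\<And>w. y (x w) = \<epsilon> *\<^sub>C x (y w) + c *\<^sub>C w"
    using lowering_raising[OF yx] by blast
  have "x (y s) = inverse \<epsilon> *\<^sub>C (y (x s) - c *\<^sub>C s)"
    using e by simp
  also have "\<dots> \<in> S"
    by (intro cvs.subspace_scale[OF sub[OF S]] cvs.subspace_diff[OF sub[OF S]] yxs s)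
  finally show "x (y s) \<in> S" .
qed

subsection \<open>Irreducibility under the Weyl and Clifford modes\<close>

definition opcre where "opcre x = (if snd x then opP else opPs) (- int (fst x) - 1)"
definition opann where "opann x = (if snd x then opPs else opP) (int (fst x))"

lemma opcre_pure [simp]: "opcre x (w \<otimes> f) = w \<otimes> cre x f" and opann_pure [simp]: "opann x (w \<otimes> f) = w \<otimes> ann x f"
  by (simp_all add: opcre_def opann_def cre_def ann_def)

lemma clinear_opcre: "clinear (opcre x)" and clinear_opann: "clinear (opann x)"
  by (simp_all add: opcre_def opann_def clinear_op)

lemma opann_opann: "opann x (opann y t) = - opann y (opann x t)"
proof (induction t rule: tensor_induct)
  case (pure w f)
  show ?case by (simp add: ann_ann[of x y] tensor_minus_right)
next
  case (add s t)
  then show ?case by (simp add: clinear_add[OF clinear_opann])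
qed

lemma opann_opcre: "opann x (opcre x t) = t - opcre x (opann x t)"
  by (induction t rule: tensor_induct)
    (simp_all add: ann_cre clinear_diff[OF clinear_pure_right] clinear_add[OF clinear_opann] clinear_add[OF clinear_opcre])

text \<open>By truncation only finitely many annihilators act nontrivially on \<open>t\<close>. They
  anticommute and square to zero, so applying one of these gives a nonzero vector killed by it and
  by all that killed \<open>t\<close> before.\<close>

lemma kill_by_annihilators:
  assumes T: "\<And>x t. t \<in> T \<Longrightarrow> opann x t \<in> T" and t: "t \<in> T" "t \<noteq> 0"
  obtains t' where "t' \<in> T" "t' \<noteq> 0" "\<And>x. opann x t' = 0"
proof -
  have "\<exists>t'\<in>T. t' \<noteq> 0 \<and> (\<forall>x. opann x t' = 0)"
    if "finite I" "t \<in> T" "t \<noteq> 0" "\<forall>x. x \<notin> I \<longrightarrow> opann x t = 0" for I t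
    using that
  proof (induction I arbitrary: t rule: finite_induct)
    case empty
    then show ?case by blast
  next
    case (insert x I)
    show ?case
    proof (cases "opann x t = 0")
      case True
      show ?thesis
        by (rule insert.IH) (use insert.prems True in auto)
    next
      case False
      have "opann z (opann x t) = 0" if "z \<notin> I" for z
      proof (cases "z = x")
        case True
        then show ?thesis by (simp only: self_neg_eq_0[OF opann_opann])
      next
        case False
        then have "opann z t = 0" using insert.prems that by blast
        then show ?thesis by (simp add: opann_opann[of z x t] clinear_0[OF clinear_opann])
      qed
      then show ?thesis
        using insert.IH[OF T[OF insert.prems(1)] False] by simp
    qed
  qed
  moreover have "\<exists>I. finite I \<and> (\<forall>x. x \<notin> I \<longrightarrow> opann x t = 0)"
  proof -
    obtain K L where K: "\<And>n. n \<ge> K \<Longrightarrow> opP n t = 0" and L: "\<And>n. n \<ge> L \<Longrightarrow> opPs n t = 0"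
      using opP_truncation opPs_truncation by metis
    have "opann x t = 0" if "x \<notin> {..nat (max K L)} \<times> UNIV" for x
      using that K[of "int (fst x)"] L[of "int (fst x)"] by (cases x) (auto simp: opann_def)
    then show ?thesis
      by (intro exI[of _ "{..nat (max K L)} \<times> UNIV"]) auto
  qed
  ultimately show thesis using t that by blast
qed

text \<open>The operators \<open>opann x \<circ> opcre x\<close> are commuting projections, which fix a vector killed by all
  annihilators and together cut it down to \<open>\<N> \<otimes> 1\<close>.\<close>

lemma killed_by_annihilators:
  assumes kill: "\<And>x. opann x t = 0"
  obtains w where "t = w \<otimes> vacuum F"
proof -
  define Sp :: "_ \<Rightarrow> ('n, 'f) tensor set" where "Sp W = cvs.span {w \<otimes> word u |w u. u \<in> W}" for W :: "(nat \<times> bool) list set"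
  have mono: "Sp W \<subseteq> Sp W'" if "W \<subseteq> W'" for W W'
    unfolding Sp_def by (rule cvs.span_mono) (use that in blast)
  have pure: "\<exists>W. finite W \<and> w \<otimes> f \<in> Sp W" for w f
  proof -
    have "f \<in> cvs.span (range word)" by (simp add: span_word)
    then show ?thesis
    proof (induction rule: cvs.span_induct_alt)
      case base
      show ?case by (intro exI[of _ "{}"]) (simp add: Sp_def cvs.span_zero)
    next
      case (step c x y)
      obtain W where W: "finite W" "w \<otimes> y \<in> Sp W" using step(2) by blast
      obtain u where u: "x = word u" using step(1) by blast
      have "w \<otimes> x \<in> Sp (insert u W)" "w \<otimes> y \<in> Sp (insert u W)"
        using W(2) mono[of W "insert u W"] by (auto simp: Sp_def u intro: cvs.span_base)
      then have "w \<otimes> (c *\<^sub>C x + y) \<in> Sp (insert u W)"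
        unfolding pure_tensor_add_right pure_tensor_scale_right Sp_def
        by (intro cvs.span_add cvs.span_scale)
      then show ?case using W(1) by blast
    qed
  qed
  have ex: "\<exists>W. finite W \<and> t \<in> Sp W" for t
  proof (induction t rule: tensor_induct)
    case (add s t)
    then obtain W W' where "finite W" "finite W'" "s \<in> Sp W" "t \<in> Sp W'" by blast
    moreover from this have "s \<in> Sp (W \<union> W')" "t \<in> Sp (W \<union> W')"
      using mono[of W "W \<union> W'"] mono[of W' "W \<union> W'"] by auto
    ultimately show ?case
      by (intro exI[of _ "W \<union> W'"]) (auto simp: Sp_def intro: cvs.span_add)
  qed (rule pure)
  have proj: "opann x (opcre x s) \<in> Sp {u \<in> W. x \<notin> set u}" if "s \<in> Sp W" for s W x
    using that unfolding Sp_def[of W]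
  proof (induction rule: cvs.span_induct_alt)
    case base
    show ?case by (simp add: clinear_0[OF clinear_opann] clinear_0[OF clinear_opcre] Sp_def cvs.span_zero)
  next
    case (step c z z')
    obtain w u where z: "z = w \<otimes> word u" "u \<in> W" using step(1) by blast
    have "opann x (opcre x z) \<in> Sp {u \<in> W. x \<notin> set u}"
      using z by (auto simp: ann_cre_word Sp_def intro: cvs.span_zero cvs.span_base)
    then show ?case
      unfolding clinear_add[OF clinear_opcre] clinear_scale[OF clinear_opcre]
        clinear_add[OF clinear_opann] clinear_scale[OF clinear_opann]
      using step(2) unfolding Sp_def by (intro cvs.span_add cvs.span_scale)
  qed
  have fixed: "opann x (opcre x t) = t" for x
    by (simp add: opann_opcre kill clinear_0[OF clinear_opcre])
  \<comment> \<open>The projection for a letter of some nonempty word in \<open>W\<close> fixes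
    \<open>t\<close> and discards that word, so \<open>W\<close> shrinks until at most the empty
    word is left.\<close>
  have "t \<in> Sp {[]}" if "finite W" "t \<in> Sp W" for W
    using that
  proof (induction W rule: finite_psubset_induct)
    case (psubset W)
    show ?case
    proof (cases "W \<subseteq> {[]}")
      case True
      then show ?thesis using mono psubset.prems by blast
    next
      case False
      then obtain u where u: "u \<in> W" "u \<noteq> []" by auto
      then have x: "hd u \<in> set u" by simp
      have "t \<in> Sp {u' \<in> W. hd u \<notin> set u'}"
        using proj[OF psubset.prems, of "hd u"] by (simp add: fixed)
      moreover have "{u' \<in> W. hd u \<notin> set u'} \<subset> W" using u(1) x by blast
      ultimately show ?thesis by (rule psubset.IH[rotated])
    qed
  qed
  then have "t \<in> Sp {[]}" using ex by blast
  moreover have "Sp {[]} \<subseteq> range (\<lambda>w. w \<otimes> vacuum F)"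
    unfolding Sp_def
  proof (rule cvs.span_minimal)
    show "cvs.subspace (range (\<lambda>w. w \<otimes> vacuum F))"
    proof -
      have "0 \<in> range (\<lambda>w. w \<otimes> vacuum F)"
        by (rule range_eqI[of _ _ 0]) simp
      then show ?thesis
        by (auto simp: cvs.subspace_def simp flip: pure_tensor_add_left pure_tensor_scale_left)
    qed
  qed auto
  ultimately show thesis using that by blast
qed

text \<open>Annihilators produce a nonzero vector of \<N> \<otimes> 1 in \<open>T\<close>;
  irreducibility of \<N> gives all of \<N> \<otimes> 1, and creators then give all words.\<close>

lemma operator_irreducible:
  assumes T: "cvs.subspace T" and nz: "T \<noteq> {0}"
    and inv: "\<And>x t. x \<in> raising \<union> lowering \<Longrightarrow> t \<in> T \<Longrightarrow> x t \<in> T"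
  shows "T = UNIV"
proof -
  have ops: "opA n t \<in> T" "opAs n t \<in> T" "opP n t \<in> T" "opPs n t \<in> T" if "t \<in> T" for n t
    using inv that by (auto simp: raising_def lowering_def)
  then have ann: "opann x t \<in> T" and cre: "opcre x t \<in> T" if "t \<in> T" for x t
    using that by (auto simp: opann_def opcre_def)
  obtain t where "t \<in> T" "t \<noteq> 0"
    using nz cvs.subspace_0[OF T] by auto
  then obtain t' where t': "t' \<in> T" "t' \<noteq> 0" "\<And>x. opann x t' = 0"
    using kill_by_annihilators[OF ann] by blast
  obtain w where w: "t' = w \<otimes> vacuum F"
    using killed_by_annihilators t'(3) by blast
  define U where "U = {w. w \<otimes> vacuum F \<in> T}"
  have "cvs.subspace U"
    using T by (auto simp: U_def cvs.subspace_def pure_tensor_add_left pure_tensor_scale_left)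
  moreover have "Y a n w \<in> U" "Y astar n w \<in> U" if "w \<in> U" for n w
    using ops(1,2)[of "w \<otimes> vacuum F" n] that by (auto simp: U_def)
  ultimately have "submodule Y U"
    by (intro submodule_generators)
  moreover have "w \<in> U" "w \<noteq> 0"
    using t'(1,2) w by (auto simp: U_def)
  then have "U \<noteq> {0}" by blast
  ultimately have U: "U = UNIV"
    using irr unfolding irreducible_module_def irreducible_submodule_def by blast
  have word: "w \<otimes> word u \<in> T" for w u
  proof (induction u)
    case Nil
    show ?case using U by (auto simp: U_def)
  next
    case (Cons x u)
    then show ?case using cre[of "w \<otimes> word u" x] by simp
  qed
  have pure: "w \<otimes> f \<in> T" for w f
  proof -
    have "f \<in> cvs.span (range word)" by (simp add: span_word)
    then show ?thesis
      by (induction rule: cvs.span_induct_alt)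
        (auto simp: pure_tensor_add_right pure_tensor_scale_right word
          intro!: cvs.subspace_0[OF T] cvs.subspace_add[OF T] cvs.subspace_scale[OF T])
  qed
  have "t \<in> T" for t
    by (induction t rule: tensor_induct) (auto intro: pure cvs.subspace_add[OF T])
  then show ?thesis by blast
qed

lemma irreducible_eigenspace:
  assumes "eigenspace E c \<noteq> {0}"
  shows "irreducible_submodule act (eigenspace E c)"
  unfolding irreducible_submodule_def
proof (intro conjI allI impI)
  show "submodule act (eigenspace E c)" by (rule submodule_eigenspace)
  show "eigenspace E c \<noteq> {0}" by fact
  fix S assume SE: "S \<subseteq> eigenspace E c" and S: "submodule act S"
  have subS: "cvs.subspace S" by (rule sub[OF S])
  show "S = {0} \<or> S = eigenspace E c"
  proof (rule disjCI)
    assume "S \<noteq> eigenspace E c"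
    show "S = {0}"
    proof (rule ccontr)
      assume nz: "S \<noteq> {0}"
      define T where "T = cvs.span (\<Union>k. level raising S k \<union> level lowering S k)"
      have ST: "S \<subseteq> T"
        unfolding T_def using level.simps(1)[of raising S] by (blast intro: cvs.span_base)
      have "T = UNIV"
      proof (rule operator_irreducible)
        show "cvs.subspace T" by (simp add: T_def)
        show "T \<noteq> {0}" using nz ST cvs.subspace_0[OF subS] by blast
        fix x t assume "x \<in> raising \<union> lowering" "t \<in> T"
        then show "x t \<in> T"
        proof (elim UnE)
          assume x: "x \<in> raising"
          show ?thesis
            unfolding T_def
          proof (rule span_level_invariant[OF subS clinear_raising clinear_lowering _ _ x \<open>t \<in> T\<close>[unfolded T_def]])
            fix x y assume xy: "x \<in> raising" "y \<in> lowering"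
            obtain \<epsilon> c where e: "\<epsilon> \<noteq> 0" "\<And>w. y (x w) = \<epsilon> *\<^sub>C x (y w) + c *\<^sub>C w"
              using lowering_raising[OF xy(2,1)] by blast
            \<comment> \<open>The exchange relation solved for the other order.\<close>
            have "x (y w) = inverse \<epsilon> *\<^sub>C y (x w) + (- inverse \<epsilon> * c) *\<^sub>C w" for w
              using e by (simp add: cvs.scale_right_distrib)
            then show "\<exists>\<epsilon> c. \<forall>w. x (y w) = \<epsilon> *\<^sub>C y (x w) + c *\<^sub>C w" by blast
          qed (use submodule_lowering_raising(2)[OF S] in auto)
        next
          assume x: "x \<in> lowering"
          have "x t \<in> cvs.span (\<Union>k. level lowering S k \<union> level raising S k)"
          proof (rule span_level_invariant[OF subS clinear_lowering clinear_raising _ _ x])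
            show "t \<in> cvs.span (\<Union>k. level lowering S k \<union> level raising S k)"
              using \<open>t \<in> T\<close> by (simp add: T_def Un_commute)
            fix x y assume "x \<in> lowering" "y \<in> raising"
            from lowering_raising[OF this] show "\<exists>\<epsilon> c. \<forall>w. x (y w) = \<epsilon> *\<^sub>C y (x w) + c *\<^sub>C w"
              by metis
          qed (use submodule_lowering_raising(1)[OF S] in auto)
          then show ?thesis by (simp add: T_def Un_commute)
        qed
      qed
      have "w \<in> S" if w: "w \<in> eigenspace E c" for w
      proof (rule invariant_subspace_meets_eigenspace[OF clinear_E subS SE clinear_raising E_raising
            clinear_lowering E_lowering _ w])
        show "w \<in> cvs.span (\<Union>k. level raising S k \<union> level lowering S k)"
          using \<open>T = UNIV\<close> unfolding T_def by blast
      qed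
      then have "eigenspace E c \<subseteq> S" by blast
      then show False using SE \<open>S \<noteq> eigenspace E c\<close> by blast
    qed
  qed
qed

lemma completely_reducible_act: "completely_reducible V act"
  unfolding completely_reducible_def
proof (intro conjI exI ballI)
  \<comment> \<open>The zero space does not count as irreducible, so values that are not eigenvalues
    are left out.\<close>
  define \<S> where "\<S> = {eigenspace E c |c. eigenspace E c \<noteq> {0}}"
  have zero: "0 \<in> eigenspace E c" for c
    by (rule cvs.subspace_0[OF subspace_eigenspace[OF clinear_E]])
  show "vertex_module V act" by (rule module_act)
  show "irreducible_submodule act S" if "S \<in> \<S>" for S
    using that irreducible_eigenspace by (auto simp: \<S>_def)
  show "S \<inter> cvs.span (\<Union>(\<S> - {S})) = {0}" if S: "S \<in> \<S>" for S
  proof -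
    obtain c where c: "S = eigenspace E c" using S by (auto simp: \<S>_def)
    have "\<Union>(\<S> - {S}) \<subseteq> (\<Union>d\<in>- {c}. eigenspace E d)"
      by (auto simp: \<S>_def c)
    then have "cvs.span (\<Union>(\<S> - {S})) \<subseteq> cvs.span (\<Union>d\<in>- {c}. eigenspace E d)"
      by (rule cvs.span_mono)
    then show ?thesis
      using eigenspace_independent[OF clinear_E, of _ c] zero[of c] cvs.span_zero by (auto simp: c)
  qed
  have "(\<Union>c. eigenspace E c) \<subseteq> insert 0 (\<Union>\<S>)"
    by (auto simp: \<S>_def)
  then have "cvs.span (\<Union>c. eigenspace E c) \<subseteq> cvs.span (insert 0 (\<Union>\<S>))"
    by (rule cvs.span_mono)
  then show "cvs.span (\<Union>\<S>) = UNIV"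
    by (simp add: span_eigenspaces top.extremum_unique)
qed

end

theorem theorem1p2:
  fixes M :: "'m::complex_space vertex_structure" and a astar :: 'm
    and F :: "'f::complex_space vertex_structure" and \<psi> \<psi>s :: 'f
    and V :: "'v::complex_space vertex_structure" and g :: "gl11 \<Rightarrow> 'v"
    and h :: "'v \<Rightarrow> ('m, 'f) tensor"
    and Y :: "'m \<Rightarrow> int \<Rightarrow> 'n::complex_space \<Rightarrow> 'n"
  assumes "weyl_vertex_algebra M a astar"
    and "clifford_vertex_superalgebra F \<psi> \<psi>s"
    and "simple_affine_gl11 1 V g"
    and "gl11_realization V g M a astar F \<psi> \<psi>s h"
    and "irreducible_module M Y"
    and "weight_module M a astar Y"
  shows "completely_reducible V (\<lambda>v. tensor_action Y (mode F) (h v))"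
proof -
  interpret realization F \<psi> \<psi>s M a astar Y V g h
    by unfold_locales (use assms in \<open>auto simp: irreducible_module_def\<close>)
  show ?thesis
    using completely_reducible_act by (simp add: act_def[abs_def])
qed

end
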